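(* Let $X$ be a finite multiset of nonzero vectors spanning $\mathbb{R}^n$, let $B_0$ be an ordered basis of $\mathbb{R}^n$, let $X'=X\sqcup B_0$ with a total order $\prec$ as in the context, let $\mathcal{H}(X',\lambda)$ be a simple hyperplane arrangement, and let $\mathbb{I}'$ be a semi-external subset of $\mathbb{I}(X)$ with $\mathbb{B}(X)\subset\mathbb{I}'\subset\mathbb{I}(X)$. Then: 1. The polynomials $(Q_I)_{I\in\mathbb{I}'}$ form a basis for $\mathcal{P}_+(X,\mathbb{I}')$. In particular, $\dim\mathcal{P}_+(X,\mathbb{I}')=\#\mathbb{I}'$. The Hilbert series of $\mathcal{P}_+(X,\mathbb{I}')$ is determined by these polynomials: for every integer $j\ge 0$, $$\dim(\mathcal{P}_+(X,\mathbb{I}')\cap\Pi_j^0)=\#\{I\in\mathbb{I}':\ \mathrm{val}(I)=j\}.$$ 2. Let $V(\mathbb{I}')$ be the set of vertices of the arrangement $\mathcal{H}(X',\lambda)$ that correspond to the bases $\mathrm{ex}(I)$, $I\in\mathbb{I}'$. Then $\mathcal{D}_+(X,\mathbb{I}')=\Pi(V(\mathbb{I}'))$. In particular, $\dim\mathcal{D}_+(X,\mathbb{I}')=\#\mathbb{I}'$. 3. $\mathcal{J}_+(X,\mathbb{I}')\oplus\mathcal{P}_+(X,\mathbb{I}')=\Pi$. 4. $\mathcal{P}_+(X,\mathbb{I}')=\ker\mathcal{I}_+(X,\mathbb{I}')$. 5. The map $p\mapsto\langle p,\cdot\rangle$ is an isomorphism between $\mathcal{P}_+(X,\mathbb{I}')$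 and the dual space $\mathcal{D}_+(X,\mathbb{I}')^*$.
   Context: **Polynomials.** $\Pi=\mathbb{C}[t_1,\dots,t_n]$, and $\Pi_k^0$ is its subspace of homogeneous polynomials of degree $k$ (including $0$). For $p\in\Pi$, $p(D)$ is the constant-coefficient differential operator obtained by substituting $\partial/\partial t_i$ for $t_i$. For $p,q\in\Pi$, $\langle p,q\rangle:=(p(D)q)(0)$. For a homogeneous ideal $I\subset\Pi$, $\ker I:=\{q\in\Pi:\ p(D)q=0\text{ for all }p\in I\}$. For $x\in\mathbb{R}^n$, $p_x(t):=x\cdot t$ (standard inner product). For a finite multiset $Y$ of vectors, $p_Y:=\prod_{y\in Y}p_y$, with $p_\emptyset=1$. **The multiset $X$.** $X$ is a finite multiset of nonzero vectors spanning $\mathbb{R}^n$ (the columns of an $n\times N$ matrix of rank $n$). Repeated vectors are distinct elements of $X$, subsets of $X$ are submultisets, and cardinalities count multiplicities. $\mathbb{B}(X)$ is the collection of subsets of $X$ that are bases of $\mathbb{R}^n$. $\mathbb{I}(X)$ is the collection of all linearly independent subsets of $X$ (including $\emptyset$). For a subspace $S$, $X\setminus S$ is the multiset of elements of $X$ not in $S$. **Orders and extensions.** $B_0$ is an arbitrary basis of $\mathbb{R}^n$ with an arbitrary total order on its elements. $X':=X\sqcup B_0$ is the multiset union, with a total order $\prec$ extending the order on $B_0$ and satisfying $x\prec b$ for all $x\in X$, $b\in B_0$. For $I\in\mathbb{I}(X)$, $\mathrm{ex}(I)\in\mathbb{B}(X')$ is the greedy completion of $I$ by elements of $B_0$: $b\in\mathrm{ex}(I)$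 if and only if $b\in I$, or $b\in B_0$ and $b\notin\mathrm{span}(I\cup\{b'\in B_0:\ b'\prec b\})$. For $I\in\mathbb{I}(X)$ put $$X(I):=\{x\in X\setminus I:\ x\notin\mathrm{span}\{b\in I:\ b\prec x\}\},\quad Q_I:=p_{X(I)},\quad \mathrm{val}(I):=\#X(I).$$ **Semi-external collections.** $\mathbb{I}'\subset\mathbb{I}(X)$ is semi-external if: whenever $I\in\mathbb{I}'$, $I'\in\mathbb{I}(X)$ and $\mathrm{span}\,I\subset\mathrm{span}\,I'$, then $I'\in\mathbb{I}'$. **Facets and ideals.** A facet hyperplane of $X$ is an $(n-1)$-dimensional subspace spanned by a subset of $X$. $\mathcal{F}(X)$ is the set of these. For $F\in\mathcal{F}(X)$, $\eta_F$ is a nonzero normal to $F$ (unique up to scalar) and $m(F):=\#(X\setminus F)$. Define - $\mathcal{I}_+(X):=\mathrm{Ideal}\{p_{\eta_F}^{m(F)+1}:\ F\in\mathcal{F}(X)\}$. - $S(X,\mathbb{I}'):=\{\mathrm{span}\,I:\ I\in\mathbb{I}(X)\setminus\mathbb{I}'\}$. - For a subspace $S\subset\mathbb{R}^n$, $\Pi_j^0(S\perp):=\{p\in\Pi_j^0:\ D_\eta p=0\text{ for all }\eta\in S\}$, where $D_\eta$ is the directional derivative along $\eta$ (homogeneous polynomials of degree $j$ on the orthogonal complement of $S$). - $\mathcal{I}_+(X,\mathbb{I}'):=\mathcal{I}_+(X)+\mathrm{Ideal}\big(\bigcup_{S\in S(X,\mathbb{I}')}\Pi^0_{\#(X\setminus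 S)}(S\perp)\big)$. - $\mathcal{J}_+(X,\mathbb{I}'):=\mathrm{Ideal}\{p_Y:\ Y\subset X',\ Y\cap\mathrm{ex}(I)\ne\emptyset\text{ for all }I\in\mathbb{I}'\}$. - $\mathcal{P}_+(X,\mathbb{I}'):=\mathrm{span}\{p_Y:\ Y\subset X,\ Y\cap I=\emptyset\text{ for some }I\in\mathbb{I}'\}$. - $\mathcal{D}_+(X,\mathbb{I}'):=\ker\mathcal{J}_+(X,\mathbb{I}')$. **Hyperplane arrangement.** For $\lambda=(\lambda_x)_{x\in X'}\in\mathbb{R}^{X'}$, $\mathcal{H}(X',\lambda)$ is the arrangement of the hyperplanes $H_{x,\lambda_x}=\{t\in\mathbb{R}^n:\ p_x(t)=\lambda_x\}$, $x\in X'$. It is simple if the intersection of every subcollection of $m$ of these hyperplanes (indexed by elements of $X'$) is either empty or of codimension $m$. In that case the map sending $B\in\mathbb{B}(X')$ to the single point of $\bigcap_{b\in B}H_{b,\lambda_b}$ is a bijection onto the vertex set of the arrangement. The vertex corresponding to $B$ is this point. **The least map.** For a finite set $V\subset\mathbb{R}^n$, let $\mathrm{Exp}(V)$ be the span of the functions $t\mapsto e^{v\cdot t}$, $v\in V$. For $0\ne f\in\mathrm{Exp}(V)$ with homogeneous power expansion $f=\sum_{j\ge j_f}f_j$, $f_j\in\Pi_j^0$, $f_{j_f}\neq 0$, put $f_\downarrow:=f_{j_f}$. Then $\Pi(V):=\mathrm{span}\{f_\downarrow:\ f\in\mathrm{Exp}(V)\setminus 0\}$. *)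

theory Defs
  imports "HOL-Analysis.Analysis" "HOL-Library.Poly_Mapping"
begin

section \<open>Polynomials in n complex variables\<close>

text \<open>The variables \<open>t\<^sub>i\<close> are indexed by a finite type \<open>'n\<close>, so that \<open>n = CARD('n)\<close>. A polynomial is a
  finitely supported family of coefficients on exponent vectors; the ring structure on this type
  (convolution product) is that of \<^theory>\<open>HOL-Library.Poly_Mapping\<close>.\<close>

type_synonym 'n mon = "'n \<Rightarrow>\<^sub>0 nat"
type_synonym 'n cpoly = "'n mon \<Rightarrow>\<^sub>0 complex"

definition pscale :: "complex \<Rightarrow> 'n cpoly \<Rightarrow> 'n cpoly" where
  "pscale c p = Poly_Mapping.single 0 c * p"

interpretation cpoly: vector_space "pscale :: complex \<Rightarrow> 'n cpoly \<Rightarrow> 'n cpoly"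
  by unfold_locales
    (simp_all add: pscale_def distrib_left distrib_right single_add mult_single
      flip: mult.assoc)

text \<open>The ideal generated by a set of polynomials is its span in the ring as a module over itself.\<close>

interpretation ideal: module "(*) :: 'n cpoly \<Rightarrow> 'n cpoly \<Rightarrow> 'n cpoly"
  by unfold_locales (simp_all add: algebra_simps)

definition hom_polys :: "nat \<Rightarrow> 'n::finite cpoly set" where
  "hom_polys k = {p. \<forall>m \<in> Poly_Mapping.keys p. (\<Sum>i\<in>UNIV. Poly_Mapping.lookup m i) = k}"

definition peval :: "'n::finite cpoly \<Rightarrow> real ^ 'n \<Rightarrow> complex" where
  "peval p t = (\<Sum>m \<in> Poly_Mapping.keys p.
     Poly_Mapping.lookup p m * (\<Prod>i\<in>UNIV. complex_of_real (t $ i) ^ Poly_Mapping.lookup m i))"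

subsection \<open>Constant-coefficient differential operators\<close>

text \<open>The subtraction of exponents truncates at 0, but then the coefficient vanishes.\<close>

definition partial :: "'n \<Rightarrow> 'n cpoly \<Rightarrow> 'n cpoly" where
  "partial i p = (\<Sum>m \<in> Poly_Mapping.keys p.
     Poly_Mapping.single (m - Poly_Mapping.single i 1)
       (of_nat (Poly_Mapping.lookup m i) * Poly_Mapping.lookup p m))"

lemma lookup_partial:
  "Poly_Mapping.lookup (partial i p) k =
     of_nat (Suc (Poly_Mapping.lookup k i)) * Poly_Mapping.lookup p (k + Poly_Mapping.single i 1)"
proof -
  let ?e = "Poly_Mapping.single i (1::nat)"
  let ?g = "\<lambda>m. of_nat (Poly_Mapping.lookup m i) * Poly_Mapping.lookup p m"
  have iff: "Poly_Mapping.lookup (Poly_Mapping.single (m - ?e) (?g m)) k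
      = (if m = k + ?e then ?g m else 0)" for m
  proof (cases "Poly_Mapping.lookup m i = 0")
    case True
    then have "m \<noteq> k + ?e" by (auto simp: lookup_add)
    then show ?thesis using True by simp
  next
    case False
    have "m - ?e = k \<longleftrightarrow> m = k + ?e"
      using False by (auto intro!: poly_mapping_eqI
          simp: lookup_add lookup_minus lookup_single when_def)
    then show ?thesis by (auto simp: lookup_single when_def)
  qed
  have "Poly_Mapping.lookup (partial i p) k
      = (\<Sum>m \<in> Poly_Mapping.keys p. if m = k + ?e then ?g m else 0)"
    unfolding partial_def lookup_sum by (simp only: iff)
  also have "\<dots> = ?g (k + ?e)"
    by (simp add: in_keys_iff)
  finally show ?thesis by (simp add: lookup_add)
qed

lemma partial_commute: "partial i (partial j p) = partial j (partial i p)"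
  by (rule poly_mapping_eqI, cases "i = j")
    (simp_all add: lookup_partial lookup_add lookup_single add_ac)

text \<open>By this commutation the fold below does not depend on the order of the variables: it is
  \<open>\<partial>\<^bsup>m\<^esup> = \<Prod>\<^sub>i \<partial>\<^sub>i\<^bsup>m i\<^esup>\<close>.\<close>

definition partials :: "'n::finite mon \<Rightarrow> 'n cpoly \<Rightarrow> 'n cpoly" where
  "partials m p =
     Finite_Set.fold (\<lambda>i. partial i ^^ Poly_Mapping.lookup m i) p (UNIV :: 'n set)"

text \<open>\<open>diff_op p q\<close> is \<open>p(D) q\<close>.\<close>

definition diff_op :: "'n::finite cpoly \<Rightarrow> 'n cpoly \<Rightarrow> 'n cpoly" where
  "diff_op p q = (\<Sum>m \<in> Poly_Mapping.keys p. pscale (Poly_Mapping.lookup p m) (partials m q))"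

definition pairing :: "'n::finite cpoly \<Rightarrow> 'n cpoly \<Rightarrow> complex" where
  "pairing p q = peval (diff_op p q) 0"

definition dir_deriv :: "real ^ 'n \<Rightarrow> 'n::finite cpoly \<Rightarrow> 'n cpoly" where
  "dir_deriv \<eta> p = (\<Sum>i\<in>UNIV. pscale (complex_of_real (\<eta> $ i)) (partial i p))"

definition ker_ideal :: "'n::finite cpoly set \<Rightarrow> 'n cpoly set" where
  "ker_ideal J = {q. \<forall>p\<in>J. diff_op p q = 0}"

subsection \<open>Isomorphisms onto dual spaces\<close>

text \<open>Functionals on \<open>D\<close> are represented by functions that are \<open>undefined\<close> outside \<open>D\<close>, so that
  equality of functionals is equality of functions.\<close>

definition dual_space :: "'n::finite cpoly set \<Rightarrow> ('n cpoly \<Rightarrow> complex) set" where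
  "dual_space D = {f \<in> extensional D.
     (\<forall>p\<in>D. \<forall>q\<in>D. f (p + q) = f p + f q) \<and> (\<forall>c. \<forall>p\<in>D. f (pscale c p) = c * f p)}"

definition iso_onto_dual ::
    "('n::finite cpoly \<Rightarrow> 'n cpoly \<Rightarrow> complex) \<Rightarrow> 'n cpoly set \<Rightarrow> 'n cpoly set \<Rightarrow> bool" where
  "iso_onto_dual \<Phi> P D \<longleftrightarrow>
     bij_betw \<Phi> P (dual_space D) \<and>
     (\<forall>p\<in>P. \<forall>q\<in>P. \<Phi> (p + q) = (\<lambda>r\<in>D. \<Phi> p r + \<Phi> q r)) \<and>
     (\<forall>c. \<forall>p\<in>P. \<Phi> (pscale c p) = (\<lambda>r\<in>D. c * \<Phi> p r))"

section \<open>Multisets of vectors\<close>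

text \<open>A multiset of vectors is a set \<open>X\<close> of indices together with the map \<open>v\<close> from indices to vectors;
  indices of equal vectors are distinct elements. The total order on \<open>X'\<close> is the order of the
  (arbitrary) linearly ordered index type, and \<open>X' = X \<union> B0\<close> for disjoint index sets.\<close>

definition lin_form :: "real ^ 'n \<Rightarrow> 'n::finite cpoly" where
  "lin_form x =
     (\<Sum>i\<in>UNIV. Poly_Mapping.single (Poly_Mapping.single i 1) (complex_of_real (x $ i)))"

definition prod_form :: "('i \<Rightarrow> real ^ 'n) \<Rightarrow> 'i set \<Rightarrow> 'n::finite cpoly" where
  "prod_form v Y = (\<Prod>y\<in>Y. lin_form (v y))"

definition lin_indep :: "('i \<Rightarrow> real ^ 'n) \<Rightarrow> 'i set \<Rightarrow> bool" where
  "lin_indep v I \<longleftrightarrow> inj_on v I \<and> independent (v ` I)"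

definition is_basis :: "('i \<Rightarrow> real ^ 'n) \<Rightarrow> 'i set \<Rightarrow> bool" where
  "is_basis v B \<longleftrightarrow> lin_indep v B \<and> span (v ` B) = UNIV"

definition indep_subsets :: "('i \<Rightarrow> real ^ 'n) \<Rightarrow> 'i set \<Rightarrow> 'i set set" where
  "indep_subsets v X = {I. I \<subseteq> X \<and> lin_indep v I}"

definition bases :: "('i \<Rightarrow> real ^ 'n) \<Rightarrow> 'i set \<Rightarrow> 'i set set" where
  "bases v X = {B. B \<subseteq> X \<and> is_basis v B}"

definition greedy_ext ::
    "('i::linorder \<Rightarrow> real ^ 'n) \<Rightarrow> 'i set \<Rightarrow> 'i set \<Rightarrow> 'i set" where
  "greedy_ext v B0 I = I \<union> {b \<in> B0. v b \<notin> span (v ` (I \<union> {b' \<in> B0. b' < b}))}"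

definition active_set ::
    "('i::linorder \<Rightarrow> real ^ 'n) \<Rightarrow> 'i set \<Rightarrow> 'i set \<Rightarrow> 'i set" where
  "active_set v X I = {x \<in> X - I. v x \<notin> span (v ` {b \<in> I. b < x})}"

definition Q_poly ::
    "('i::linorder \<Rightarrow> real ^ 'n) \<Rightarrow> 'i set \<Rightarrow> 'i set \<Rightarrow> 'n::finite cpoly" where
  "Q_poly v X I = prod_form v (active_set v X I)"

definition val ::
    "('i::linorder \<Rightarrow> real ^ 'n) \<Rightarrow> 'i set \<Rightarrow> 'i set \<Rightarrow> nat" where
  "val v X I = card (active_set v X I)"

definition semi_external :: "('i \<Rightarrow> real ^ 'n) \<Rightarrow> 'i set \<Rightarrow> 'i set set \<Rightarrow> bool" where
  "semi_external v X \<I> \<longleftrightarrow> \<I> \<subseteq> indep_subsets v X \<and>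
     (\<forall>I\<in>\<I>. \<forall>I'\<in>indep_subsets v X. span (v ` I) \<subseteq> span (v ` I') \<longrightarrow> I' \<in> \<I>)"

section \<open>Ideals and polynomial spaces\<close>

definition facets :: "('i \<Rightarrow> real ^ 'n) \<Rightarrow> 'i set \<Rightarrow> (real ^ 'n) set set" where
  "facets v X = {span (v ` Y) | Y. Y \<subseteq> X \<and> dim (span (v ` Y)) = CARD('n) - 1}"

definition num_off :: "('i \<Rightarrow> real ^ 'n) \<Rightarrow> 'i set \<Rightarrow> (real ^ 'n) set \<Rightarrow> nat" where
  "num_off v X S = card {x \<in> X. v x \<notin> S}"

text \<open>All nonzero normals of a facet hyperplane are admitted; being proportional, they contribute
  associated generators.\<close>

definition ideal_I_plus :: "('i \<Rightarrow> real ^ 'n) \<Rightarrow> 'i set \<Rightarrow> 'n::finite cpoly set" where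
  "ideal_I_plus v X = ideal.span
     {lin_form \<eta> ^ (num_off v X F + 1) | F \<eta>.
        F \<in> facets v X \<and> \<eta> \<noteq> 0 \<and> (\<forall>y\<in>F. \<eta> \<bullet> y = 0)}"

definition missing_spans ::
    "('i \<Rightarrow> real ^ 'n) \<Rightarrow> 'i set \<Rightarrow> 'i set set \<Rightarrow> (real ^ 'n) set set" where
  "missing_spans v X \<I> = {span (v ` I) | I. I \<in> indep_subsets v X - \<I>}"

definition hom_polys_perp :: "nat \<Rightarrow> (real ^ 'n) set \<Rightarrow> 'n::finite cpoly set" where
  "hom_polys_perp j S = {p \<in> hom_polys j. \<forall>\<eta>\<in>S. dir_deriv \<eta> p = 0}"

definition semi_ideal_I ::
    "('i \<Rightarrow> real ^ 'n) \<Rightarrow> 'i set \<Rightarrow> 'i set set \<Rightarrow> 'n::finite cpoly set" where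
  "semi_ideal_I v X \<I> = {p + q | p q. p \<in> ideal_I_plus v X \<and>
     q \<in> ideal.span (\<Union>S \<in> missing_spans v X \<I>. hom_polys_perp (num_off v X S) S)}"

definition semi_ideal_J ::
    "('i::linorder \<Rightarrow> real ^ 'n) \<Rightarrow> 'i set \<Rightarrow> 'i set \<Rightarrow> 'i set set \<Rightarrow> 'n::finite cpoly set" where
  "semi_ideal_J v X B0 \<I> = ideal.span
     {prod_form v Y | Y. Y \<subseteq> X \<union> B0 \<and> (\<forall>I\<in>\<I>. Y \<inter> greedy_ext v B0 I \<noteq> {})}"

definition semi_space_P ::
    "('i \<Rightarrow> real ^ 'n) \<Rightarrow> 'i set \<Rightarrow> 'i set set \<Rightarrow> 'n::finite cpoly set" where
  "semi_space_P v X \<I> = cpoly.span {prod_form v Y | Y. Y \<subseteq> X \<and> (\<exists>I\<in>\<I>. Y \<inter> I = {})}"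

definition semi_space_D ::
    "('i::linorder \<Rightarrow> real ^ 'n) \<Rightarrow> 'i set \<Rightarrow> 'i set \<Rightarrow> 'i set set \<Rightarrow> 'n::finite cpoly set" where
  "semi_space_D v X B0 \<I> = ker_ideal (semi_ideal_J v X B0 \<I>)"

section \<open>Hyperplane arrangements and the least map\<close>

definition hyperplane :: "('i \<Rightarrow> real ^ 'n) \<Rightarrow> ('i \<Rightarrow> real) \<Rightarrow> 'i \<Rightarrow> (real ^ 'n) set" where
  "hyperplane v lam x = {t. v x \<bullet> t = lam x}"

definition simple_arrangement ::
    "('i \<Rightarrow> real ^ 'n) \<Rightarrow> ('i \<Rightarrow> real) \<Rightarrow> 'i set \<Rightarrow> bool" where
  "simple_arrangement v lam Z \<longleftrightarrow> (\<forall>Y \<subseteq> Z. (\<Inter>x\<in>Y. hyperplane v lam x) = {} \<or>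
     aff_dim (\<Inter>x\<in>Y. hyperplane v lam x) = int CARD('n) - int (card Y))"

definition vertex :: "('i \<Rightarrow> real ^ 'n) \<Rightarrow> ('i \<Rightarrow> real) \<Rightarrow> 'i set \<Rightarrow> real ^ 'n" where
  "vertex v lam B = (THE t. t \<in> (\<Inter>b\<in>B. hyperplane v lam b))"

text \<open>The span of the exponentials \<open>t \<mapsto> e\<^bsup>v\<cdot>t\<^esup>\<close>, for finite \<open>V\<close>.\<close>

definition exp_space :: "(real ^ 'n) set \<Rightarrow> (real ^ 'n \<Rightarrow> complex) set" where
  "exp_space V = {\<lambda>t. \<Sum>v\<in>V. c v * exp (complex_of_real (v \<bullet> t)) | c. True}"

definition hom_expansion ::
    "(real ^ 'n \<Rightarrow> complex) \<Rightarrow> (nat \<Rightarrow> 'n::finite cpoly) \<Rightarrow> bool" where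
  "hom_expansion f F \<longleftrightarrow>
     (\<forall>j. F j \<in> hom_polys j) \<and> (\<forall>t. (\<lambda>j. peval (F j) t) sums f t)"

definition least_term :: "(real ^ 'n \<Rightarrow> complex) \<Rightarrow> 'n::finite cpoly" where
  "least_term f =
     (THE p. \<exists>F j. hom_expansion f F \<and> (\<forall>i<j. F i = 0) \<and> F j \<noteq> 0 \<and> p = F j)"

definition least_space :: "(real ^ 'n) set \<Rightarrow> 'n::finite cpoly set" where
  "least_space V = cpoly.span {least_term f | f. f \<in> exp_space V \<and> f \<noteq> (\<lambda>t. 0)}"

end

theory Submission
  imports Defs
begin

text \<open>
  Write \<open>J\<close>, \<open>P\<close>, \<open>D\<close> for the ideal and the two spaces of the semi-external family \<open>\<I>\<close>, and \<open>N\<close> for the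
  number of its elements. Everything except the description of \<open>P\<close> as a kernel comes out of
  the inequalities
  \<open>N \<le> dim \<Pi>(V) \<le> dim D \<le> N\<close>,
  where \<open>V\<close> is the set of the \<open>N\<close> vertices. They are distinct since, by simplicity of the arrangement, a vertex
  lies on no hyperplane other than those of its basis (\<open>vertex_incidence\<close>).

  For the first inequality, an exponential sum whose coefficients are orthogonal to the values of
  the conjugates of all least terms would have a least term orthogonal to itself in a positive definite
  inner product (\<open>card_le_of_least_space_subset_span\<close>). For the second one, \<open>\<Pi>(V)\<close> is contained in \<open>D\<close>: a
  generator \<open>p\<^sub>Y\<close> of \<open>J\<close> is the leading part of \<open>\<Prod>\<^sub>y (p\<^sub>y - lam y)\<close>, which vanishes on \<open>V\<close>
  (\<open>diff_op_prod_form_least\<close>). For the third one, \<open>D\<close> is orthogonal to \<open>J\<close>, and every polynomial is in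
  \<open>J + P\<close> with \<open>P\<close> spanned by the \<open>N\<close> polynomials \<open>Q\<^sub>I\<close>; so an element of \<open>D\<close> that is orthogonal to
  all \<open>Q\<^sub>I\<close> is zero. Both statements about spanning follow from exchange arguments that replace a factor
  of \<open>p\<^sub>Y\<close> by smaller ones (\<open>semi_space_P_subset_span_Q\<close>, \<open>semi_ideal_J_plus_semi_space_P\<close>). Once the
  inequalities are equalities, the pairing matrix of the \<open>Q\<^sub>I\<close> with a basis of \<open>D\<close> is square and
  invertible (\<open>perfect_pairing\<close>): the \<open>Q\<^sub>I\<close> are independent modulo \<open>J\<close>, the sum of \<open>J\<close> and \<open>P\<close> is
  direct, and \<open>P\<close> is the dual of \<open>D\<close>.

  That \<open>q\<close> is in the kernel of the ideal means that its degree along the orthogonal complements of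
  certain subspaces \<open>S\<close> is bounded by the number of vectors outside \<open>S\<close>. Products \<open>p\<^sub>Y\<close> in \<open>P\<close> have this
  property for reasons of degree. The converse is proved by deletion and contraction of vectors
  (\<open>deg_conditions_imp_good_space\<close>), where contraction of \<open>W\<close> is computed in the same polynomial ring
  modulo the linear forms of \<open>W\<close>.
\<close>

(* As a rewrite rule, this law associates products of polynomials to the left and so conflicts
   with mult.assoc. *)
declare ideal.scale_scale [simp del]

section \<open>Monomials and induction on polynomials\<close>

abbreviation coef :: "('a \<Rightarrow>\<^sub>0 'b::zero) \<Rightarrow> 'a \<Rightarrow> 'b" where "coef \<equiv> Poly_Mapping.lookup"
abbreviation sing :: "'a \<Rightarrow> 'b \<Rightarrow> ('a \<Rightarrow>\<^sub>0 'b::zero)" where "sing \<equiv> Poly_Mapping.single"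

definition cvar :: "'n \<Rightarrow> 'n cpoly" where
  "cvar i = sing (sing i 1) 1"

abbreviation const :: "complex \<Rightarrow> 'n cpoly" where "const c \<equiv> sing 0 c"

definition mdeg :: "'n::finite mon \<Rightarrow> nat" where
  "mdeg m = (\<Sum>i\<in>UNIV. coef m i)"

lemma mdeg_0 [simp]: "mdeg 0 = 0"
  by (simp add: mdeg_def)

lemma mdeg_add: "mdeg (a + b) = mdeg a + mdeg b"
  by (simp add: mdeg_def lookup_add sum.distrib)

lemma mdeg_single [simp]: "mdeg (sing i k) = k"
  by (simp add: mdeg_def lookup_single when_def)

lemma mdeg_eq_0_iff: "mdeg m = 0 \<longleftrightarrow> m = 0"
  by (auto simp: mdeg_def intro: poly_mapping_eqI)

lemma mon_remove_var:
  fixes m :: "'n mon"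
  assumes "coef m i \<noteq> 0"
  shows "m = (m - sing i 1) + sing i 1"
  using assms by (auto intro!: poly_mapping_eqI simp: lookup_add lookup_minus lookup_single when_def)

text \<open>Monomials are built up one variable at a time, so that operators need to be understood only for single variables.\<close>

lemma mon_induct [case_names zero add_var]:
  fixes m :: "'n::finite mon"
  assumes "P 0" and step: "\<And>i m. P m \<Longrightarrow> P (m + sing i 1)"
  shows "P m"
proof (induction "mdeg m" arbitrary: m)
  case 0
  then show ?case using assms(1) by (simp add: mdeg_eq_0_iff)
next
  case (Suc d)
  then have "m \<noteq> 0" by auto
  then obtain i where i: "coef m i \<noteq> 0"
    by (metis lookup_zero poly_mapping_eqI)
  have eq: "m = (m - sing i 1) + sing i 1" using i by (rule mon_remove_var)
  then have "mdeg m = mdeg (m - sing i 1) + 1" by (metis mdeg_add mdeg_single)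
  with Suc have "P (m - sing i 1)" by simp
  then show ?case using step eq by metis
qed

lemma cpoly_sum_induct [case_names single add]:
  fixes p :: "'n cpoly"
  assumes single: "\<And>m c. P (sing m c)" and add: "\<And>p q. P p \<Longrightarrow> P q \<Longrightarrow> P (p + q)"
  shows "P p"
proof (induction p rule: update_induct)
  case const
  show ?case using single[of 0 0] by simp
next
  case (update p m c)
  have "Poly_Mapping.update m c p = p + sing m c"
    using update(1) by (auto intro!: poly_mapping_eqI simp: lookup_update lookup_add lookup_single when_def in_keys_iff)
  then show ?case using add[OF update(3) single] by simp
qed

text \<open>The polynomial ring is generated by constants and variables. Every identity about products and
  about constant-coefficient operators below is reduced by this rule to multiplication by one variable.\<close>

lemma cpoly_induct [case_names const add var]:
  fixes p :: "'n::finite cpoly"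
  assumes const: "\<And>c. P (const c)" and add: "\<And>p q. P p \<Longrightarrow> P q \<Longrightarrow> P (p + q)"
    and var: "\<And>i p. P p \<Longrightarrow> P (cvar i * p)"
  shows "P p"
proof (induction p rule: cpoly_sum_induct)
  case (single m c)
  show ?case
  proof (induction m rule: mon_induct)
    case zero show ?case by (rule const)
  next
    case (add_var i m)
    have "sing (m + sing i 1) c = cvar i * sing m c"
      by (simp add: cvar_def mult_single add.commute)
    then show ?case using var[OF add_var] by simp
  qed
next
  case (add p q) then show ?case by (rule assms(2))
qed

section \<open>Partial derivatives\<close>

lemma coef_const_mult: "coef (const c * p) m = c * coef p m"
  for p :: "'n cpoly"
  by (induction p rule: cpoly_sum_induct)
    (auto simp: mult_single distrib_left lookup_add lookup_single when_def)

lemma coef_pscale [simp]: "coef (pscale c p) m = c * coef p m"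
  by (simp add: pscale_def coef_const_mult)

lemma partial_add: "partial i (p + q) = partial i p + partial i q"
  by (rule poly_mapping_eqI) (simp add: lookup_partial lookup_add algebra_simps)

lemma partial_0 [simp]: "partial i 0 = 0"
  by (rule poly_mapping_eqI) (simp add: lookup_partial)

lemma partial_pscale: "partial i (pscale c p) = pscale c (partial i p)"
  by (rule poly_mapping_eqI) (simp add: lookup_partial)

lemma partial_const [simp]: "partial i (const c) = 0"
  for i :: 'n
proof (rule poly_mapping_eqI)
  fix k :: "'n mon"
  have "k + sing i 1 \<noteq> 0"
  proof
    assume "k + sing i 1 = 0"
    then have "coef (k + sing i 1) i = 0" by (simp only: lookup_zero)
    then show False by (simp add: lookup_add lookup_single)
  qed
  then show "coef (partial i (const c)) k = coef 0 k"
    by (simp add: lookup_partial lookup_single when_def del: One_nat_def)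
qed

lemma partial_single:
  "partial i (sing m c) = sing (m - sing i 1) (of_nat (coef m i) * c)"
  by (cases "c = 0") (simp_all add: partial_def)

lemma partial_cvar_mult:
  "partial i (cvar j * p) = (if i = j then p else 0) + cvar j * partial i p"
proof (induction p rule: cpoly_sum_induct)
  case (single m c)
  have shift: "(sing j 1 + m) - sing i 1 = sing j 1 + (m - sing i (1::nat))"
    if "i \<noteq> j \<or> coef m i \<noteq> 0"
    using that by (auto intro!: poly_mapping_eqI simp: lookup_add lookup_minus lookup_single when_def)
  show ?case
  proof (cases "i = j \<and> coef m i = 0")
    case True
    then show ?thesis
      by (auto simp: cvar_def mult_single partial_single lookup_add)
  next
    case False
    have lhs: "partial i (cvar j * sing m c)
        = sing (sing j 1 + (m - sing i 1)) (of_nat (coef (sing j 1 + m) i) * c)"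
      using shift False by (auto simp: cvar_def mult_single partial_single)
    have rhs: "cvar j * partial i (sing m c)
        = sing (sing j 1 + (m - sing i 1)) (of_nat (coef m i) * c)"
      by (simp add: cvar_def mult_single partial_single)
    show ?thesis
    proof (cases "i = j")
      case True
      with False have "sing j 1 + (m - sing i (1::nat)) = m"
        using mon_remove_var[of m i] by (simp add: add.commute)
      moreover have "of_nat (coef (sing j 1 + m) i) * c = c + of_nat (coef m i) * c"
        using True by (simp add: lookup_add algebra_simps)
      ultimately show ?thesis using True unfolding lhs rhs by (simp add: single_add)
    next
      case False
      then show ?thesis unfolding lhs rhs by (simp add: lookup_add lookup_single)
    qed
  qed
next
  case (add p q)
  then show ?case by (auto simp: distrib_left partial_add algebra_simps)
qed

lemma partial_mult: "partial i (p * q) = partial i p * q + p * partial i q"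
  for p q :: "'n::finite cpoly"
proof (induction p rule: cpoly_induct)
  case (const c)
  then show ?case using partial_pscale[of i c q] by (simp add: pscale_def)
next
  case (add p q)
  then show ?case by (simp add: partial_add algebra_simps)
next
  case (var j p)
  have "partial i (cvar j * p * q) = (if i = j then p * q else 0) + cvar j * partial i (p * q)"
    unfolding mult.assoc by (rule partial_cvar_mult)
  also have "\<dots> = partial i (cvar j * p) * q + (cvar j * p) * partial i q"
    unfolding var partial_cvar_mult by (simp add: distrib_left distrib_right mult.assoc)
  finally show ?case .
qed

section \<open>The ring action of constant-coefficient operators\<close>

lemma partial_funpow_commute:
  "(partial i ^^ a) ((partial j ^^ b) p) = (partial j ^^ b) ((partial i ^^ a) p)"
proof -
  have one: "partial i ((partial j ^^ b) p) = (partial j ^^ b) (partial i p)" for p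
    by (induction b arbitrary: p) (simp_all add: partial_commute[of i j])
  show ?thesis by (induction a) (simp_all add: one)
qed

lemma comp_fun_commute_partials:
  "comp_fun_commute (\<lambda>i. partial i ^^ coef (m::'n mon) i)"
  by unfold_locales (auto simp: fun_eq_iff partial_funpow_commute)

lemma partials_0 [simp]: "partials 0 p = p"
proof -
  interpret comp_fun_commute "\<lambda>i. partial i ^^ coef (0::'a mon) i"
    by (rule comp_fun_commute_partials)
  have "Finite_Set.fold (\<lambda>i. partial i ^^ coef (0::'a mon) i) p A = p" if "finite A" for A
    using that
  proof (induction A)
    case (insert x A)
    then show ?case using fold_insert[OF insert(1,2), of p] by (simp add: id_def)
  qed simp
  then show ?thesis unfolding partials_def by simp
qed

text \<open>The fold over the variables may be evaluated in any order, so the additional derivative can be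
  taken last.\<close>

lemma partials_add_var: "partials (m + sing i 1) p = partial i (partials m p)"
proof -
  let ?f = "\<lambda>m i. partial i ^^ coef (m::'a mon) i"
  interpret a: comp_fun_commute "?f m" by (rule comp_fun_commute_partials)
  interpret b: comp_fun_commute "?f (m + sing i 1)" by (rule comp_fun_commute_partials)
  have U: "UNIV = insert i (UNIV - {i})" by auto
  have same: "Finite_Set.fold (?f (m + sing i 1)) p A = Finite_Set.fold (?f m) p A"
    if "finite A" "i \<notin> A" for A
    using that
  proof (induction A)
    case (insert x A)
    then have "?f (m + sing i 1) x = ?f m x" by (auto simp: lookup_add lookup_single when_def)
    with insert show ?case using a.fold_insert[of A x p] b.fold_insert[of A x p] by auto
  qed simp
  have "partials (m + sing i 1) p
      = ?f (m + sing i 1) i (Finite_Set.fold (?f (m + sing i 1)) p (UNIV - {i}))"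
    unfolding partials_def by (subst U, subst b.fold_insert) auto
  also have "\<dots> = partial i (?f m i (Finite_Set.fold (?f m) p (UNIV - {i})))"
    by (subst same) (auto simp: lookup_add)
  also have "\<dots> = partial i (partials m p)"
    using a.fold_insert[of "UNIV - {i}" i p] U unfolding partials_def by simp
  finally show ?thesis .
qed

lemma partials_add: "partials m (p + q) = partials m p + partials m q"
  by (induction m rule: mon_induct) (simp_all only: partials_0 partials_add_var partial_add)

lemma partials_zero [simp]: "partials m 0 = 0"
  by (induction m rule: mon_induct) (simp_all only: partials_0 partials_add_var partial_0)

lemma partials_pscale: "partials m (pscale c p) = pscale c (partials m p)"
  by (induction m rule: mon_induct) (simp_all only: partials_0 partials_add_var partial_pscale)

lemma diff_op_superset:
  assumes "finite K" "Poly_Mapping.keys p \<subseteq> K"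
  shows "diff_op p q = (\<Sum>m\<in>K. pscale (coef p m) (partials m q))"
  unfolding diff_op_def using assms
  by (intro sum.mono_neutral_left) (auto simp: in_keys_iff)

lemma diff_op_add_left: "diff_op (p + p') q = diff_op p q + diff_op p' q"
proof -
  let ?K = "Poly_Mapping.keys p \<union> Poly_Mapping.keys p' \<union> Poly_Mapping.keys (p + p')"
  show ?thesis
    using diff_op_superset[of ?K p q] diff_op_superset[of ?K p' q] diff_op_superset[of ?K "p + p'" q]
    by (simp add: le_supI1 le_supI2 lookup_add cpoly.scale_left_distrib sum.distrib)
qed

lemma diff_op_single: "diff_op (sing m c) q = pscale c (partials m q)"
  using diff_op_superset[of "{m}" "sing m c" q] by simp

lemma diff_op_const: "diff_op (const c) q = pscale c q"
  by (simp add: diff_op_single)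

lemma diff_op_one [simp]: "diff_op 1 q = q"
  using diff_op_const[of 1 q] by simp

lemma diff_op_zero_left [simp]: "diff_op 0 q = 0"
  by (simp add: diff_op_def)

lemma diff_op_add_right: "diff_op p (q + q') = diff_op p q + diff_op p q'"
  by (simp add: diff_op_def partials_add cpoly.scale_right_distrib sum.distrib)

lemma diff_op_zero_right [simp]: "diff_op p 0 = 0"
  by (simp add: diff_op_def)

lemma diff_op_pscale_right: "diff_op p (pscale c q) = pscale c (diff_op p q)"
  by (simp add: diff_op_def partials_pscale cpoly.scale_sum_right mult.commute)

lemma partial_sum: "partial i (\<Sum>a\<in>A. f a) = (\<Sum>a\<in>A. partial i (f a))"
  by (induction A rule: infinite_finite_induct) (simp_all add: partial_add)

lemma diff_op_cvar_mult: "diff_op (cvar i * p) q = partial i (diff_op p q)"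
proof (induction p rule: cpoly_sum_induct)
  case (single m c)
  then show ?case
    by (simp add: cvar_def mult_single diff_op_single partials_add_var partial_pscale add.commute
      del: One_nat_def)
next
  case (add p q)
  then show ?case by (simp add: distrib_left diff_op_add_left partial_add)
qed

text \<open>Together with additivity this makes the polynomials a module over themselves, \<open>p\<close> acting as
  \<open>p(D)\<close>; kernels of ideals are therefore determined by generators.\<close>

lemma diff_op_mult: "diff_op (p * r) q = diff_op p (diff_op r q)"
proof (induction p rule: cpoly_induct)
  case (const c)
  have "diff_op (const c * r) q = pscale c (diff_op r q)"
  proof (induction r rule: cpoly_sum_induct)
    case (single m d)
    show ?case by (simp add: mult_single diff_op_single)
  next
    case (add r r')
    then show ?case by (simp add: distrib_left diff_op_add_left cpoly.scale_right_distrib)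
  qed
  then show ?case by (simp add: diff_op_const)
next
  case (add p p')
  then show ?case by (simp add: distrib_right diff_op_add_left)
next
  case (var i p)
  then show ?case by (simp add: mult.assoc diff_op_cvar_mult)
qed

lemma diff_op_minus_right: "diff_op p (q - q') = diff_op p q - diff_op p q'"
  using diff_op_add_right[of p "q - q'" q'] by simp

lemma diff_op_pscale_left: "diff_op (pscale c p) q = pscale c (diff_op p q)"
  by (simp add: pscale_def diff_op_mult) (simp add: diff_op_const pscale_def)

lemma diff_op_sum_right: "diff_op p (\<Sum>a\<in>A. f a) = (\<Sum>a\<in>A. diff_op p (f a))"
  by (induction A rule: infinite_finite_induct) (simp_all add: diff_op_add_right)

lemma diff_op_sum_left: "diff_op (\<Sum>a\<in>A. f a) q = (\<Sum>a\<in>A. diff_op (f a) q)"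
  by (induction A rule: infinite_finite_induct) (simp_all add: diff_op_add_left)

section \<open>Linear forms and directional derivatives\<close>

lemma lin_form_eq: "lin_form x = (\<Sum>i\<in>UNIV. pscale (complex_of_real (x $ i)) (cvar i))"
  by (simp add: lin_form_def cvar_def pscale_def mult_single)

lemma diff_op_lin_form: "diff_op (lin_form x) q = dir_deriv x q"
proof -
  have "diff_op (cvar i) q = partial i q" for i
    using diff_op_cvar_mult[of i 1 q] by simp
  then show ?thesis by (simp add: lin_form_eq diff_op_sum_left diff_op_pscale_left dir_deriv_def)
qed

lemma lin_form_add: "lin_form (x + y) = lin_form x + lin_form y"
  by (simp add: lin_form_def single_add sum.distrib)

lemma lin_form_scaleR: "lin_form (c *\<^sub>R x) = pscale (complex_of_real c) (lin_form x)"
  by (simp add: lin_form_eq cpoly.scale_sum_right)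

lemma lin_form_0 [simp]: "lin_form 0 = 0"
  by (simp add: lin_form_def)

lemma lin_form_sum: "lin_form (\<Sum>a\<in>A. f a) = (\<Sum>a\<in>A. lin_form (f a))"
  by (induction A rule: infinite_finite_induct) (simp_all add: lin_form_add)

lemma lin_form_axis: "lin_form (axis i 1) = cvar i"
proof -
  have "lin_form (axis i 1) = (\<Sum>j\<in>UNIV. if j = i then cvar i else 0)"
    unfolding lin_form_eq by (rule sum.cong) (auto simp: axis_def)
  then show ?thesis by simp
qed

lemma dir_deriv_add: "dir_deriv x (p + q) = dir_deriv x p + dir_deriv x q"
  by (simp add: diff_op_add_right flip: diff_op_lin_form)

lemma dir_deriv_minus: "dir_deriv x (p - q) = dir_deriv x p - dir_deriv x q"
  by (simp add: diff_op_minus_right flip: diff_op_lin_form)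

lemma dir_deriv_zero [simp]: "dir_deriv x 0 = 0"
  by (simp flip: diff_op_lin_form)

lemma dir_deriv_pscale: "dir_deriv x (pscale c p) = pscale c (dir_deriv x p)"
  by (simp add: diff_op_pscale_right flip: diff_op_lin_form)

lemma dir_deriv_sum: "dir_deriv x (\<Sum>a\<in>A. f a) = (\<Sum>a\<in>A. dir_deriv x (f a))"
  by (simp add: diff_op_sum_right flip: diff_op_lin_form)

lemma dir_deriv_axis: "dir_deriv (axis i 1) p = partial i p"
  using diff_op_cvar_mult[of i 1 p] by (simp add: lin_form_axis flip: diff_op_lin_form)

lemma dir_deriv_add_dir: "dir_deriv (x + y) p = dir_deriv x p + dir_deriv y p"
  by (simp add: diff_op_add_left lin_form_add flip: diff_op_lin_form)

lemma dir_deriv_scaleR_dir: "dir_deriv (c *\<^sub>R x) p = pscale (complex_of_real c) (dir_deriv x p)"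
  by (simp add: diff_op_pscale_left lin_form_scaleR flip: diff_op_lin_form)

lemma dir_deriv_0_dir [simp]: "dir_deriv 0 p = 0"
  by (simp flip: diff_op_lin_form)

lemma dir_deriv_mult: "dir_deriv x (p * q) = dir_deriv x p * q + p * dir_deriv x q"
  unfolding dir_deriv_def partial_mult pscale_def distrib_left sum.distrib sum_distrib_left
    sum_distrib_right
  by (simp only: mult.assoc mult.left_commute)

lemma diff_op_dir_deriv: "diff_op p (dir_deriv x q) = dir_deriv x (diff_op p q)"
  by (simp add: mult.commute flip: diff_op_lin_form diff_op_mult)

lemma dir_deriv_lin_form: "dir_deriv x (lin_form y) = const (complex_of_real (x \<bullet> y))"
proof -
  have partial_lin: "partial i (lin_form y) = const (complex_of_real (y $ i))" for i
  proof -
    have "partial i (cvar j) = (if j = i then 1 else 0)" for j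
      using partial_cvar_mult[of i j 1] partial_const[of i 1] by auto
    then have "partial i (lin_form y) = (\<Sum>j\<in>UNIV. if j = i then const (complex_of_real (y $ i)) else 0)"
      unfolding lin_form_eq partial_sum partial_pscale
      by (intro sum.cong) (auto simp: pscale_def)
    then show ?thesis by simp
  qed
  have sum_const: "(\<Sum>i\<in>A. const (f i)) = const (\<Sum>i\<in>A. f i)" for f :: "'a \<Rightarrow> complex" and A
    by (induction A rule: infinite_finite_induct) (simp_all add: single_add)
  show ?thesis
    by (simp add: dir_deriv_def pscale_def mult_single inner_vec_def partial_lin sum_const)
qed

lemma partial_lin_form: "partial i (lin_form y) = const (complex_of_real (y $ i))"
  using dir_deriv_lin_form[of "axis i 1" y] by (simp add: dir_deriv_axis inner_axis')

text \<open>The Heisenberg commutation relation. All arguments on degrees rest on it: a linear form \<open>p\<^sub>y\<close> can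
  be pulled out of \<open>p(D)\<close> whenever \<open>D\<^sub>y p = 0\<close>, and otherwise the error term has lower order.\<close>

lemma diff_op_lin_form_mult:
  "diff_op p (lin_form y * q) = lin_form y * diff_op p q + diff_op (dir_deriv y p) q"
proof (induction p rule: cpoly_induct)
  case (const c)
  have "dir_deriv y (const c) = 0" by (simp add: dir_deriv_def)
  then show ?case
    by (simp add: diff_op_const) (simp add: pscale_def mult.left_commute)
next
  case (add p p')
  then show ?case by (simp add: diff_op_add_left dir_deriv_add distrib_left algebra_simps)
next
  case (var i p)
  have "dir_deriv y (cvar i * p) = const (complex_of_real (y $ i)) * p + cvar i * dir_deriv y p"
    by (simp add: dir_deriv_mult dir_deriv_lin_form inner_axis flip: lin_form_axis)
  then have "diff_op (dir_deriv y (cvar i * p)) q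
      = const (complex_of_real (y $ i)) * diff_op p q + partial i (diff_op (dir_deriv y p) q)"
    by (simp only: diff_op_add_left diff_op_mult[of "const _"] diff_op_const pscale_def diff_op_cvar_mult)
  moreover have "diff_op (cvar i * p) (lin_form y * q)
      = (const (complex_of_real (y $ i)) * diff_op p q + lin_form y * partial i (diff_op p q))
        + partial i (diff_op (dir_deriv y p) q)"
    by (simp only: diff_op_cvar_mult var partial_add partial_mult partial_lin_form)
  ultimately show ?case by (simp add: diff_op_cvar_mult)
qed

section \<open>Homogeneous polynomials\<close>

lemma hom_polys_iff: "p \<in> hom_polys k \<longleftrightarrow> (\<forall>m. coef p m \<noteq> 0 \<longrightarrow> mdeg m = k)"
  by (auto simp: hom_polys_def mdeg_def in_keys_iff)

lemma hom_0 [simp]: "0 \<in> hom_polys k"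
  by (simp add: hom_polys_iff)

lemma hom_add: "p \<in> hom_polys k \<Longrightarrow> q \<in> hom_polys k \<Longrightarrow> p + q \<in> hom_polys k"
  unfolding hom_polys_iff lookup_add by (metis add.left_neutral)

lemma hom_minus: "p \<in> hom_polys k \<Longrightarrow> q \<in> hom_polys k \<Longrightarrow> p - q \<in> hom_polys k"
  unfolding hom_polys_iff lookup_minus by (metis diff_self)

lemma hom_pscale: "p \<in> hom_polys k \<Longrightarrow> pscale c p \<in> hom_polys k"
  by (auto simp: hom_polys_iff)

lemma hom_sum: "(\<And>a. a \<in> A \<Longrightarrow> f a \<in> hom_polys k) \<Longrightarrow> (\<Sum>a\<in>A. f a) \<in> hom_polys k"
  by (induction A rule: infinite_finite_induct) (auto intro: hom_add)

lemma hom_mult: "p \<in> hom_polys j \<Longrightarrow> q \<in> hom_polys k \<Longrightarrow> p * q \<in> hom_polys (j + k)"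
  using keys_mult[of p q] unfolding hom_polys_def mdeg_def[symmetric]
  by (fastforce simp: mdeg_add)

lemma hom_const: "const c \<in> hom_polys 0"
  by (auto simp: hom_polys_iff lookup_single when_def)

lemma hom_one: "1 \<in> hom_polys 0"
  using hom_const[of 1] by simp

lemma hom_lin_form: "lin_form x \<in> hom_polys 1"
  unfolding lin_form_def
  by (intro hom_sum) (auto simp: hom_polys_iff lookup_single when_def split: if_splits)

lemma hom_power: "p \<in> hom_polys k \<Longrightarrow> p ^ a \<in> hom_polys (a * k)"
proof (induction a)
  case (Suc a)
  then show ?case using hom_mult[of p k "p ^ a" "a * k"] by simp
qed (simp add: hom_one)

lemma hom_prod_form: "finite Y \<Longrightarrow> prod_form v Y \<in> hom_polys (card Y)"
proof (induction Y rule: finite_induct)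
  case (insert y Y)
  then show ?case using hom_mult[OF hom_lin_form insert(3)] by (simp add: prod_form_def)
qed (simp add: prod_form_def hom_one)

lemma hom_0_eq_const:
  assumes "p \<in> hom_polys 0" shows "p = const (coef p 0)"
  using assms by (auto intro!: poly_mapping_eqI simp: hom_polys_iff lookup_single when_def mdeg_eq_0_iff)

lemma hom_partial: "p \<in> hom_polys (Suc k) \<Longrightarrow> partial i p \<in> hom_polys k"
  unfolding hom_polys_iff lookup_partial
  by (metis Suc_eq_plus1 add_right_cancel mdeg_add mdeg_single mult_zero_right)

lemma partial_hom_0: "p \<in> hom_polys 0 \<Longrightarrow> partial i p = 0"
  by (subst hom_0_eq_const) simp_all

lemma hom_dir_deriv: "p \<in> hom_polys (Suc k) \<Longrightarrow> dir_deriv x p \<in> hom_polys k"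
  unfolding dir_deriv_def by (intro hom_sum hom_pscale hom_partial)

lemma dir_deriv_hom_0: "p \<in> hom_polys 0 \<Longrightarrow> dir_deriv x p = 0"
  by (simp add: dir_deriv_def partial_hom_0)

text \<open>The quotients of factorials are the falling products that \<open>\<partial>\<^bsup>m\<^esup>\<close> produces; at \<open>k = 0\<close> they reduce to
  the factorials that make the pairing diagonal on monomials.\<close>

lemma coef_partials:
  "coef (partials m q) k = (\<Prod>i\<in>UNIV. fact (coef k i + coef m i) / fact (coef k i)) * coef q (k + m)"
proof (induction m arbitrary: k rule: mon_induct)
  case (add_var j m)
  let ?f = "\<lambda>k m i. fact (coef k i + coef m i) / fact (coef k i) :: complex"
  let ?e = "sing j 1 :: 'a mon"
  have j: "of_nat (Suc (coef k j)) * ?f (k + ?e) m j = ?f k (m + ?e) j"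
    by (simp add: lookup_add del: of_nat_Suc)
  have rest: "?f (k + ?e) m i = ?f k (m + ?e) i" if "i \<noteq> j" for i
    using that by (simp add: lookup_add lookup_single)
  have "of_nat (Suc (coef k j)) * (\<Prod>i\<in>UNIV. ?f (k + ?e) m i) = (\<Prod>i\<in>UNIV. ?f k (m + ?e) i)"
    unfolding prod.remove[OF finite UNIV_I, of _ j] mult.assoc[symmetric] j
    by (intro arg_cong2[of _ _ _ _ "(*)"] prod.cong rest) auto
  moreover have "k + (m + ?e) = k + ?e + m" by (simp only: ac_simps)
  ultimately show ?case
    unfolding partials_add_var lookup_partial add_var mult.assoc[symmetric] by simp
qed simp

lemma partials_high_degree:
  assumes "\<And>m'. coef q m' \<noteq> 0 \<Longrightarrow> mdeg m' < mdeg m"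
  shows "partials m q = 0"
proof (rule poly_mapping_eqI)
  fix k
  have "coef q (k + m) = 0"
    using assms[of "k + m"] by (auto simp: mdeg_add)
  then show "coef (partials m q) k = coef 0 k" by (simp add: coef_partials)
qed

lemma diff_op_high_degree:
  assumes "p \<in> hom_polys j" "\<And>m'. coef q m' \<noteq> 0 \<Longrightarrow> mdeg m' < j"
  shows "diff_op p q = 0"
proof -
  have "partials m q = 0" if "m \<in> Poly_Mapping.keys p" for m
    using that assms by (intro partials_high_degree) (auto simp: hom_polys_iff in_keys_iff)
  then show ?thesis by (simp add: diff_op_def)
qed

lemma diff_op_hom_less:
  assumes "p \<in> hom_polys j" "q \<in> hom_polys k" "k < j"
  shows "diff_op p q = 0"
  using assms by (intro diff_op_high_degree) (auto simp: hom_polys_iff)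

lemma diff_op_eventually_0:
  fixes q :: "'n::finite cpoly"
  obtains d where "\<And>j (p :: 'n cpoly). d \<le> j \<Longrightarrow> p \<in> hom_polys j \<Longrightarrow> diff_op p q = 0"
proof
  let ?d = "Suc (Max (insert 0 (mdeg ` Poly_Mapping.keys q)))"
  fix j and p :: "'n cpoly" assume j: "?d \<le> j" "p \<in> hom_polys j"
  show "diff_op p q = 0"
  proof (rule diff_op_high_degree[OF j(2)])
    fix m' assume "coef q m' \<noteq> 0"
    then have "mdeg m' \<le> Max (insert 0 (mdeg ` Poly_Mapping.keys q))"
      by (intro Max_ge) (auto simp: in_keys_iff)
    then show "mdeg m' < j" using j by simp
  qed
qed

text \<open>Euler's identity recovers a homogeneous polynomial of positive degree from its partial derivatives.\<close>

lemma euler_identity: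
  assumes "p \<in> hom_polys k"
  shows "(\<Sum>i\<in>UNIV. cvar i * partial i p) = pscale (of_nat k) p"
proof -
  have coef: "coef (cvar i * partial i p) m = of_nat (coef m i) * coef p m" for i m and p :: "'a cpoly"
  proof (induction p rule: cpoly_sum_induct)
    case (single n c)
    show ?case
    proof (cases "coef n i = 0")
      case True
      then show ?thesis by (auto simp: partial_single lookup_single when_def)
    next
      case False
      have "sing i 1 + (n - sing i 1) = n"
        using mon_remove_var[OF False] by (simp add: add.commute)
      then show ?thesis by (auto simp: cvar_def mult_single partial_single lookup_single when_def)
    qed
  next
    case (add p q)
    then show ?case by (simp add: partial_add distrib_left lookup_add)
  qed
  show ?thesis
  proof (rule poly_mapping_eqI)
    fix m
    have "coef (\<Sum>i\<in>UNIV. cvar i * partial i p) m = of_nat (mdeg m) * coef p m"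
      by (simp add: lookup_sum coef mdeg_def sum_distrib_right)
    also have "\<dots> = coef (pscale (of_nat k) p) m"
      using assms by (auto simp: hom_polys_iff)
    finally show "coef (\<Sum>i\<in>UNIV. cvar i * partial i p) m = coef (pscale (of_nat k) p) m" .
  qed
qed

lemma hom_eq_0_if_partials_0:
  assumes "p \<in> hom_polys k" "0 < k" "\<And>i. partial i p = 0"
  shows "p = 0"
  using euler_identity[OF assms(1)] assms(2,3) by simp

section \<open>The pairing\<close>

lemma peval_0_right: "peval p 0 = coef p 0"
proof -
  have "(\<Prod>i\<in>UNIV. (0::complex) ^ coef m i) = (if m = 0 then 1 else 0)" for m :: "'a mon"
    by (auto simp: poly_mapping_eq_iff fun_eq_iff intro!: prod.neutral)
  then have "peval p 0 = (\<Sum>m\<in>Poly_Mapping.keys p. if m = 0 then coef p m else 0)"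
    unfolding peval_def by (intro sum.cong) auto
  then show ?thesis by (simp add: in_keys_iff)
qed

lemma pairing_eq_coef: "pairing p q = coef (diff_op p q) 0"
  by (simp add: pairing_def peval_0_right)

lemma pairing_add_left: "pairing (p + p') q = pairing p q + pairing p' q"
  by (simp add: pairing_eq_coef diff_op_add_left lookup_add)

lemma pairing_add_right: "pairing p (q + q') = pairing p q + pairing p q'"
  by (simp add: pairing_eq_coef diff_op_add_right lookup_add)

lemma pairing_pscale_left: "pairing (pscale c p) q = c * pairing p q"
  by (simp add: pairing_eq_coef diff_op_pscale_left)

lemma pairing_pscale_right: "pairing p (pscale c q) = c * pairing p q"
  by (simp add: pairing_eq_coef diff_op_pscale_right)

lemma pairing_sum_left: "pairing (\<Sum>a\<in>A. f a) q = (\<Sum>a\<in>A. pairing (f a) q)"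
  by (simp add: pairing_eq_coef diff_op_sum_left lookup_sum)

lemma pairing_sum_right: "pairing p (\<Sum>a\<in>A. f a) = (\<Sum>a\<in>A. pairing p (f a))"
  by (simp add: pairing_eq_coef diff_op_sum_right lookup_sum)

lemma pairing_zero_left [simp]: "pairing 0 q = 0"
  by (simp add: pairing_eq_coef)

text \<open>The pairing is diagonal in the monomial basis, with nonzero diagonal entries; hence it is nondegenerate.\<close>

lemma pairing_monomial: "pairing (sing m c) q = c * (\<Prod>i\<in>UNIV. fact (coef m i)) * coef q m"
  by (simp add: pairing_eq_coef diff_op_single coef_partials)

lemma pairing_nondegenerate:
  assumes "\<And>p. pairing p q = 0"
  shows "q = 0"
proof (rule poly_mapping_eqI)
  fix m
  show "coef q m = coef 0 m"
    using assms[of "sing m 1"] by (simp add: pairing_monomial)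
qed

lemma ker_ideal_span:
  "q \<in> ker_ideal (ideal.span G) \<longleftrightarrow> (\<forall>g\<in>G. diff_op g q = 0)"
proof
  assume "q \<in> ker_ideal (ideal.span G)"
  then show "\<forall>g\<in>G. diff_op g q = 0" by (auto simp: ker_ideal_def ideal.span_base)
next
  assume G: "\<forall>g\<in>G. diff_op g q = 0"
  have "diff_op p q = 0" if "p \<in> ideal.span G" for p
    using that
  proof (induction rule: ideal.span_induct_alt)
    case (step c g r)
    then show ?case using G by (simp add: diff_op_add_left diff_op_mult)
  qed simp
  then show "q \<in> ker_ideal (ideal.span G)" by (auto simp: ker_ideal_def)
qed

section \<open>Polynomials on an orthogonal complement\<close>

lemma hom_polys_perp_iff:
  "p \<in> hom_polys_perp j S \<longleftrightarrow> p \<in> hom_polys j \<and> (\<forall>\<eta>\<in>S. dir_deriv \<eta> p = 0)"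
  by (simp add: hom_polys_perp_def)

lemma perp_antimono: "S \<subseteq> S' \<Longrightarrow> hom_polys_perp j S' \<subseteq> hom_polys_perp j S"
  by (fastforce simp: hom_polys_perp_iff)

lemma dir_deriv_power:
  "dir_deriv x (l ^ Suc a) = const (of_nat (Suc a)) * l ^ a * dir_deriv x l"
  for l :: "'n::finite cpoly"
proof (induction a)
  case (Suc a)
  have "dir_deriv x (l ^ Suc (Suc a)) = dir_deriv x l * l ^ Suc a + l * dir_deriv x (l ^ Suc a)"
    by (simp only: power_Suc[of l "Suc a"] dir_deriv_mult)
  also have "\<dots> = (1 + const (of_nat (Suc a))) * l ^ Suc a * dir_deriv x l"
    unfolding Suc by (simp add: algebra_simps)
  also have "1 + const (of_nat (Suc a)) = (const (of_nat (Suc (Suc a))) :: 'n cpoly)"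
    using single_add[of "0 :: 'n mon" 1 "of_nat (Suc a) :: complex"] by (simp add: add.commute)
  finally show ?case .
qed simp

text \<open>Take the component of \<open>x\<close> orthogonal to \<open>S\<close> and scale it.\<close>

lemma orthogonal_component:
  fixes x :: "real ^ 'n"
  assumes "subspace S" "x \<notin> S"
  obtains z where "\<And>s. s \<in> S \<Longrightarrow> s \<bullet> z = 0" "x \<bullet> z = 1"
proof -
  obtain y z where yz: "y \<in> span S" "\<And>w. w \<in> span S \<Longrightarrow> orthogonal z w" "x = y + z"
    using orthogonal_subspace_decomp_exists[of S x] by metis
  have S: "span S = S" using assms(1) by (simp add: span_eq_iff)
  have "z \<noteq> 0" using yz assms S by auto
  then have xz: "x \<bullet> z \<noteq> 0" using yz by (simp add: inner_add_left orthogonal_def inner_commute[of y z])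
  show ?thesis
    using yz(2) S xz
    by (intro that[of "inverse (x \<bullet> z) *\<^sub>R z"]) (auto simp: orthogonal_def inner_commute)
qed

text \<open>With \<open>l\<close> a linear form that is constant along \<open>S\<close> and satisfies \<open>D\<^sub>x l = 1\<close>, integration by parts
  gives an antiderivative of \<open>l\<^sup>a p\<close> from one of \<open>l\<^bsup>a+1\<^esup> D\<^sub>x p\<close>. Since \<open>D\<^sub>x p\<close> has smaller degree, this
  ends, provided that the statement is proved for all powers \<open>a\<close> together.\<close>

lemma perp_antiderivative:
  assumes S: "subspace S" "x \<notin> S" and p: "p \<in> hom_polys_perp d S"
  obtains P where "P \<in> hom_polys_perp (Suc d) S" "dir_deriv x P = p"
proof -
  obtain z where z: "\<And>s. s \<in> S \<Longrightarrow> s \<bullet> z = 0" "x \<bullet> z = 1"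
    using orthogonal_component[OF S] by blast
  let ?l = "lin_form z"
  have Dl: "dir_deriv x ?l = 1" "\<And>s. s \<in> S \<Longrightarrow> dir_deriv s ?l = 0"
    using z by (simp_all add: dir_deriv_lin_form)
  have DA: "dir_deriv x (pscale (inverse (of_nat (Suc a))) (?l ^ Suc a * q))
      = ?l ^ a * q + pscale (inverse (of_nat (Suc a))) (?l ^ Suc a * dir_deriv x q)" for a q
  proof -
    have "dir_deriv x (?l ^ Suc a * q) = pscale (of_nat (Suc a)) (?l ^ a * q) + ?l ^ Suc a * dir_deriv x q"
      unfolding dir_deriv_mult dir_deriv_power Dl pscale_def by (simp only: mult.assoc mult_1_right)
    then show ?thesis
      by (simp add: dir_deriv_pscale cpoly.scale_right_distrib del: of_nat_Suc power_Suc)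
  qed
  have DS: "dir_deriv s (pscale c (?l ^ Suc a * q)) = pscale c (?l ^ Suc a * dir_deriv s q)"
    if "s \<in> S" for s c a q
    using Dl(2)[OF that] by (simp add: dir_deriv_pscale dir_deriv_mult dir_deriv_power del: power_Suc)
  have la: "?l ^ a \<in> hom_polys a" for a
    using hom_power[OF hom_lin_form, where a=a] by simp
  have "\<exists>P \<in> hom_polys_perp (Suc (a + d)) S. dir_deriv x P = ?l ^ a * p" for a
    using p
  proof (induction d arbitrary: a p)
    case (0 a p)
    let ?P = "pscale (inverse (of_nat (Suc a))) (?l ^ Suc a * p)"
    have "dir_deriv s p = 0" for s
      using 0 by (intro dir_deriv_hom_0) (auto simp: hom_polys_perp_iff)
    moreover have "?P \<in> hom_polys (Suc a + 0)"
      using 0 by (intro hom_pscale hom_mult la) (auto simp: hom_polys_perp_iff)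
    ultimately show ?case using DS DA
      by (intro bexI[of _ ?P]) (simp_all add: hom_polys_perp_iff del: of_nat_Suc power_Suc)
  next
    case (Suc d a p)
    let ?c = "inverse (of_nat (Suc a)) :: complex"
    have comm: "dir_deriv s (dir_deriv x p) = dir_deriv x (dir_deriv s p)" for s
      using diff_op_dir_deriv[of "lin_form s" x p] by (simp add: diff_op_lin_form)
    then have "dir_deriv x p \<in> hom_polys_perp d S"
      using Suc.prems by (simp add: hom_polys_perp_iff hom_dir_deriv)
    from Suc.IH[OF this, of "Suc a"] obtain R where
      R: "R \<in> hom_polys_perp (Suc (Suc a + d)) S" "dir_deriv x R = ?l ^ Suc a * dir_deriv x p" by auto
    let ?P = "pscale ?c (?l ^ Suc a * p) - pscale ?c R"
    have "?P \<in> hom_polys (Suc a + Suc d)"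
      using Suc.prems R by (intro hom_mult hom_pscale hom_minus la) (auto simp: hom_polys_perp_iff)
    moreover have "dir_deriv s ?P = 0" if "s \<in> S" for s
    proof -
      have "dir_deriv s p = 0" "dir_deriv s R = 0"
        using Suc.prems R that by (auto simp: hom_polys_perp_iff)
      then show ?thesis unfolding dir_deriv_minus DS[OF that] by (simp add: dir_deriv_pscale)
    qed
    moreover have "dir_deriv x ?P = ?l ^ a * p"
      unfolding dir_deriv_minus DA using R by (simp add: dir_deriv_pscale)
    ultimately show ?case
      by (intro bexI[of _ ?P]) (simp_all add: hom_polys_perp_iff del: of_nat_Suc power_Suc)
  qed
  from this[of 0] show ?thesis using that by auto
qed

text \<open>By Euler's identity a polynomial of degree \<open>j + 1\<close> on the complement of \<open>S\<close> is a combination of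
  variables times its partial derivatives, which are polynomials of degree \<open>j\<close> on that complement.\<close>

lemma diff_op_perp_upward:
  assumes k: "\<And>p. p \<in> hom_polys_perp k S \<Longrightarrow> diff_op p q = 0"
    and "k \<le> j" "p \<in> hom_polys_perp j S"
  shows "diff_op p q = 0"
  using assms(2,3)
proof (induction j arbitrary: p rule: dec_induct)
  case base then show ?case by (rule k)
next
  case (step j p)
  have "partial i p \<in> hom_polys_perp j S" for i
  proof -
    have "dir_deriv s (partial i p) = partial i (dir_deriv s p)" for s
      using diff_op_dir_deriv[of "lin_form s" "axis i 1" p] by (simp add: diff_op_lin_form dir_deriv_axis)
    then show ?thesis using step.prems by (simp add: hom_polys_perp_iff hom_partial)
  qed
  then have 0: "diff_op (cvar i * partial i p) q = 0" for i
    using step.IH by (simp add: diff_op_mult)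
  have "pscale (of_nat (Suc j)) (diff_op p q) = diff_op (\<Sum>i\<in>UNIV. cvar i * partial i p) q"
    using step.prems euler_identity[of p "Suc j"] by (simp add: hom_polys_perp_iff diff_op_pscale_left)
  also have "\<dots> = 0" by (simp add: diff_op_sum_left 0)
  finally show ?case by (simp del: of_nat_Suc)
qed

text \<open>The orthogonal complement of a hyperplane is a line, on which a homogeneous polynomial is a multiple
  of a power of the coordinate. This makes powers of normals and the spaces \<open>\<Pi>\<^sup>0\<^sub>k(F\<bottom>)\<close> interchangeable
  as generators of the ideals.\<close>

lemma perp_hyperplane:
  fixes \<eta> :: "real ^ 'n"
  assumes F: "span (insert \<eta> F) = UNIV" and \<eta>: "\<eta> \<noteq> 0" "\<And>y. y \<in> F \<Longrightarrow> \<eta> \<bullet> y = 0"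
  shows "p \<in> hom_polys_perp k F \<Longrightarrow> \<exists>c. p = pscale c (lin_form \<eta> ^ k)"
proof (induction k arbitrary: p)
  case 0
  then show ?case using hom_0_eq_const[of p] by (auto simp: hom_polys_perp_iff pscale_def)
next
  case (Suc k p)
  have "dir_deriv s (dir_deriv \<eta> p) = dir_deriv \<eta> (dir_deriv s p)" for s
    using diff_op_dir_deriv[of "lin_form s" \<eta> p] by (simp add: diff_op_lin_form)
  then have "dir_deriv \<eta> p \<in> hom_polys_perp k F"
    using Suc.prems by (simp add: hom_polys_perp_iff hom_dir_deriv)
  then obtain c where c: "dir_deriv \<eta> p = pscale c (lin_form \<eta> ^ k)" using Suc.IH by blast
  define a where "a = of_nat (Suc k) * complex_of_real (\<eta> \<bullet> \<eta>)"
  have "a \<noteq> 0" using \<eta> by (simp add: a_def del: of_nat_Suc)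
  define r where "r = p - pscale (c / a) (lin_form \<eta> ^ Suc k)"
  have D\<eta>: "dir_deriv \<eta> (lin_form \<eta> ^ Suc k) = pscale a (lin_form \<eta> ^ k)"
  proof -
    have "const a = (const (of_nat (Suc k)) * const (complex_of_real (\<eta> \<bullet> \<eta>)) :: 'n cpoly)"
      unfolding a_def mult_single by (simp del: of_nat_Suc)
    then show ?thesis
      unfolding dir_deriv_power dir_deriv_lin_form pscale_def by (simp only: mult.assoc mult.left_commute mult.commute)
  qed
  have DF: "dir_deriv y (lin_form \<eta> ^ Suc k) = 0" if "y \<in> F" for y
    using \<eta>(2)[OF that] unfolding dir_deriv_power dir_deriv_lin_form by (simp add: inner_commute)
  have "dir_deriv w r = 0" for w
  proof -
    have "w \<in> span (insert \<eta> F)" using F by simp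
    then show ?thesis
    proof (induction rule: span_induct_alt)
      case (step c' x y)
      have "dir_deriv x r = 0"
        using step(1) Suc.prems DF c \<open>a \<noteq> 0\<close>
        by (auto simp: r_def dir_deriv_minus dir_deriv_pscale D\<eta> hom_polys_perp_iff simp del: power_Suc)
      then show ?case using step by (simp add: dir_deriv_add_dir dir_deriv_scaleR_dir)
    qed simp
  qed
  then have "partial i r = 0" for i using dir_deriv_axis[of i r] by simp
  moreover have "r \<in> hom_polys (Suc k)"
    using Suc.prems hom_power[OF hom_lin_form, where a="Suc k"]
    unfolding r_def by (intro hom_minus hom_pscale) (auto simp: hom_polys_perp_iff)
  ultimately have "r = 0" by (intro hom_eq_0_if_partials_0[of r "Suc k"]) auto
  then show ?case unfolding r_def by auto
qed

section \<open>Ideals generated by linear forms\<close>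

text \<open>Reduction modulo this ideal is restriction of polynomials to the orthogonal complement of \<open>W\<close>. It
  expresses the contraction of a vector without a change of the number of variables.\<close>

definition lin_ideal :: "(real ^ 'n) set \<Rightarrow> 'n::finite cpoly set" where
  "lin_ideal W = ideal.span (lin_form ` W)"

lemma lin_ideal_mult: "j \<in> lin_ideal W \<Longrightarrow> p * j \<in> lin_ideal W"
  by (simp add: lin_ideal_def ideal.span_scale)

lemma lin_ideal_add: "j \<in> lin_ideal W \<Longrightarrow> j' \<in> lin_ideal W \<Longrightarrow> j + j' \<in> lin_ideal W"
  by (simp add: lin_ideal_def ideal.span_add)

lemma lin_ideal_minus: "j \<in> lin_ideal W \<Longrightarrow> j' \<in> lin_ideal W \<Longrightarrow> j - j' \<in> lin_ideal W"
  by (simp add: lin_ideal_def ideal.span_diff)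

lemma lin_ideal_0 [simp]: "0 \<in> lin_ideal W"
  by (simp add: lin_ideal_def ideal.span_zero)

lemma lin_ideal_mono: "W \<subseteq> W' \<Longrightarrow> lin_ideal W \<subseteq> lin_ideal W'"
  unfolding lin_ideal_def by (intro ideal.span_mono image_mono)

text \<open>Operators in directions orthogonal to \<open>W\<close> act on polynomials restricted to the complement of \<open>W\<close>.\<close>

lemma diff_op_lin_ideal:
  assumes "\<And>w. w \<in> W \<Longrightarrow> dir_deriv w p = 0" "j \<in> lin_ideal W"
  shows "diff_op p j \<in> lin_ideal W"
  using assms(2) unfolding lin_ideal_def
proof (induction rule: ideal.span_induct_alt)
  case base then show ?case by (simp add: ideal.span_zero)
next
  case (step c g j)
  then obtain w where w: "w \<in> W" "g = lin_form w" by auto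
  have "diff_op p (c * g + j) = diff_op p c * g + diff_op p j"
    using assms(1)[OF w(1)] diff_op_lin_form_mult[of p w c]
    by (simp add: diff_op_add_right w(2) mult.commute)
  then show ?case using step by (auto intro: ideal.span_add ideal.span_scale ideal.span_base)
qed

text \<open>Contraction of one more vector: in the quotient the new ideal is principal, generated by that vector.\<close>

lemma lin_ideal_insert:
  assumes W: "subspace W" and j: "j \<in> lin_ideal (span (insert x W))"
  obtains j0 r where "j0 \<in> lin_ideal W" "j = j0 + lin_form x * r"
proof -
  have "\<exists>j0 r. j0 \<in> lin_ideal W \<and> j = j0 + lin_form x * r"
    using j unfolding lin_ideal_def[of "span (insert x W)"]
  proof (induction rule: ideal.span_induct_alt)
    case base
    show ?case by (intro exI[of _ 0]) auto
  next
    case (step c g j)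
    then obtain w j0 r where w: "w \<in> span (insert x W)" "g = lin_form w"
      and j0: "j0 \<in> lin_ideal W" "j = j0 + lin_form x * r" by auto
    obtain k where "w - k *\<^sub>R x \<in> span W"
      using span_breakdown_eq[of w x W] w(1) by auto
    then have k: "w - k *\<^sub>R x \<in> W" using W by (simp add: span_eq_iff[THEN iffD2])
    have "g = lin_form (w - k *\<^sub>R x) + lin_form (k *\<^sub>R x)"
      unfolding w(2) lin_form_add[symmetric] by simp
    then have g: "g = lin_form (w - k *\<^sub>R x) + lin_form x * const (complex_of_real k)"
      by (simp add: lin_form_scaleR pscale_def mult.commute)
    have "c * lin_form (w - k *\<^sub>R x) + j0 \<in> lin_ideal W"
      using k j0 unfolding lin_ideal_def by (auto intro: ideal.span_add ideal.span_scale ideal.span_base)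
    moreover have "c * g + j = (c * lin_form (w - k *\<^sub>R x) + j0) + lin_form x * (c * const (complex_of_real k) + r)"
      unfolding g j0 by (simp add: algebra_simps)
    ultimately show ?case by blast
  qed
  then show ?thesis using that by blast
qed

lemma lin_ideal_UNIV: "\<exists>c. q - const c \<in> lin_ideal UNIV"
proof (induction q rule: cpoly_induct)
  case (const c)
  show ?case by (intro exI[of _ c]) simp
next
  case (add p q)
  then obtain c d where "p - const c \<in> lin_ideal UNIV" "q - const d \<in> lin_ideal UNIV" by auto
  then have "(p - const c) + (q - const d) \<in> lin_ideal UNIV" by (rule lin_ideal_add)
  then show ?case by (intro exI[of _ "c + d"]) (simp add: single_add algebra_simps)
next
  case (var i p)
  have "p * lin_form (axis i 1) \<in> lin_ideal UNIV"
    unfolding lin_ideal_def by (intro ideal.span_scale ideal.span_base) auto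
  then show ?case by (intro exI[of _ 0]) (simp add: lin_form_axis mult.commute)
qed

section \<open>Degree along the cosets of a subspace\<close>

text \<open>Modulo the ideal of \<open>W\<close>, the degree of \<open>q\<close> along the cosets of the orthogonal complement of \<open>S\<close> is
  smaller than \<open>k\<close>. All operators of order at least \<open>k\<close> are included because the inductions
  below descend from high orders.\<close>

definition deg_below :: "(real ^ 'n) set \<Rightarrow> (real ^ 'n) set \<Rightarrow> nat \<Rightarrow> 'n::finite cpoly \<Rightarrow> bool" where
  "deg_below W S k q \<longleftrightarrow> (\<forall>j\<ge>k. \<forall>p\<in>hom_polys_perp j S. diff_op p q \<in> lin_ideal W)"

lemma deg_below_mono:
  assumes "deg_below W S k q" "W \<subseteq> W'" "S \<subseteq> S'" "k \<le> k'"
  shows "deg_below W' S' k' q"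
  using assms perp_antimono[OF assms(3)] lin_ideal_mono[OF assms(2)]
  unfolding deg_below_def by (meson le_trans subsetD)

lemma deg_below_minus: "deg_below W S k q \<Longrightarrow> deg_below W S k q' \<Longrightarrow> deg_below W S k (q - q')"
  by (auto simp: deg_below_def diff_op_minus_right intro: lin_ideal_minus)

lemma deg_below_lin_ideal: "W \<subseteq> S \<Longrightarrow> j \<in> lin_ideal W \<Longrightarrow> deg_below W S k j"
  unfolding deg_below_def by (auto simp: hom_polys_perp_iff intro!: diff_op_lin_ideal)

lemma deg_below_0D: "deg_below W S 0 q \<Longrightarrow> q \<in> lin_ideal W"
  unfolding deg_below_def
  by (drule spec[of _ 0], drule mp, simp, drule bspec[of _ _ 1])
    (auto simp: hom_polys_perp_iff hom_one dir_deriv_hom_0)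

text \<open>If \<open>x\<close> is not in \<open>S\<close>, then \<open>p\<^sub>x\<close> is not constant along the complement of \<open>S\<close>, and division by it
  lowers the degree there by one. The operator \<open>p\<close> of order \<open>j\<close> is written as \<open>D\<^sub>x P\<close>; the commutation
  relation expresses \<open>p(D) r\<close> by \<open>P(D)(p\<^sub>x r)\<close> and \<open>P(D) r\<close>, and the latter is known by descending
  induction on \<open>j\<close>, which starts beyond the degree of \<open>r\<close>.\<close>

lemma deg_below_divide:
  assumes S: "subspace S" "x \<notin> S" and deg_below: "deg_below W S (Suc k) (lin_form x * r)"
  shows "deg_below W S k r"
proof -
  obtain d where d: "\<And>j p. d \<le> j \<Longrightarrow> p \<in> hom_polys j \<Longrightarrow> diff_op p r = 0"
    using diff_op_eventually_0[of r] by blast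
  have "diff_op p r \<in> lin_ideal W" if "k \<le> j" "p \<in> hom_polys_perp j S" for j p
    using that
  proof (induction "d - j" arbitrary: j p)
    case 0
    then show ?case using d[of j p] by (simp add: hom_polys_perp_iff)
  next
    case (Suc a j p)
    obtain P where P: "P \<in> hom_polys_perp (Suc j) S" "dir_deriv x P = p"
      using perp_antiderivative[OF S Suc.prems(2)] by blast
    have "diff_op P r \<in> lin_ideal W" using Suc P by (intro Suc.hyps(1)[of "Suc j"]) auto
    moreover have "diff_op P (lin_form x * r) \<in> lin_ideal W"
      using deg_below P Suc.prems unfolding deg_below_def by (meson Suc_le_mono)
    ultimately have "diff_op P (lin_form x * r) - lin_form x * diff_op P r \<in> lin_ideal W"
      by (intro lin_ideal_minus lin_ideal_mult)
    then show ?case by (simp add: diff_op_lin_form_mult P)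
  qed
  then show ?thesis by (auto simp: deg_below_def)
qed

text \<open>A polynomial in the ideal has degree below \<open>0\<close> along the complement of \<open>W\<close>, hence in particular
  below \<open>1\<close>; dividing by \<open>p\<^sub>x\<close> brings this bound back to \<open>0\<close>.\<close>

lemma lin_ideal_prime:
  assumes "subspace W" "x \<notin> W" "lin_form x * s \<in> lin_ideal W"
  shows "s \<in> lin_ideal W"
  by (rule deg_below_0D[OF deg_below_divide[OF assms(1,2) deg_below_lin_ideal[OF order_refl assms(3)]]])

text \<open>For \<open>x\<close> in \<open>S\<close> the form \<open>p\<^sub>x\<close> is constant along the complement of \<open>S\<close>, so that dividing by it costs no degree.\<close>

lemma deg_below_cancel:
  assumes W: "subspace W" "x \<notin> W" and S: "x \<in> S" and deg_below: "deg_below W S k (lin_form x * r)"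
  shows "deg_below W S k r"
  unfolding deg_below_def
proof (intro allI impI ballI)
  fix j p assume j: "k \<le> j" "p \<in> hom_polys_perp j S"
  then have "lin_form x * diff_op p r = diff_op p (lin_form x * r)"
    using S by (simp add: diff_op_lin_form_mult hom_polys_perp_iff)
  also have "\<dots> \<in> lin_ideal W" using deg_below j unfolding deg_below_def by blast
  finally show "diff_op p r \<in> lin_ideal W" by (rule lin_ideal_prime[OF W])
qed

section \<open>Products of linear forms\<close>

lemma prod_form_insert: "finite Y \<Longrightarrow> y \<notin> Y \<Longrightarrow> prod_form v (insert y Y) = lin_form (v y) * prod_form v Y"
  by (simp add: prod_form_def)

lemma diff_op_prod_form_mult:
  assumes "finite A" "\<And>y. y \<in> A \<Longrightarrow> dir_deriv (v y) p = 0"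
  shows "diff_op p (prod_form v A * q) = prod_form v A * diff_op p q"
  using assms
proof (induction A rule: finite_induct)
  case (insert y A)
  then show ?case by (simp add: prod_form_insert mult.assoc diff_op_lin_form_mult)
qed (simp add: prod_form_def)

text \<open>The factors with \<open>y\<close> in \<open>S\<close> commute with \<open>p(D)\<close>, and the other factors are too few for an
  operator of order \<open>j\<close>. If \<open>S\<close> is not good, then one factor less is available: were all vectors
  outside \<open>S\<close> in \<open>Y\<close>, the complement of \<open>Y\<close> would span a good subspace inside \<open>S\<close>.\<close>

lemma diff_op_prod_form_eq_0:
  assumes T: "finite T" "Y \<subseteq> T" and S: "subspace S" "W \<subseteq> S"
    and Good: "Good (span (W \<union> v ` (T - Y)))" and mono: "\<And>S S'. Good S \<Longrightarrow> S \<subseteq> S' \<Longrightarrow> Good S'"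
    and p: "p \<in> hom_polys_perp j S" "num_off v T S + of_bool (Good S) \<le> j"
  shows "diff_op p (prod_form v Y) = 0"
proof -
  let ?A = "{y\<in>Y. v y \<in> S}" and ?B = "{y\<in>Y. v y \<notin> S}" and ?C = "{y\<in>T. v y \<notin> S}"
  have fin: "finite Y" using T finite_subset by auto
  have split: "prod_form v Y = prod_form v ?A * prod_form v ?B"
    unfolding prod_form_def using fin by (subst prod.union_disjoint[symmetric]) (auto intro: prod.cong)
  have "card ?B < j"
  proof (cases "Good S")
    case True
    have "card ?B \<le> card ?C" using T by (intro card_mono) auto
    then show ?thesis using p True by (simp add: num_off_def)
  next
    case False
    have "?B \<noteq> ?C"
    proof
      assume "?B = ?C"
      then have "W \<union> v ` (T - Y) \<subseteq> S" using S by auto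
      then have "span (W \<union> v ` (T - Y)) \<subseteq> S" using S(1) by (rule span_minimal)
      then show False using mono Good False by blast
    qed
    then have "?B \<subset> ?C" using T by auto
    then have "card ?B < card ?C" using T by (intro psubset_card_mono) auto
    then show ?thesis using p by (simp add: num_off_def)
  qed
  then have "diff_op p (prod_form v ?B) = 0"
    using p fin by (intro diff_op_hom_less[OF _ hom_prod_form]) (auto simp: hom_polys_perp_iff)
  then show ?thesis
    unfolding split using p fin by (subst diff_op_prod_form_mult) (auto simp: hom_polys_perp_iff)
qed

lemma diff_op_cpoly_span:
  assumes "\<And>a. a \<in> A \<Longrightarrow> diff_op p a = 0" "q \<in> cpoly.span A"
  shows "diff_op p q = 0"
  using assms(2)
  by (induction rule: cpoly.span_induct_alt) (simp_all add: assms(1) diff_op_add_right diff_op_pscale_right)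

lemma mult_cpoly_span:
  assumes "\<And>a. a \<in> A \<Longrightarrow> g * a \<in> cpoly.span B" "q \<in> cpoly.span A"
  shows "g * q \<in> cpoly.span B"
  using assms(2)
proof (induction rule: cpoly.span_induct_alt)
  case (step c a q)
  have "g * (pscale c a + q) = pscale c (g * a) + g * q"
    by (simp add: pscale_def algebra_simps)
  then show ?case using step assms(1) by (simp add: cpoly.span_add cpoly.span_scale)
qed (simp add: cpoly.span_zero)

section \<open>Deletion and contraction\<close>

text \<open>The space \<open>P\<close> of the contraction by \<open>W\<close>. The family of independent sets enters only through an
  upward closed predicate on subspaces, since this is the form that deletion and contraction preserve.\<close>

definition good_space ::
    "('i \<Rightarrow> real ^ 'n) \<Rightarrow> ((real ^ 'n) set \<Rightarrow> bool) \<Rightarrow> 'i set \<Rightarrow> (real ^ 'n) set \<Rightarrow> 'n::finite cpoly set" where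
  "good_space v Good T W = cpoly.span {prod_form v Y | Y. Y \<subseteq> T \<and> Good (span (W \<union> v ` (T - Y)))}"

text \<open>The conditions that the generators of the ideal impose, for the contraction by \<open>W\<close>: along the complement
  of a hyperplane \<open>S\<close> spanned by vectors of \<open>T\<close> the degree is at most the number of vectors outside \<open>S\<close>, and
  along the complement of any spanned subspace that is not good it is strictly less.\<close>

definition deg_conditions ::
    "('i \<Rightarrow> real ^ 'n) \<Rightarrow> ((real ^ 'n) set \<Rightarrow> bool) \<Rightarrow> 'i set \<Rightarrow> (real ^ 'n) set \<Rightarrow> 'n::finite cpoly \<Rightarrow> bool" where
  "deg_conditions v Good T W q \<longleftrightarrow>
     (\<forall>Z \<subseteq> T. let S = span (W \<union> v ` Z) in
        dim S = CARD('n) - 1 \<or> \<not> Good S \<longrightarrow> deg_below W S (num_off v T S + of_bool (Good S)) q)"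

lemma deg_conditionsD:
  assumes "deg_conditions v Good T W q" "Z \<subseteq> T" "S = span (W \<union> v ` Z)"
    "dim S = CARD('n) - 1 \<or> \<not> Good S"
  shows "deg_below W S (num_off v T S + of_bool (Good S)) (q :: 'n::finite cpoly)"
  using assms unfolding deg_conditions_def Let_def by blast

lemma deg_conditionsI:
  assumes "\<And>Z S. Z \<subseteq> T \<Longrightarrow> S = span (W \<union> v ` Z) \<Longrightarrow> dim S = CARD('n) - 1 \<or> \<not> Good S \<Longrightarrow>
    deg_below W S (num_off v T S + of_bool (Good S)) q"
  shows "deg_conditions v Good T W (q :: 'n::finite cpoly)"
  using assms unfolding deg_conditions_def Let_def by blast

lemma deg_conditions_minus:
  "deg_conditions v Good T W q \<Longrightarrow> deg_conditions v Good T W q' \<Longrightarrow> deg_conditions v Good T W (q - q')"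
  unfolding deg_conditions_def Let_def by (meson deg_below_minus)

lemma deg_conditions_lin_ideal:
  "j \<in> lin_ideal W \<Longrightarrow> deg_conditions v Good T W j"
  by (rule deg_conditionsI) (auto intro: deg_below_lin_ideal span_base)

lemma deg_conditions_good_space:
  assumes T: "finite T" and mono: "\<And>S S'. Good S \<Longrightarrow> S \<subseteq> S' \<Longrightarrow> Good S'"
    and q: "q \<in> good_space v Good T W"
  shows "deg_conditions v Good T W q"
proof (rule deg_conditionsI)
  fix Z S assume S: "S = span (W \<union> v ` Z)"
  then have sub: "subspace S" "W \<subseteq> S" by (auto intro: span_base)
  have "diff_op p q = 0" if "p \<in> hom_polys_perp j S" "num_off v T S + of_bool (Good S) \<le> j" for j p
  proof (rule diff_op_cpoly_span[OF _ q[unfolded good_space_def]])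
    fix a assume "a \<in> {prod_form v Y | Y. Y \<subseteq> T \<and> Good (span (W \<union> v ` (T - Y)))}"
    then obtain Y where Y: "a = prod_form v Y" "Y \<subseteq> T" "Good (span (W \<union> v ` (T - Y)))" by auto
    show "diff_op p a = 0"
      unfolding Y(1) by (rule diff_op_prod_form_eq_0[where Good = Good, OF T Y(2) sub Y(3) mono that])
  qed
  then show "deg_below W S (num_off v T S + of_bool (Good S)) q" by (auto simp: deg_below_def)
qed

lemma lin_form_mult_good_space:
  assumes T: "finite T" "x \<in> T"
    and q: "q \<in> cpoly.span {prod_form v Y | Y. Y \<subseteq> T - {x} \<and> Good (span (W \<union> v ` (T - insert x Y)))}"
  shows "lin_form (v x) * q \<in> good_space v Good T W"
  unfolding good_space_def
proof (rule mult_cpoly_span[OF _ q])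
  fix a assume "a \<in> {prod_form v Y | Y. Y \<subseteq> T - {x} \<and> Good (span (W \<union> v ` (T - insert x Y)))}"
  then obtain Y where Y: "a = prod_form v Y" "Y \<subseteq> T - {x}" "Good (span (W \<union> v ` (T - insert x Y)))" by auto
  have "finite Y" using T Y(2) finite_subset by auto
  then have "lin_form (v x) * a = prod_form v (insert x Y)" using Y by (subst prod_form_insert) auto
  moreover have "insert x Y \<subseteq> T" using T Y by auto
  ultimately show "lin_form (v x) * a \<in> cpoly.span {prod_form v Y | Y. Y \<subseteq> T \<and> Good (span (W \<union> v ` (T - Y)))}"
    using Y(3) by (intro cpoly.span_base) auto
qed

text \<open>Induction on the number of vectors. Contracting \<open>x\<close>, that is, restricting \<open>q\<close> to the hyperplane
  orthogonal to \<open>x\<close>, gives \<open>q = p + p\<^sub>x r\<close> modulo the ideal of \<open>W\<close>, with \<open>p\<close> already in the space. If the remaining vectors still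
  span, then \<open>r\<close> satisfies the conditions of the deletion of \<open>x\<close>, because division by \<open>p\<^sub>x\<close> lowers the
  degree exactly along the complements that do not annihilate \<open>x\<close>.

  If \<open>x\<close> is a coloop, then the remaining vectors span a hyperplane \<open>H\<close> that does not contain \<open>x\<close>, the
  deletion is degenerate, and the contraction is used a second time: \<open>r\<close> satisfies the conditions of the
  contraction, where a subspace now counts as good if its intersection with \<open>H\<close> is good. This gives
  \<open>r = p\<^sub>1 + p\<^sub>x r'\<close>; since \<open>x\<close> is the only vector outside \<open>H\<close>, the degree across \<open>H\<close> is at most \<open>1\<close>,
  which excludes the term \<open>p\<^sub>x\<^sup>2 r'\<close>.\<close>

theorem deg_conditions_imp_good_space:
  fixes v :: "'i \<Rightarrow> real ^ 'n" and Good :: "(real ^ 'n) set \<Rightarrow> bool"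
  assumes "finite T" "subspace W" "\<And>x. x \<in> T \<Longrightarrow> v x \<notin> W" "span (W \<union> v ` T) = UNIV"
    and "\<And>S S'. Good S \<Longrightarrow> S \<subseteq> S' \<Longrightarrow> Good S'"
    and "deg_conditions v Good T W q"
  shows "\<exists>p \<in> good_space v Good T W. \<exists>j \<in> lin_ideal W. q = p + j"
  using assms
proof (induction "card T" arbitrary: T W Good q rule: less_induct)
  case (less T W Good q)
  note T = \<open>finite T\<close> and W = \<open>subspace W\<close> and mono = less.prems(5) and K = less.prems(6)
  show ?case
  proof (cases "T = {}")
    case True
    then have "W = UNIV" using less.prems(4) W by (simp add: span_eq_iff[THEN iffD2])
    obtain c where c: "q - const c \<in> lin_ideal W" using lin_ideal_UNIV \<open>W = UNIV\<close> by metis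
    show ?thesis
    proof (cases "Good UNIV")
      case True
      have "1 \<in> good_space v Good T W"
        unfolding good_space_def using True less.prems(4) \<open>T = {}\<close>
        by (intro cpoly.span_base) (auto simp: prod_form_def)
      then have "pscale c 1 \<in> good_space v Good T W"
        unfolding good_space_def by (rule cpoly.span_scale)
      then show ?thesis using c by (intro bexI[of _ "const c"] bexI[of _ "q - const c"]) (auto simp: pscale_def)
    next
      case False
      have "deg_below W UNIV (num_off v T UNIV + of_bool (Good UNIV)) q"
        using False less.prems(4) by (intro deg_conditionsD[OF K, of "{}"]) (auto simp: \<open>T = {}\<close>)
      then have "q \<in> lin_ideal W" using False by (intro deg_below_0D) (simp add: num_off_def)
      moreover have "0 \<in> good_space v Good T W" by (simp add: good_space_def cpoly.span_zero)
      ultimately show ?thesis by (metis add_0)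
    qed
  next
    case False
    then obtain x where x: "x \<in> T" by blast
    let ?g = "lin_form (v x)"
    have xW: "v x \<notin> W" using less.prems(3) x .
    define W' where "W' = span (insert (v x) W)"
    have W': "subspace W'" "W \<subseteq> W'" "v x \<in> W'" by (auto simp: W'_def intro: span_base)
    have span_W': "span (W' \<union> A) = span (insert (v x) (W \<union> A))" for A
      unfolding W'_def Un_insert_left[symmetric] by (simp only: span_Un span_span)
    have mem_W': "\<exists>k. \<exists>w\<in>W. y = k *\<^sub>R v x + w" if y: "y \<in> W'" for y
    proof -
      obtain k where "y - k *\<^sub>R v x \<in> span W" using y span_breakdown_eq unfolding W'_def by blast
      then have "y - k *\<^sub>R v x \<in> W" using W by (simp add: span_eq_iff[THEN iffD2])
      then show ?thesis by (intro exI[of _ k] bexI[of _ "y - k *\<^sub>R v x"]) auto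
    qed
    \<comment> \<open>Contraction of \<open>x\<close>; vectors that fall into \<open>W'\<close> are dropped, as they lie in every
      subspace that still matters.\<close>
    define T' where "T' = {y\<in>T. v y \<notin> W'}"
    have T': "finite T'" "T' \<subseteq> T" "x \<notin> T'" using T W' by (auto simp: T'_def)
    have num_T': "num_off v T' S = num_off v T S" if "W' \<subseteq> S" for S
      unfolding num_off_def T'_def using that by (intro arg_cong[of _ _ card]) auto
    have "\<exists>p \<in> good_space v Good T' W'. \<exists>j \<in> lin_ideal W'. q = p + j"
    proof (rule less.hyps[OF _ T'(1) W'(1) _ _ mono])
      show "card T' < card T" using T T' x by (intro psubset_card_mono) auto
      show "v y \<notin> W'" if "y \<in> T'" for y using that by (simp add: T'_def)
      have "W \<union> v ` T \<subseteq> span (W' \<union> v ` T')"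
        using W' by (auto simp: T'_def intro!: span_base)
      then have "span (W \<union> v ` T) \<subseteq> span (W' \<union> v ` T')" by (intro span_minimal) auto
      then show "span (W' \<union> v ` T') = UNIV" using less.prems(4) by auto
      show "deg_conditions v Good T' W' q"
      proof (rule deg_conditionsI)
        fix Z S assume Z: "Z \<subseteq> T'" "S = span (W' \<union> v ` Z)" and S: "dim S = CARD('n) - 1 \<or> \<not> Good S"
        have "S = span (W \<union> v ` insert x Z)" unfolding Z(2) span_W' by simp
        then have "deg_below W S (num_off v T S + of_bool (Good S)) q"
          using Z x T' S by (intro deg_conditionsD[OF K, of "insert x Z"]) auto
        moreover have "W' \<subseteq> S" unfolding Z(2) by (auto intro: span_base)
        ultimately show "deg_below W' S (num_off v T' S + of_bool (Good S)) q"
          using deg_below_mono[OF _ W'(2)] by (simp add: num_T')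
      qed
    qed
    then obtain p j where pj: "p \<in> good_space v Good T' W'" "j \<in> lin_ideal W'" "q = p + j" by blast
    obtain j0 r where j0: "j0 \<in> lin_ideal W" "j = j0 + ?g * r"
      using lin_ideal_insert[OF W pj(2)[unfolded W'_def]] .
    have p: "p \<in> good_space v Good T W"
    proof -
      have "good_space v Good T' W' \<subseteq> good_space v Good T W"
        unfolding good_space_def
      proof (rule cpoly.span_mono, safe)
        fix Y assume Y: "Y \<subseteq> T'" "Good (span (W' \<union> v ` (T' - Y)))"
        have "span (W' \<union> v ` (T' - Y)) \<subseteq> span (W \<union> v ` (T - Y))"
          unfolding span_W' using x T' Y by (intro span_mono) auto
        then show "\<exists>Y'. prod_form v Y = prod_form v Y' \<and> Y' \<subseteq> T \<and> Good (span (W \<union> v ` (T - Y')))"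
          using Y T' mono by blast
      qed
      then show ?thesis using pj by auto
    qed
    have "?g * r = q - p - j0" by (simp add: pj(3) j0(2))
    moreover have good_K: "deg_conditions v Good T W p'" if "p' \<in> good_space v Good T W" for p'
      using T mono that by (rule deg_conditions_good_space)
    ultimately have Kr: "deg_conditions v Good T W (?g * r)"
      using K good_K[OF p] j0(1) by (simp add: deg_conditions_minus deg_conditions_lin_ideal)
    have "\<exists>p' \<in> good_space v Good T W. \<exists>j' \<in> lin_ideal W. ?g * r = p' + j'"
    proof (cases "span (W \<union> v ` (T - {x})) = UNIV")
      case True
      have "\<exists>p \<in> good_space v Good (T - {x}) W. \<exists>j \<in> lin_ideal W. r = p + j"
      proof (rule less.hyps[OF _ _ W _ True mono])
        show "card (T - {x}) < card T" using T x by (intro card_Diff1_less)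
        show "finite (T - {x})" using T by simp
        show "v y \<notin> W" if "y \<in> T - {x}" for y using that less.prems(3) by auto
        show "deg_conditions v Good (T - {x}) W r"
        proof (rule deg_conditionsI)
          fix Z S assume Z: "Z \<subseteq> T - {x}" "S = span (W \<union> v ` Z)" and S: "dim S = CARD('n) - 1 \<or> \<not> Good S"
          have deg_below: "deg_below W S (num_off v T S + of_bool (Good S)) (?g * r)"
            using Z S by (intro deg_conditionsD[OF Kr, of Z]) auto
          show "deg_below W S (num_off v (T - {x}) S + of_bool (Good S)) r"
          proof (cases "v x \<in> S")
            case True
            then have "num_off v (T - {x}) S = num_off v T S"
              unfolding num_off_def by (intro arg_cong[of _ _ card]) auto
            then show ?thesis using deg_below_cancel[OF W xW True deg_below] by simp
          next
            case False
            have "{y\<in>T. v y \<notin> S} = insert x {y\<in>T - {x}. v y \<notin> S}" using x False by auto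
            then have "num_off v T S = Suc (num_off v (T - {x}) S)"
              unfolding num_off_def using T by simp
            with deg_below have "deg_below W S (Suc (num_off v (T - {x}) S + of_bool (Good S))) (?g * r)" by simp
            then show ?thesis by (rule deg_below_divide[rotated 2]) (use False Z in simp_all)
          qed
        qed
      qed
      then obtain p1 j1 where r: "p1 \<in> good_space v Good (T - {x}) W" "j1 \<in> lin_ideal W" "r = p1 + j1" by blast
      have "T - {x} - Y = T - insert x Y" for Y by auto
      then have "?g * p1 \<in> good_space v Good T W"
        using r(1) by (intro lin_form_mult_good_space[OF T x]) (simp add: good_space_def)
      moreover have "?g * j1 \<in> lin_ideal W" using r(2) by (rule lin_ideal_mult)
      moreover have "?g * r = ?g * p1 + ?g * j1" unfolding r(3) by (rule distrib_left)
      ultimately show ?thesis by blast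
    next
      case False
      \<comment> \<open>The coloop: a second contraction, with goodness measured inside \<open>H\<close>.\<close>
      define H where "H = span (W \<union> v ` (T - {x}))"
      have spanH: "span (insert (v x) H) = UNIV"
      proof -
        have "W \<union> v ` T \<subseteq> span (insert (v x) H)" by (auto simp: H_def intro!: span_base)
        then show ?thesis using less.prems(4) span_minimal[of "W \<union> v ` T" "span (insert (v x) H)"] by auto
      qed
      have H: "subspace H" "W \<subseteq> H" by (auto simp: H_def intro: span_base)
      have xH: "v x \<notin> H"
      proof
        assume "v x \<in> H"
        then have "span (insert (v x) H) = H" using H by (simp add: insert_absorb span_eq_iff[THEN iffD2])
        then show False using spanH False by (simp add: H_def)
      qed
      have dimH: "dim H = CARD('n) - 1"
      proof -
        have "v x \<notin> span H" using xH H by (simp add: span_eq_iff[THEN iffD2])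
        then have "dim (insert (v x) H) = dim H + 1" by (simp add: dim_insert)
        moreover have "dim (insert (v x) H) = CARD('n)"
          using spanH by (metis dim_span dim_UNIV DIM_cart DIM_real mult.right_neutral)
        ultimately show ?thesis by simp
      qed
      have yW': "v y \<notin> W'" if "y \<in> T - {x}" for y
      proof
        assume "v y \<in> W'"
        then obtain k w where kw: "w \<in> W" "v y = k *\<^sub>R v x + w" using mem_W' by blast
        have "v y \<in> H" using that by (auto simp: H_def intro: span_base)
        then have "k *\<^sub>R v x \<in> H" using kw H subspace_diff[of H "v y" w] by auto
        then have "k = 0" using xH H subspace_scale[of H "k *\<^sub>R v x" "inverse k"] by (cases "k = 0") auto
        then show False using kw less.prems(3) that by auto
      qed
      have inter: "span (W' \<union> v ` Z) \<inter> H = span (W \<union> v ` Z)" if "Z \<subseteq> T - {x}" for Z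
      proof
        have sub: "span (W \<union> v ` Z) \<subseteq> H" unfolding H_def using that by (intro span_mono) auto
        have "span (W \<union> v ` Z) \<subseteq> span (W' \<union> v ` Z)" using W' by (intro span_mono) auto
        then show "span (W \<union> v ` Z) \<subseteq> span (W' \<union> v ` Z) \<inter> H" using sub by auto
        show "span (W' \<union> v ` Z) \<inter> H \<subseteq> span (W \<union> v ` Z)"
        proof
          fix y assume y: "y \<in> span (W' \<union> v ` Z) \<inter> H"
          then obtain k where k: "y - k *\<^sub>R v x \<in> span (W \<union> v ` Z)"
            unfolding span_W' using span_breakdown_eq by blast
          then have "y - k *\<^sub>R v x \<in> H" "y \<in> H" using y sub by auto
          then have "y - (y - k *\<^sub>R v x) \<in> H" using H(1) by (metis subspace_diff)
          then have "k *\<^sub>R v x \<in> H" by simp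
          then have "k = 0" using xH H subspace_scale[of H "k *\<^sub>R v x" "inverse k"] by (cases "k = 0") auto
          then show "y \<in> span (W \<union> v ` Z)" using k by simp
        qed
      qed
      let ?G = "\<lambda>S. Good (S \<inter> H)"
      have "\<exists>p \<in> good_space v ?G (T - {x}) W'. \<exists>j \<in> lin_ideal W'. r = p + j"
      proof (rule less.hyps[OF _ _ W'(1) yW'])
        show "card (T - {x}) < card T" using T x by (intro card_Diff1_less)
        show "finite (T - {x})" using T by simp
        have "insert x (T - {x}) = T" using x by auto
        then show "span (W' \<union> v ` (T - {x})) = UNIV"
          unfolding span_W' using less.prems(4) by (metis Un_insert_right image_insert)
        show "Good (S' \<inter> H)" if "Good (S \<inter> H)" "S \<subseteq> S'" for S S'
          using mono[OF that(1)] that(2) by blast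
        show "deg_conditions v ?G (T - {x}) W' r"
        proof (rule deg_conditionsI)
          fix Z S' assume Z: "Z \<subseteq> T - {x}" "S' = span (W' \<union> v ` Z)"
            and S': "dim S' = CARD('n) - 1 \<or> \<not> Good (S' \<inter> H)"
          define S where "S = span (W \<union> v ` Z)"
          have S: "S' \<inter> H = S" unfolding Z(2) S_def by (rule inter[OF Z(1)])
          have xS': "v x \<in> S'" unfolding Z(2) by (auto intro: span_base W')
          have off: "num_off v T S' = num_off v (T - {x}) S'"
            unfolding num_off_def using xS' by (intro arg_cong[of _ _ card]) auto
          show "deg_below W' S' (num_off v (T - {x}) S' + of_bool (Good (S' \<inter> H))) r"
          proof (cases "Good S")
            case True
            have "Good S'" using mono[OF True] S by blast
            have "S' = span (W \<union> v ` insert x Z)" unfolding Z(2) span_W' by simp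
            then have "deg_below W S' (num_off v T S' + of_bool (Good S')) (?g * r)"
              using Z S' x True S by (intro deg_conditionsD[OF Kr, of "insert x Z"]) auto
            from deg_below_cancel[OF W xW xS' this]
            have "deg_below W S' (num_off v (T - {x}) S' + of_bool (Good (S' \<inter> H))) r"
              using True \<open>Good S'\<close> by (simp add: S off)
            then show ?thesis by (rule deg_below_mono[OF _ W'(2)]) auto
          next
            case False
            have "deg_below W S (num_off v T S + of_bool (Good S)) (?g * r)"
              using False Z by (intro deg_conditionsD[OF Kr, of Z]) (auto simp: S_def)
            moreover have "num_off v T S = Suc (num_off v (T - {x}) S')"
            proof -
              have "v y \<in> S \<longleftrightarrow> v y \<in> S'" if "y \<in> T - {x}" for y
                using that S by (auto simp: H_def intro: span_base)
              moreover have "v x \<notin> S" using S xH by auto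
              ultimately have "{y\<in>T. v y \<notin> S} = insert x {y\<in>T - {x}. v y \<notin> S'}" using x by auto
              then show ?thesis unfolding num_off_def using T by simp
            qed
            ultimately have "deg_below W S (Suc (num_off v (T - {x}) S')) (?g * r)" using False by simp
            then have "deg_below W S (num_off v (T - {x}) S') r"
              by (rule deg_below_divide[rotated 2]) (use S xH in \<open>auto simp: S_def\<close>)
            then show ?thesis by (rule deg_below_mono[OF _ W'(2)]) (use S False in auto)
          qed
        qed
      qed
      then obtain p1 j' where r: "p1 \<in> good_space v ?G (T - {x}) W'" "j' \<in> lin_ideal W'" "r = p1 + j'" by blast
      obtain j1 r' where j1: "j1 \<in> lin_ideal W" "j' = j1 + ?g * r'"
        using lin_ideal_insert[OF W r(2)[unfolded W'_def]] .
      have gp1: "?g * p1 \<in> good_space v Good T W"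
      proof (rule lin_form_mult_good_space[OF T x])
        have "span (W' \<union> v ` (T - {x} - Y)) \<inter> H = span (W \<union> v ` (T - insert x Y))" for Y
        proof -
          have "T - {x} - Y = T - insert x Y" by auto
          then show ?thesis using inter[of "T - insert x Y"] by auto
        qed
        then show "p1 \<in> cpoly.span {prod_form v Y | Y. Y \<subseteq> T - {x} \<and> Good (span (W \<union> v ` (T - insert x Y)))}"
          using r(1) by (simp add: good_space_def)
      qed
      have gj1: "?g * j1 \<in> lin_ideal W" by (rule lin_ideal_mult[OF j1(1)])
      have "?g * (?g * r') = ?g * r - ?g * p1 - ?g * j1"
        by (simp add: r(3) j1(2) algebra_simps)
      then have "deg_conditions v Good T W (?g * (?g * r'))"
        using Kr good_K[OF gp1] gj1 by (simp add: deg_conditions_minus deg_conditions_lin_ideal)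
      then have "deg_below W H (num_off v T H + of_bool (Good H)) (?g * (?g * r'))"
        using dimH by (intro deg_conditionsD[of v Good T W _ "T - {x}"]) (auto simp: H_def)
      moreover have "num_off v T H = 1"
      proof -
        have "{y\<in>T. v y \<notin> H} = {x}" using x xH by (auto simp: H_def intro: span_base)
        then show ?thesis by (simp add: num_off_def)
      qed
      ultimately have "deg_below W H (Suc (Suc 0)) (?g * (?g * r'))"
        by (elim deg_below_mono) auto
      then have "r' \<in> lin_ideal W"
        using deg_below_0D deg_below_divide[OF H(1) xH] by blast
      then have "?g * j1 + ?g * (?g * r') \<in> lin_ideal W"
        by (intro lin_ideal_add gj1 lin_ideal_mult)
      moreover have "?g * r = ?g * p1 + (?g * j1 + ?g * (?g * r'))"
        by (simp add: r(3) j1(2) algebra_simps)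
      ultimately show ?thesis using gp1 by blast
    qed
    then obtain p' j' where "p' \<in> good_space v Good T W" "j' \<in> lin_ideal W" "?g * r = p' + j'" by blast
    then have "p + p' \<in> good_space v Good T W" "j0 + j' \<in> lin_ideal W" "q = (p + p') + (j0 + j')"
      using p j0 pj(3) by (auto simp: good_space_def intro: cpoly.span_add lin_ideal_add)
    then show ?thesis by blast
  qed
qed

section \<open>Underdetermined linear systems\<close>

text \<open>The dimension counts below are reduced to this fact, which is Gaussian elimination.\<close>

lemma homogeneous_system:
  fixes M :: "'a \<Rightarrow> 'b \<Rightarrow> complex"
  assumes "finite A" "finite B" "card A < card B"
  shows "\<exists>c. (\<exists>b\<in>B. c b \<noteq> 0) \<and> (\<forall>a\<in>A. (\<Sum>b\<in>B. M a b * c b) = 0)"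
  using assms
proof (induction A arbitrary: B M rule: finite_induct)
  case empty
  then have "B \<noteq> {}" by auto
  then show ?case by (intro exI[of _ "\<lambda>_. 1"]) auto
next
  case (insert a A)
  show ?case
  proof (cases "\<forall>b\<in>B. M a b = 0")
    case True
    have "card A < card B" using insert by simp
    from insert.IH[OF insert.prems(1) this, of M] show ?thesis using True by auto
  next
    case False
    then obtain b0 where b0: "b0 \<in> B" "M a b0 \<noteq> 0" by auto
    let ?B = "B - {b0}"
    have "card A < card ?B" "finite ?B" using insert b0 by auto
    \<comment> \<open>Eliminate the unknown \<open>b0\<close> by means of the equation \<open>a\<close>.\<close>
    from insert.IH[OF this(2,1), of "\<lambda>a' b. M a' b - M a' b0 * M a b / M a b0"]
    obtain c where c: "\<exists>b\<in>?B. c b \<noteq> 0"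
      and sys: "\<And>a'. a' \<in> A \<Longrightarrow> (\<Sum>b\<in>?B. (M a' b - M a' b0 * M a b / M a b0) * c b) = 0" by blast
    define s where "s = (\<Sum>b\<in>?B. M a b * c b)"
    define d where "d = c(b0 := - s / M a b0)"
    have split: "(\<Sum>b\<in>B. M a' b * d b) = M a' b0 * (- s / M a b0) + (\<Sum>b\<in>?B. M a' b * c b)" for a'
      unfolding d_def using insert.prems(1) b0 by (subst sum.remove[of B b0]) auto
    have "(\<Sum>b\<in>B. M a' b * d b) = 0" if "a' \<in> insert a A" for a'
    proof (cases "a' = a")
      case True
      then show ?thesis unfolding split using b0 by (simp add: s_def)
    next
      case False
      have "(\<Sum>b\<in>?B. (M a' b - M a' b0 * M a b / M a b0) * c b)
          = (\<Sum>b\<in>?B. M a' b * c b) - (M a' b0 / M a b0) * s"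
        unfolding s_def sum_distrib_left sum_subtractf[symmetric] by (intro sum.cong) (auto simp: algebra_simps)
      then show ?thesis unfolding split using sys that False by simp
    qed
    moreover have "\<exists>b\<in>B. d b \<noteq> 0" using c by (auto simp: d_def)
    ultimately show ?thesis by blast
  qed
qed

section \<open>Greedy bases\<close>

text \<open>The lexicographically first basis of \<open>A\<close>; greedy completions are of this form too.\<close>

definition greedy_basis :: "('i::linorder \<Rightarrow> real ^ 'n) \<Rightarrow> 'i set \<Rightarrow> 'i set" where
  "greedy_basis v A = {x\<in>A. v x \<notin> span (v ` {b\<in>A. b < x})}"

lemma greedy_basis_subset: "greedy_basis v A \<subseteq> A"
  by (auto simp: greedy_basis_def)

lemma greedy_basis_span_below:
  assumes A: "finite A" "y \<in> A" and up: "\<And>b. b \<in> A \<Longrightarrow> b \<le> y \<Longrightarrow> P b"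
  shows "v y \<in> span (v ` {b \<in> greedy_basis v A. P b})"
  using A(2) up
proof (induction "card {z\<in>A. z < y}" arbitrary: y rule: less_induct)
  case less
  show ?case
  proof (cases "y \<in> greedy_basis v A")
    case True
    then show ?thesis using less.prems by (auto intro: span_base)
  next
    case False
    then have "v y \<in> span (v ` {b\<in>A. b < y})" using less.prems by (auto simp: greedy_basis_def)
    moreover have "v b \<in> span (v ` {b \<in> greedy_basis v A. P b})" if "b \<in> A" "b < y" for b
    proof (rule less.hyps)
      show "card {z\<in>A. z < b} < card {z\<in>A. z < y}" using A(1) that by (intro psubset_card_mono) auto
    qed (use that less.prems in auto)
    then have "span (v ` {b\<in>A. b < y}) \<subseteq> span (v ` {b \<in> greedy_basis v A. P b})"
      by (intro span_minimal) auto
    ultimately show ?thesis by blast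
  qed
qed

lemma span_greedy_basis:
  assumes "finite A"
  shows "span (v ` greedy_basis v A) = span (v ` A)"
proof
  show "span (v ` greedy_basis v A) \<subseteq> span (v ` A)"
    by (intro span_mono image_mono greedy_basis_subset)
  have "v y \<in> span (v ` greedy_basis v A)" if "y \<in> A" for y
    using greedy_basis_span_below[OF assms that, of "\<lambda>_. True"] by simp
  then show "span (v ` A) \<subseteq> span (v ` greedy_basis v A)" by (intro span_minimal) auto
qed

lemma not_in_greedy_basis:
  assumes "finite A" "y \<in> A - greedy_basis v A"
  shows "v y \<in> span (v ` {b \<in> greedy_basis v A. b < y})"
proof -
  have "v y \<in> span (v ` {b\<in>A. b < y})" using assms by (auto simp: greedy_basis_def)
  moreover have "v b \<in> span (v ` {b \<in> greedy_basis v A. b < y})" if "b \<in> A" "b < y" for b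
    using that assms(1) by (intro greedy_basis_span_below) auto
  then have "span (v ` {b\<in>A. b < y}) \<subseteq> span (v ` {b \<in> greedy_basis v A. b < y})"
    by (intro span_minimal) auto
  ultimately show ?thesis by blast
qed

lemma lin_indep_insert:
  "lin_indep v I \<Longrightarrow> v b \<notin> span (v ` I) \<Longrightarrow> lin_indep v (insert b I)"
  unfolding lin_indep_def by (auto simp: independent_insert intro: span_base)

lemma lin_indep_subset: "lin_indep v I \<Longrightarrow> J \<subseteq> I \<Longrightarrow> lin_indep v J"
  unfolding lin_indep_def using independent_mono[of "v ` I" "v ` J"] inj_on_subset[of v I J] by auto

lemma lin_indep_notin_span:
  assumes "lin_indep v I" "x \<in> I" "J \<subseteq> I - {x}"
  shows "v x \<notin> span (v ` J)"
proof
  assume "v x \<in> span (v ` J)"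
  moreover have "v ` J \<subseteq> v ` I - {v x}"
    using assms unfolding lin_indep_def inj_on_def by auto
  ultimately have "v x \<in> span (v ` I - {v x})" using span_mono by blast
  then show False using assms unfolding lin_indep_def dependent_def by auto
qed

lemma lin_indep_if_increasing:
  assumes "finite G" "\<And>x. x \<in> G \<Longrightarrow> v x \<notin> span (v ` {b\<in>G. b < x})"
  shows "lin_indep v (G :: 'i::linorder set)"
  using assms
proof (induction G rule: finite_linorder_max_induct)
  case empty
  then show ?case by (simp add: lin_indep_def independent_empty)
next
  case (insert b G)
  have "{c \<in> insert b G. c < b} = G" using insert.hyps by auto
  moreover have "v x \<notin> span (v ` {c\<in>G. c < x})" if "x \<in> G" for x
  proof -
    have "{c \<in> insert b G. c < x} = {c\<in>G. c < x}" using insert.hyps that by auto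
    then show ?thesis using insert.prems[of x] that by simp
  qed
  ultimately show ?case using insert.IH insert.prems[of b] by (intro lin_indep_insert) auto
qed

lemma lin_indep_greedy_basis:
  assumes "finite A"
  shows "lin_indep v (greedy_basis v A)"
proof (rule lin_indep_if_increasing)
  show "finite (greedy_basis v A)" using assms greedy_basis_subset finite_subset by metis
  fix x assume x: "x \<in> greedy_basis v A"
  have "span (v ` {b \<in> greedy_basis v A. b < x}) \<subseteq> span (v ` {b\<in>A. b < x})"
    using greedy_basis_subset[of v A] by (intro span_mono) auto
  then show "v x \<notin> span (v ` {b \<in> greedy_basis v A. b < x})"
    using x by (auto simp: greedy_basis_def)
qed

text \<open>As the elements of \<open>B\<^sub>0\<close> come last and \<open>I\<close> is independent, the greedy algorithm on \<open>I \<union> B\<^sub>0\<close> keeps all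
  of \<open>I\<close>.\<close>

lemma greedy_ext_eq_greedy_basis:
  assumes I: "lin_indep v I" and less: "\<And>x b. x \<in> I \<Longrightarrow> b \<in> B0 \<Longrightarrow> x < b"
  shows "greedy_ext v B0 I = greedy_basis v (I \<union> B0)"
proof -
  have "v x \<notin> span (v ` {b \<in> I \<union> B0. b < x})" if "x \<in> I" for x
    using that less by (intro lin_indep_notin_span[OF I]) force+
  moreover have "{c \<in> I \<union> B0. c < b} = I \<union> {c\<in>B0. c < b}" if "b \<in> B0" for b
    using less that by auto
  ultimately show ?thesis unfolding greedy_ext_def greedy_basis_def by auto
qed

lemma span_image_sum:
  assumes "finite A" "lin_indep v A" "y \<in> span (v ` A)"
  obtains c where "y = (\<Sum>b\<in>A. c b *\<^sub>R v b)"
proof -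
  obtain u where "y = (\<Sum>x\<in>v ` A. u x *\<^sub>R x)"
    using assms(1,3) span_finite[of "v ` A"] by auto
  then have "y = (\<Sum>b\<in>A. u (v b) *\<^sub>R v b)"
    using assms(2) by (simp add: lin_indep_def sum.reindex)
  then show ?thesis by (rule that)
qed

section \<open>Exchange in products of linear forms\<close>

lemma lin_form_sum_mult_prod_form:
  assumes "finite Y" "A \<inter> Y = {}"
  shows "lin_form (\<Sum>b\<in>A. c b *\<^sub>R v b) * prod_form v Y
    = (\<Sum>b\<in>A. pscale (complex_of_real (c b)) (prod_form v (insert b Y)))"
proof -
  have "lin_form (\<Sum>b\<in>A. c b *\<^sub>R v b) * prod_form v Y
      = (\<Sum>b\<in>A. pscale (complex_of_real (c b)) (lin_form (v b) * prod_form v Y))"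
    by (simp add: lin_form_sum lin_form_scaleR sum_distrib_right pscale_def mult.assoc)
  also have "\<dots> = (\<Sum>b\<in>A. pscale (complex_of_real (c b)) (prod_form v (insert b Y)))"
  proof (rule sum.cong[OF refl])
    fix b assume "b \<in> A"
    then have "b \<notin> Y" using assms by auto
    then show "pscale (complex_of_real (c b)) (lin_form (v b) * prod_form v Y)
      = pscale (complex_of_real (c b)) (prod_form v (insert b Y))"
      using assms by (simp add: prod_form_insert)
  qed
  finally show ?thesis .
qed

text \<open>Replacing a factor \<open>p\<^sub>y\<close> by a combination of \<open>p\<^sub>b\<close> with smaller \<open>b\<close> outside \<open>Y\<close> decreases the sum of the ranks of
  the elements of \<open>Y\<close>. An invariant is carried along, and it has to be maintained only for those \<open>b\<close> that
  occur in the combination.\<close>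

lemma prod_form_exchange_induct:
  fixes v :: "'i::linorder \<Rightarrow> real ^ 'n"
  assumes U: "finite U" and C: "cpoly.subspace C"
    and step: "\<And>Y. Inv Y \<Longrightarrow> Y \<subseteq> U \<Longrightarrow> prod_form v Y \<notin> C \<Longrightarrow>
      \<exists>y\<in>Y. \<exists>A c. A \<subseteq> U \<and> A \<inter> Y = {} \<and> (\<forall>b\<in>A. b < y) \<and> v y = (\<Sum>b\<in>A. c b *\<^sub>R v b) \<and>
        (\<forall>b\<in>A. c b \<noteq> 0 \<longrightarrow> Inv (insert b (Y - {y})))"
    and Y: "Inv Y" "Y \<subseteq> U"
  shows "prod_form v Y \<in> C"
  using Y
proof (induction "\<Sum>y\<in>Y. card {z\<in>U. z < y}" arbitrary: Y rule: less_induct)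
  case (less Y)
  have fin: "finite Y" using less.prems U finite_subset by auto
  show ?case
  proof (rule ccontr)
    assume "prod_form v Y \<notin> C"
    from step[OF less.prems this] obtain y A c where y: "y \<in> Y" and A: "A \<subseteq> U" "A \<inter> Y = {}"
      and lt: "\<And>b. b \<in> A \<Longrightarrow> b < y" and vy: "v y = (\<Sum>b\<in>A. c b *\<^sub>R v b)"
      and Inv: "\<And>b. b \<in> A \<Longrightarrow> c b \<noteq> 0 \<Longrightarrow> Inv (insert b (Y - {y}))" by blast
    have "prod_form v (insert b (Y - {y})) \<in> C" if b: "b \<in> A" "c b \<noteq> 0" for b
    proof (rule less.hyps[OF _ Inv[OF b]])
      have "b \<notin> Y - {y}" using A b by auto
      then have "(\<Sum>y\<in>insert b (Y - {y}). card {z\<in>U. z < y})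
          = card {z\<in>U. z < b} + (\<Sum>y\<in>Y - {y}. card {z\<in>U. z < y})"
        using fin by simp
      moreover have "(\<Sum>y\<in>Y. card {z\<in>U. z < y}) = card {z\<in>U. z < y} + (\<Sum>y\<in>Y - {y}. card {z\<in>U. z < y})"
        by (rule sum.remove[OF fin y])
      moreover have "card {z\<in>U. z < b} < card {z\<in>U. z < y}"
        using U A b lt[of b] by (intro psubset_card_mono) auto
      ultimately show "(\<Sum>y\<in>insert b (Y - {y}). card {z\<in>U. z < y}) < (\<Sum>y\<in>Y. card {z\<in>U. z < y})"
        by simp
      show "insert b (Y - {y}) \<subseteq> U" using less.prems A b by auto
    qed
    then have "pscale (complex_of_real (c b)) (prod_form v (insert b (Y - {y}))) \<in> C" if "b \<in> A" for b
      using that C by (cases "c b = 0") (auto intro: cpoly.subspace_scale cpoly.subspace_0)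
    then have "(\<Sum>b\<in>A. pscale (complex_of_real (c b)) (prod_form v (insert b (Y - {y})))) \<in> C"
      using C by (intro cpoly.subspace_sum) auto
    moreover have "lin_form (v y) * prod_form v (Y - {y}) = prod_form v Y"
      using fin y prod_form_insert[of "Y - {y}" y v] by (simp add: insert_absorb)
    moreover have "A \<inter> (Y - {y}) = {}" using A by auto
    ultimately have "prod_form v Y \<in> C"
      using lin_form_sum_mult_prod_form[of "Y - {y}" A c v] fin vy by simp
    then show False using \<open>prod_form v Y \<notin> C\<close> by blast
  qed
qed

text \<open>Let \<open>I\<close> be the greedy basis of \<open>X - Y\<close>. A vector outside \<open>Y\<close> that is not in \<open>I\<close> depends on smaller elements
  of \<open>I\<close>, so \<open>X(I)\<close> is contained in \<open>Y\<close>. If the two sets differ, some \<open>y\<close> in \<open>Y\<close> depends on smaller elements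
  of \<open>I\<close> and can be exchanged; the complement of \<open>Y\<close> keeps its span, and it is only this span that decides
  whether \<open>I\<close> belongs to the semi-external family.\<close>

lemma semi_space_P_subset_span_Q:
  fixes v :: "'i::linorder \<Rightarrow> real ^ 'n"
  assumes X: "finite X" and semi: "semi_external v X \<I>"
  shows "semi_space_P v X \<I> \<subseteq> cpoly.span (Q_poly v X ` \<I>)"
proof -
  have "prod_form v Y \<in> cpoly.span (Q_poly v X ` \<I>)" if Y: "Y \<subseteq> X" "I0 \<in> \<I>" "Y \<inter> I0 = {}" for Y I0
  proof (rule prod_form_exchange_induct[of X _ "\<lambda>Y. span (v ` I0) \<subseteq> span (v ` (X - Y))"])
    show "finite X" by (rule X)
    show "cpoly.subspace (cpoly.span (Q_poly v X ` \<I>))" by (rule cpoly.subspace_span)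
    show "Y \<subseteq> X" by (rule Y)
    have "I0 \<subseteq> X" using semi Y by (auto simp: semi_external_def indep_subsets_def)
    then show "span (v ` I0) \<subseteq> span (v ` (X - Y))" using Y by (intro span_mono) auto
  next
    fix Y assume Inv: "span (v ` I0) \<subseteq> span (v ` (X - Y))" and Y: "Y \<subseteq> X"
      and no: "prod_form v Y \<notin> cpoly.span (Q_poly v X ` \<I>)"
    define I where "I = greedy_basis v (X - Y)"
    have fin: "finite (X - Y)" using X by simp
    have I: "I \<subseteq> X - Y" "lin_indep v I" "span (v ` I) = span (v ` (X - Y))"
      unfolding I_def
      by (rule greedy_basis_subset lin_indep_greedy_basis[OF fin] span_greedy_basis[OF fin])+
    have "I \<in> indep_subsets v X" using I by (auto simp: indep_subsets_def)
    then have "I \<in> \<I>" using semi that(2) Inv I unfolding semi_external_def by blast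
    have act: "active_set v X I \<subseteq> Y"
    proof
      fix x assume x: "x \<in> active_set v X I"
      show "x \<in> Y"
      proof (rule ccontr)
        assume "x \<notin> Y"
        then have "v x \<in> span (v ` {b\<in>I. b < x})"
          using x unfolding I_def by (intro not_in_greedy_basis[OF fin]) (auto simp: active_set_def)
        then show False using x by (simp add: active_set_def)
      qed
    qed
    have "active_set v X I \<noteq> Y"
    proof
      assume "active_set v X I = Y"
      then have "prod_form v Y = Q_poly v X I" by (simp add: Q_poly_def)
      then show False using no \<open>I \<in> \<I>\<close> by (auto intro: cpoly.span_base)
    qed
    then obtain y where y: "y \<in> Y" "y \<notin> active_set v X I" using act by auto
    let ?A = "{b\<in>I. b < y}"
    have "v y \<in> span (v ` ?A)" using y Y I by (auto simp: active_set_def)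
    moreover have "finite ?A" using I(1) fin by (auto intro: finite_subset)
    moreover have "lin_indep v ?A" using lin_indep_subset[OF I(2)] by auto
    ultimately obtain c where c: "v y = (\<Sum>b\<in>?A. c b *\<^sub>R v b)" using span_image_sum by blast
    have "span (v ` I0) \<subseteq> span (v ` (X - insert b (Y - {y})))" if b: "b \<in> ?A" "c b \<noteq> 0" for b
    proof -
      let ?S = "span (v ` (X - insert b (Y - {y})))"
      \<comment> \<open>As \<open>c b\<close> is nonzero, \<open>v b\<close> can be solved for from the other vectors of the relation.\<close>
      have mem: "v z \<in> ?S" if "z \<in> I \<union> {y}" "z \<noteq> b" for z
        using that I Y y by (intro span_base) auto
      have "v y = c b *\<^sub>R v b + (\<Sum>b\<in>?A - {b}. c b *\<^sub>R v b)"
        unfolding c using \<open>finite ?A\<close> b(1) by (intro sum.remove)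
      then have "c b *\<^sub>R v b = v y - (\<Sum>b\<in>?A - {b}. c b *\<^sub>R v b)" by simp
      also have "\<dots> \<in> ?S" using b by (intro span_diff span_sum span_scale mem) auto
      finally have "inverse (c b) *\<^sub>R (c b *\<^sub>R v b) \<in> ?S" by (rule span_scale)
      then have "v b \<in> ?S" using b by simp
      then have "v ` I \<subseteq> ?S" using mem by blast
      then have "span (v ` I) \<subseteq> ?S" by (intro span_minimal) auto
      then show ?thesis using Inv I by auto
    qed
    moreover have "?A \<subseteq> X" "?A \<inter> Y = {}" "\<forall>b\<in>?A. b < y" using I by auto
    ultimately show "\<exists>y\<in>Y. \<exists>A c. A \<subseteq> X \<and> A \<inter> Y = {} \<and> (\<forall>b\<in>A. b < y) \<and> v y = (\<Sum>b\<in>A. c b *\<^sub>R v b) \<and>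
        (\<forall>b\<in>A. c b \<noteq> 0 \<longrightarrow> span (v ` I0) \<subseteq> span (v ` (X - insert b (Y - {y}))))"
      using y(1) c by blast
  qed
  then show ?thesis unfolding semi_space_P_def by (intro cpoly.span_minimal) auto
qed

lemma Q_poly_in_semi_space_P:
  assumes "I \<in> \<I>" shows "Q_poly v X I \<in> semi_space_P v X \<I>"
  unfolding semi_space_P_def Q_poly_def
  using assms by (intro cpoly.span_base) (auto simp: active_set_def)

lemma span_Q_eq_semi_space_P:
  fixes v :: "'i::linorder \<Rightarrow> real ^ 'n"
  assumes "finite X" "semi_external v X \<I>"
  shows "cpoly.span (Q_poly v X ` \<I>) = semi_space_P v X \<I>"
proof
  show "cpoly.span (Q_poly v X ` \<I>) \<subseteq> semi_space_P v X \<I>"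
    using Q_poly_in_semi_space_P by (intro cpoly.span_minimal) (auto simp: semi_space_P_def)
qed (rule semi_space_P_subset_span_Q[OF assms])

lemma subspace_semi_ideal_J: "cpoly.subspace (semi_ideal_J v X B0 \<I>)"
  unfolding semi_ideal_J_def cpoly.subspace_def
  by (auto intro: ideal.span_add ideal.span_zero ideal.span_scale simp: pscale_def)

lemma greedy_ext_basis:
  fixes v :: "'i::linorder \<Rightarrow> real ^ 'n"
  assumes X: "finite X" and B0: "finite B0" "span (v ` B0) = UNIV"
    and less: "\<And>x b. x \<in> X \<Longrightarrow> b \<in> B0 \<Longrightarrow> x < b" and I: "I \<in> indep_subsets v X"
  shows "is_basis v (greedy_ext v B0 I)" "I \<subseteq> greedy_ext v B0 I" "greedy_ext v B0 I \<subseteq> I \<union> B0"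
    "b \<in> B0 - greedy_ext v B0 I \<Longrightarrow> v b \<in> span (v ` {c \<in> greedy_ext v B0 I. c < b})"
proof -
  have I: "I \<subseteq> X" "lin_indep v I" using I by (auto simp: indep_subsets_def)
  then have eq: "greedy_ext v B0 I = greedy_basis v (I \<union> B0)"
    using less by (intro greedy_ext_eq_greedy_basis) auto
  have fin: "finite (I \<union> B0)" using I X B0 finite_subset by auto
  have "span (v ` B0) \<subseteq> span (v ` (I \<union> B0))" by (intro span_mono) auto
  then show "is_basis v (greedy_ext v B0 I)"
    unfolding eq is_basis_def span_greedy_basis[OF fin] using lin_indep_greedy_basis[OF fin] B0 by auto
  show "I \<subseteq> greedy_ext v B0 I" by (auto simp: greedy_ext_def)
  show "greedy_ext v B0 I \<subseteq> I \<union> B0" unfolding eq by (rule greedy_basis_subset)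
  show "v b \<in> span (v ` {c \<in> greedy_ext v B0 I. c < b})" if "b \<in> B0 - greedy_ext v B0 I"
    using that unfolding eq by (intro not_in_greedy_basis[OF fin]) auto
qed

text \<open>A product \<open>p\<^sub>Y\<close> with \<open>Y \<subseteq> X \<union> B\<^sub>0\<close> lies in \<open>J\<close> if \<open>Y\<close> meets all completions \<open>ex(I)\<close>. If it misses one, then it
  lies in \<open>P\<close>, or \<open>Y\<close> contains some \<open>b\<close> in \<open>B\<^sub>0\<close>, which depends on smaller elements of \<open>ex(I)\<close> and can be exchanged.
  To pass from these products to all polynomials, multiply \<open>p\<^sub>Y\<close> in \<open>P\<close> by a linear form and expand that form in the basis
  \<open>ex(I)\<close>, which is disjoint from \<open>Y\<close>: no factor is repeated, and the products are again of the first kind.\<close>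

theorem semi_ideal_J_plus_semi_space_P:
  fixes v :: "'i::linorder \<Rightarrow> real ^ 'n"
  assumes X: "finite X" "finite B0" "span (v ` B0) = UNIV" "X \<inter> B0 = {}"
    and less: "\<And>x b. x \<in> X \<Longrightarrow> b \<in> B0 \<Longrightarrow> x < b" and \<I>: "\<I> \<subseteq> indep_subsets v X"
  shows "{p + q | p q. p \<in> semi_ideal_J v X B0 \<I> \<and> q \<in> semi_space_P v X \<I>} = UNIV" (is "?C = _")
proof -
  let ?J = "semi_ideal_J v X B0 \<I>" and ?P = "semi_space_P v X \<I>"
  have C: "cpoly.subspace ?C"
    using subspace_semi_ideal_J by (intro cpoly.subspace_sums) (auto simp: semi_space_P_def)
  have J: "p \<in> ?C" if "p \<in> ?J" for p
    using that by (force simp: semi_space_P_def intro: cpoly.span_zero)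
  have P: "q \<in> ?C" if "q \<in> ?P" for q
    using that cpoly.subspace_0[OF subspace_semi_ideal_J] by force
  have ext: "finite (greedy_ext v B0 I)" "lin_indep v (greedy_ext v B0 I)"
    "span (v ` greedy_ext v B0 I) = UNIV" "greedy_ext v B0 I \<subseteq> I \<union> B0" "I \<subseteq> greedy_ext v B0 I" "I \<subseteq> X"
    "\<And>b. b \<in> B0 - greedy_ext v B0 I \<Longrightarrow> v b \<in> span (v ` {c \<in> greedy_ext v B0 I. c < b})"
    if "I \<in> \<I>" for I
  proof -
    have I: "I \<in> indep_subsets v X" using that \<I> by auto
    note ext = greedy_ext_basis[OF X(1,2,3) less I]
    show "I \<subseteq> X" using I by (simp add: indep_subsets_def)
    then show "finite (greedy_ext v B0 I)" using ext(3) X by (meson finite_Un finite_subset)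
    show "lin_indep v (greedy_ext v B0 I)" "span (v ` greedy_ext v B0 I) = UNIV"
      using ext(1) by (simp_all add: is_basis_def)
  qed (use greedy_ext_basis(2-)[OF X(1,2,3) less] that \<I> in blast)+
  have prod: "prod_form v Y \<in> ?C" if "Y \<subseteq> X \<union> B0" for Y
  proof (rule prod_form_exchange_induct[of "X \<union> B0" _ "\<lambda>_. True"])
    fix Y assume Y: "Y \<subseteq> X \<union> B0" "prod_form v Y \<notin> ?C"
    have "\<exists>I\<in>\<I>. Y \<inter> greedy_ext v B0 I = {}"
    proof (rule ccontr)
      assume "\<not> (\<exists>I\<in>\<I>. Y \<inter> greedy_ext v B0 I = {})"
      then have "prod_form v Y \<in> ?J" unfolding semi_ideal_J_def using Y(1) by (intro ideal.span_base) auto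
      then show False using J Y by blast
    qed
    then obtain I where I: "I \<in> \<I>" "Y \<inter> greedy_ext v B0 I = {}" by blast
    have "\<not> Y \<subseteq> X"
    proof
      assume "Y \<subseteq> X"
      moreover have "Y \<inter> I = {}" using I ext(5)[OF I(1)] by auto
      ultimately have "prod_form v Y \<in> ?P" unfolding semi_space_P_def using I(1)
        by (intro cpoly.span_base) auto
      then show False using P Y by blast
    qed
    then obtain b where "b \<in> Y" "b \<notin> X" by blast
    then have b: "b \<in> Y" "b \<in> B0" "b \<notin> greedy_ext v B0 I" using Y I by auto
    let ?A = "{c \<in> greedy_ext v B0 I. c < b}"
    have "v b \<in> span (v ` ?A)" using ext(7)[OF I(1)] b by auto
    moreover have "finite ?A" using ext(1)[OF I(1)] by simp
    moreover have "lin_indep v ?A" using lin_indep_subset[OF ext(2)[OF I(1)]] by auto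
    ultimately obtain c where "v b = (\<Sum>b\<in>?A. c b *\<^sub>R v b)" using span_image_sum by blast
    moreover have "?A \<subseteq> X \<union> B0" "?A \<inter> Y = {}" "\<forall>c\<in>?A. c < b"
      using ext(4,6)[OF I(1)] I(2) by auto
    ultimately show "\<exists>y\<in>Y. \<exists>A c. A \<subseteq> X \<union> B0 \<and> A \<inter> Y = {} \<and> (\<forall>b\<in>A. b < y) \<and>
        v y = (\<Sum>b\<in>A. c b *\<^sub>R v b) \<and> (\<forall>b\<in>A. c b \<noteq> 0 \<longrightarrow> True)"
      using b(1) by blast
  qed (use X C that in auto)
  have lin: "lin_form w * p \<in> ?C" if p: "p \<in> ?C" for w p
  proof -
    obtain j q where jq: "j \<in> ?J" "q \<in> ?P" "p = j + q" using p by blast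
    have "lin_form w * j \<in> ?C"
      using jq(1) by (intro J) (simp add: semi_ideal_J_def ideal.span_scale)
    moreover have "lin_form w * q \<in> cpoly.span ?C"
    proof (rule mult_cpoly_span[OF _ jq(2)[unfolded semi_space_P_def]])
      fix a assume "a \<in> {prod_form v Y |Y. Y \<subseteq> X \<and> (\<exists>I\<in>\<I>. Y \<inter> I = {})}"
      then obtain Y I where Y: "a = prod_form v Y" "Y \<subseteq> X" "I \<in> \<I>" "Y \<inter> I = {}" by auto
      have disj: "greedy_ext v B0 I \<inter> Y = {}" using ext(4)[OF Y(3)] Y(2,4) X(4) by blast
      obtain c where w: "w = (\<Sum>b\<in>greedy_ext v B0 I. c b *\<^sub>R v b)"
        using span_image_sum[OF ext(1,2)[OF Y(3)], of w] ext(3)[OF Y(3)] by auto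
      have "finite Y" using Y X finite_subset by auto
      have "prod_form v (insert b Y) \<in> ?C" if "b \<in> greedy_ext v B0 I" for b
        using that ext(4,6)[OF Y(3)] Y by (intro prod) auto
      then show "lin_form w * a \<in> cpoly.span ?C"
        unfolding w Y(1) lin_form_sum_mult_prod_form[OF \<open>finite Y\<close> disj]
        by (intro cpoly.span_sum cpoly.span_scale cpoly.span_base)
    qed
    then have "lin_form w * q \<in> ?C" using C by (simp only: cpoly.span_eq_iff[THEN iffD2])
    ultimately show ?thesis using C unfolding jq(3) distrib_left by (rule cpoly.subspace_add[rotated])
  qed
  have "p \<in> ?C" for p
  proof (induction p rule: cpoly_induct)
    case (const c)
    have "prod_form v {} \<in> ?C" by (rule prod) simp
    then have "pscale c (prod_form v {}) \<in> ?C" using C cpoly.subspace_scale by blast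
    then show ?case by (simp add: prod_form_def pscale_def)
  next
    case (add p q)
    then show ?case using cpoly.subspace_add[OF C] by blast
  next
    case (var i p)
    then show ?case using lin[of p "axis i 1"] by (simp only: lin_form_axis)
  qed
  then show ?thesis by blast
qed

section \<open>Evaluation of polynomials\<close>

definition mon_eval :: "'n::finite mon \<Rightarrow> real ^ 'n \<Rightarrow> complex" where
  "mon_eval m t = (\<Prod>i\<in>UNIV. complex_of_real (t $ i) ^ coef m i)"

lemma mon_eval_add: "mon_eval (m + m') t = mon_eval m t * mon_eval m' t"
  by (simp add: mon_eval_def lookup_add power_add prod.distrib)

lemma mon_eval_0 [simp]: "mon_eval 0 t = 1"
  by (simp add: mon_eval_def)

lemma mon_eval_var [simp]: "mon_eval (sing i (Suc 0)) t = complex_of_real (t $ i)"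
proof -
  have "mon_eval (sing i (Suc 0)) t = (\<Prod>j\<in>UNIV. if j = i then complex_of_real (t $ i) else 1)"
    unfolding mon_eval_def by (rule prod.cong) (auto simp: lookup_single)
  then show ?thesis by simp
qed

lemma peval_superset:
  assumes "finite K" "Poly_Mapping.keys p \<subseteq> K"
  shows "peval p t = (\<Sum>m\<in>K. coef p m * mon_eval m t)"
  unfolding peval_def mon_eval_def[symmetric] using assms
  by (intro sum.mono_neutral_left) (auto simp: in_keys_iff)

lemma peval_add: "peval (p + q) t = peval p t + peval q t"
proof -
  let ?K = "Poly_Mapping.keys p \<union> Poly_Mapping.keys q \<union> Poly_Mapping.keys (p + q)"
  show ?thesis
    using peval_superset[of ?K p t] peval_superset[of ?K q t] peval_superset[of ?K "p + q" t]
    by (simp add: le_supI1 le_supI2 lookup_add distrib_right sum.distrib)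
qed

lemma peval_single: "peval (sing m c) t = c * mon_eval m t"
  using peval_superset[of "{m}" "sing m c" t] by simp

lemma peval_cvar_mult: "peval (cvar i * p) t = complex_of_real (t $ i) * peval p t"
proof (induction p rule: cpoly_sum_induct)
  case (single m c)
  then show ?case by (simp add: cvar_def mult_single peval_single mon_eval_add)
next
  case (add p q)
  then show ?case by (simp add: distrib_left peval_add)
qed

lemma peval_0 [simp]: "peval 0 t = 0"
  by (simp add: peval_def)

lemma peval_pscale: "peval (pscale c p) t = c * peval p t"
proof (induction p rule: cpoly_sum_induct)
  case (single m d)
  then show ?case by (simp add: pscale_def mult_single peval_single)
next
  case (add p q)
  then show ?case by (simp add: cpoly.scale_right_distrib peval_add distrib_left)
qed

lemma peval_mult: "peval (p * q) t = peval p t * peval q t"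
proof (induction p rule: cpoly_induct)
  case (const c)
  have "peval (const c * q) t = c * peval q t" using peval_pscale[of c q t] by (simp add: pscale_def)
  then show ?case by (simp add: peval_single)
next
  case (add p p')
  then show ?case by (simp add: distrib_right peval_add)
next
  case (var i p)
  then show ?case by (simp add: mult.assoc peval_cvar_mult)
qed

lemma peval_one [simp]: "peval 1 t = 1"
  using peval_single[of 0 1 t] by simp

lemma peval_power: "peval (p ^ k) t = peval p t ^ k"
  by (induction k) (simp_all add: peval_mult)

lemma peval_sum: "peval (\<Sum>a\<in>A. f a) t = (\<Sum>a\<in>A. peval (f a) t)"
  by (induction A rule: infinite_finite_induct) (simp_all add: peval_add)

lemma peval_minus: "peval (p - q) t = peval p t - peval q t"
  using peval_add[of "p - q" q t] by simp

lemma peval_lin_form: "peval (lin_form x) t = complex_of_real (x \<bullet> t)"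
  unfolding lin_form_def peval_sum peval_single by (simp add: inner_vec_def)

lemma peval_scaleR:
  assumes "p \<in> hom_polys k"
  shows "peval p (s *\<^sub>R t) = complex_of_real s ^ k * peval p t"
proof -
  have eq: "coef p m * mon_eval m (s *\<^sub>R t) = complex_of_real s ^ k * (coef p m * mon_eval m t)"
    if "m \<in> Poly_Mapping.keys p" for m
  proof -
    have "mon_eval m (s *\<^sub>R t) = complex_of_real s ^ mdeg m * mon_eval m t"
      by (simp add: mon_eval_def mdeg_def power_mult_distrib prod.distrib power_sum)
    moreover have "mdeg m = k" using assms that by (auto simp: hom_polys_iff in_keys_iff)
    ultimately show ?thesis by simp
  qed
  show ?thesis
    unfolding peval_superset[OF finite_keys order_refl] sum_distrib_left by (rule sum.cong[OF refl eq])
qed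

text \<open>Formal and analytic derivatives agree. This is used to see that a polynomial that vanishes as a
  function on \<open>\<real>\<^sup>n\<close> has only zero coefficients.\<close>

lemma peval_has_vector_derivative:
  "((\<lambda>s. peval p (t + s *\<^sub>R axis i 1)) has_vector_derivative peval (partial i p) t) (at 0)"
proof (induction p rule: cpoly_induct)
  case (const c)
  then show ?case by (simp add: peval_single)
next
  case (add p q)
  then show ?case unfolding peval_add partial_add by (rule has_vector_derivative_add)
next
  case (var j p)
  have "((\<lambda>s. complex_of_real ((t + s *\<^sub>R axis i 1) $ j)) has_vector_derivative
      complex_of_real (axis i 1 $ j)) (at 0)"
    by (auto intro!: derivative_eq_intros)
  from has_vector_derivative_mult[OF this var]
  show ?case
    unfolding peval_cvar_mult partial_cvar_mult peval_add
    by (auto simp: axis_def algebra_simps split: if_splits)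
qed

lemma peval_eq_0_imp_eq_0:
  assumes "\<And>t. peval p t = 0"
  shows "p = 0"
proof -
  have step: "peval (partial i q) t = 0" if "\<And>t. peval q t = 0" for i q t
  proof -
    have "((\<lambda>s. peval q (t + s *\<^sub>R axis i 1)) has_vector_derivative 0) (at 0)"
      using that by simp
    then show ?thesis using peval_has_vector_derivative vector_derivative_unique_at by blast
  qed
  have "peval (partials m p) t = 0" for m t
  proof (induction m arbitrary: t rule: mon_induct)
    case zero
    then show ?case by (simp add: assms)
  next
    case (add_var i m)
    then show ?case unfolding partials_add_var by (intro step)
  qed
  then have "pairing (sing m 1) p = 0" for m
    by (simp add: pairing_def diff_op_single peval_pscale)
  then show ?thesis
    by (intro poly_mapping_eqI) (simp add: pairing_monomial)
qed

section \<open>Uniqueness of homogeneous expansions\<close>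

lemma real_power_series_zero:
  fixes a :: "nat \<Rightarrow> real"
  assumes "\<And>s. (\<lambda>n. a n * s ^ n) sums 0"
  shows "a n = 0"
proof (induction n rule: less_induct)
  case (less n)
  \<comment> \<open>After division by \<open>s\<^sup>n\<close> the coefficient \<open>a n\<close> is the limit at \<open>0\<close>.\<close>
  have "(\<lambda>k. a (k + n) * s ^ k) sums 0" if "s \<noteq> 0" for s
  proof -
    have "(\<lambda>k. a (k + n) * s ^ (k + n)) sums (0 - (\<Sum>i<n. a i * s ^ i))"
      using assms[of s] by (subst sums_iff_shift) simp
    then have "(\<lambda>k. inverse (s ^ n) * (a (k + n) * s ^ (k + n))) sums (inverse (s ^ n) * 0)"
      using less by (intro sums_mult) simp
    moreover have "inverse (s ^ n) * (a (k + n) * s ^ (k + n)) = a (k + n) * s ^ k" for k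
      using that by (simp add: power_add field_simps)
    ultimately show ?thesis by simp
  qed
  then have "((\<lambda>_. 0) \<longlongrightarrow> a (0 + n)) (at (0::real))"
    by (intro powser_limit_0_strong[of 1]) auto
  then show ?case by (simp add: tendsto_const_iff)
qed

text \<open>On each line through the origin the homogeneous components become the terms of a power series in
  one real variable.\<close>

lemma hom_expansion_unique:
  assumes F: "hom_expansion f F" and G: "hom_expansion f G"
  shows "F = G"
proof
  fix j
  have hom: "F j - G j \<in> hom_polys j" for j
    using F G by (auto simp: hom_expansion_def intro: hom_minus)
  have "peval (F j - G j) t = 0" for t
  proof -
    let ?a = "\<lambda>j. peval (F j - G j) t"
    have "(\<lambda>j. ?a j * complex_of_real s ^ j) sums 0" for s
    proof -
      have "(\<lambda>j. peval (F j) (s *\<^sub>R t) - peval (G j) (s *\<^sub>R t)) sums (f (s *\<^sub>R t) - f (s *\<^sub>R t))"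
        using F G by (intro sums_diff) (auto simp: hom_expansion_def)
      then show ?thesis
        unfolding peval_minus[symmetric] peval_scaleR[OF hom] by (simp add: mult.commute)
    qed
    then have "(\<lambda>j. Re (?a j * complex_of_real s ^ j)) sums Re 0"
        "(\<lambda>j. Im (?a j * complex_of_real s ^ j)) sums Im 0" for s
      unfolding sums_complex_iff by blast+
    then have "(\<lambda>j. Re (?a j) * s ^ j) sums 0" "(\<lambda>j. Im (?a j) * s ^ j) sums 0" for s
      unfolding of_real_power[symmetric] by simp_all
    then have "Re (?a j) = 0" "Im (?a j) = 0"
      using real_power_series_zero[of "\<lambda>j. Re (?a j)"] real_power_series_zero[of "\<lambda>j. Im (?a j)"] by auto
    then show ?thesis by (simp add: complex_eq_iff)
  qed
  then show "F j = G j" using peval_eq_0_imp_eq_0[of "F j - G j"] by simp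
qed

section \<open>Least terms of exponential sums\<close>

text \<open>The homogeneous component of degree \<open>j\<close> of \<open>t \<mapsto> e\<^bsup>w\<cdot>t\<^esup>\<close>.\<close>

definition exp_part :: "real ^ 'n \<Rightarrow> nat \<Rightarrow> 'n::finite cpoly" where
  "exp_part w j = pscale (1 / fact j) (lin_form w ^ j)"

definition exp_sum_part :: "(real ^ 'n) set \<Rightarrow> (real ^ 'n \<Rightarrow> complex) \<Rightarrow> nat \<Rightarrow> 'n::finite cpoly" where
  "exp_sum_part V c j = (\<Sum>w\<in>V. pscale (c w) (exp_part w j))"

lemma hom_exp_part: "exp_part w j \<in> hom_polys j"
  using hom_power[OF hom_lin_form[of w], where a=j] by (simp add: exp_part_def hom_pscale)

lemma hom_exp_sum_part: "exp_sum_part V c j \<in> hom_polys j"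
  unfolding exp_sum_part_def by (intro hom_sum hom_pscale hom_exp_part)

lemma dir_deriv_exp_part_Suc:
  "dir_deriv y (exp_part w (Suc j)) = pscale (complex_of_real (y \<bullet> w)) (exp_part w j)"
proof -
  have "dir_deriv y (lin_form w ^ Suc j)
      = pscale (of_nat (Suc j)) (pscale (complex_of_real (y \<bullet> w)) (lin_form w ^ j))"
    unfolding dir_deriv_power dir_deriv_lin_form pscale_def
    by (simp only: mult.assoc mult.commute[of "lin_form w ^ j"])
  then show ?thesis by (simp add: exp_part_def dir_deriv_pscale del: of_nat_Suc power_Suc)
qed

lemma dir_deriv_exp_sum_part_0: "dir_deriv y (exp_sum_part V c 0) = 0"
  by (rule dir_deriv_hom_0[OF hom_exp_sum_part])

lemma dir_deriv_exp_sum_part_Suc: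
  "dir_deriv y (exp_sum_part V c (Suc j)) = exp_sum_part V (\<lambda>w. complex_of_real (y \<bullet> w) * c w) j"
  unfolding exp_sum_part_def dir_deriv_sum dir_deriv_pscale dir_deriv_exp_part_Suc
  by (simp add: mult.commute)

text \<open>The operator \<open>D\<^sub>y - a\<close> acts on exponential sums by multiplying the coefficient at \<open>w\<close> by \<open>y \<cdot> w - a\<close>, and on
  their components of lowest degree by \<open>D\<^sub>y\<close>.\<close>

lemma exp_sum_part_shift:
  "exp_sum_part V (\<lambda>w. complex_of_real (y \<bullet> w - a) * c w) j
    = dir_deriv y (exp_sum_part V c (Suc j)) - pscale (complex_of_real a) (exp_sum_part V c j)"
  unfolding dir_deriv_exp_sum_part_Suc
  unfolding exp_sum_part_def cpoly.scale_sum_right sum_subtractf[symmetric]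
  by (intro sum.cong) (simp_all add: left_diff_distrib cpoly.scale_left_diff_distrib)

lemma coef_exp_part: "coef (exp_part w (mdeg m)) m = mon_eval m w / (\<Prod>i\<in>UNIV. fact (coef m i))"
proof (induction m rule: mon_induct)
  case zero
  show ?case by (simp add: exp_part_def)
next
  case (add_var i m)
  let ?e = "sing i (1::nat)"
  have "of_nat (Suc (coef m i)) * coef (exp_part w (Suc (mdeg m))) (m + ?e)
      = coef (partial i (exp_part w (Suc (mdeg m)))) m"
    by (simp add: lookup_partial)
  also have "\<dots> = complex_of_real (w $ i) * coef (exp_part w (mdeg m)) m"
    using dir_deriv_exp_part_Suc[of "axis i 1" w "mdeg m"] by (simp add: dir_deriv_axis inner_axis')
  finally have eq: "of_nat (Suc (coef m i)) * coef (exp_part w (Suc (mdeg m))) (m + ?e)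
      = complex_of_real (w $ i) * (mon_eval m w / (\<Prod>i\<in>UNIV. fact (coef m i)))"
    unfolding add_var .
  have "(\<Prod>j\<in>UNIV. fact (coef (m + ?e) j)) = of_nat (Suc (coef m i)) * (\<Prod>j\<in>UNIV. fact (coef m j) :: complex)"
  proof -
    have "(\<Prod>j\<in>UNIV - {i}. fact (coef (m + ?e) j)) = (\<Prod>j\<in>UNIV - {i}. fact (coef m j) :: complex)"
      by (intro prod.cong) (auto simp: lookup_add lookup_single)
    then show ?thesis
      unfolding prod.remove[OF finite UNIV_I, of _ i] by (simp add: lookup_add)
  qed
  moreover have "mdeg (m + ?e) = Suc (mdeg m)" by (simp add: mdeg_add)
  moreover have "(\<Prod>j\<in>UNIV. fact (coef m j) :: complex) \<noteq> 0" by simp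
  moreover have "of_nat (Suc (coef m i)) \<noteq> (0 :: complex)" by (rule of_nat_neq_0)
  ultimately show ?case
    using eq by (simp add: mon_eval_add nonzero_eq_divide_eq mult_ac del: of_nat_Suc prod_zero_iff)
qed

lemma hom_expansion_exp:
  assumes "finite V"
  shows "hom_expansion (\<lambda>t. \<Sum>w\<in>V. c w * exp (complex_of_real (w \<bullet> t))) (exp_sum_part V c)"
  unfolding hom_expansion_def
proof (intro conjI allI hom_exp_sum_part)
  fix t
  have "(\<lambda>j. c w * peval (exp_part w j) t) sums (c w * exp (complex_of_real (w \<bullet> t)))" for w
  proof (rule sums_mult)
    have "(\<lambda>j. complex_of_real (w \<bullet> t) ^ j /\<^sub>R fact j) sums exp (complex_of_real (w \<bullet> t))"
      by (rule exp_converges)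
    then show "(\<lambda>j. peval (exp_part w j) t) sums exp (complex_of_real (w \<bullet> t))"
      by (simp add: exp_part_def peval_pscale peval_power peval_lin_form scaleR_conv_of_real field_simps)
  qed
  then show "(\<lambda>j. peval (exp_sum_part V c j) t) sums (\<Sum>w\<in>V. c w * exp (complex_of_real (w \<bullet> t)))"
    unfolding exp_sum_part_def peval_sum peval_pscale by (intro sums_sum)
qed

lemma least_term_exp:
  assumes V: "finite V" and k: "\<And>i. i < k \<Longrightarrow> exp_sum_part V c i = 0" "exp_sum_part V c k \<noteq> 0"
  shows "least_term (\<lambda>t. \<Sum>w\<in>V. c w * exp (complex_of_real (w \<bullet> t))) = exp_sum_part V c k"
  unfolding least_term_def
proof (rule the_equality)
  let ?f = "\<lambda>t. \<Sum>w\<in>V. c w * exp (complex_of_real (w \<bullet> t))"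
  show "\<exists>F j. hom_expansion ?f F \<and> (\<forall>i<j. F i = 0) \<and> F j \<noteq> 0 \<and> exp_sum_part V c k = F j"
    using hom_expansion_exp[OF V, of c] k by blast
  fix p assume "\<exists>F j. hom_expansion ?f F \<and> (\<forall>i<j. F i = 0) \<and> F j \<noteq> 0 \<and> p = F j"
  then obtain F j where F: "hom_expansion ?f F" "\<forall>i<j. F i = 0" "F j \<noteq> 0" "p = F j" by blast
  have "F = exp_sum_part V c" using F(1) hom_expansion_exp[OF V] by (rule hom_expansion_unique)
  then have "j = k" using F k by (metis linorder_neqE_nat)
  then show "p = exp_sum_part V c k" using F \<open>F = exp_sum_part V c\<close> by simp
qed

text \<open>Least terms are read off from coefficient vectors on \<open>V\<close>, so that from here on functions are replaced by linear algebra.\<close>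

lemma least_terms_exp_space:
  assumes V: "finite V"
  shows "{least_term f | f. f \<in> exp_space V \<and> f \<noteq> (\<lambda>t. 0)}
    = {exp_sum_part V c k | c k. (\<forall>i<k. exp_sum_part V c i = 0) \<and> exp_sum_part V c k \<noteq> 0}" (is "?L = ?R")
proof
  let ?f = "\<lambda>c t. \<Sum>w\<in>V. c w * exp (complex_of_real (w \<bullet> t))"
  show "?L \<subseteq> ?R"
  proof
    fix p assume "p \<in> ?L"
    then obtain c where c: "p = least_term (?f c)" "?f c \<noteq> (\<lambda>t. 0)" by (auto simp: exp_space_def)
    have "\<exists>k. exp_sum_part V c k \<noteq> 0"
    proof (rule ccontr)
      assume "\<not> (\<exists>k. exp_sum_part V c k \<noteq> 0)"
      then have "(\<lambda>j. 0) sums ?f c t" for t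
        using hom_expansion_exp[OF V, of c] by (auto simp: hom_expansion_def)
      then have "?f c t = 0" for t using sums_unique2 sums_zero by blast
      then show False using c by auto
    qed
    then obtain k where k: "exp_sum_part V c k \<noteq> 0" "\<And>i. i < k \<Longrightarrow> exp_sum_part V c i = 0"
      using exists_least_iff[of "\<lambda>k. exp_sum_part V c k \<noteq> 0"] by auto
    then show "p \<in> ?R" using least_term_exp[OF V k(2,1)] c by blast
  qed
  show "?R \<subseteq> ?L"
  proof
    fix p assume "p \<in> ?R"
    then obtain c k where k: "p = exp_sum_part V c k" "\<And>i. i < k \<Longrightarrow> exp_sum_part V c i = 0"
      "exp_sum_part V c k \<noteq> 0" by blast
    have "?f c \<noteq> (\<lambda>t. 0)"
    proof
      assume "?f c = (\<lambda>t. 0)"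
      then have "hom_expansion (\<lambda>t. 0) (exp_sum_part V c)" using hom_expansion_exp[OF V, of c] by simp
      moreover have "hom_expansion (\<lambda>t. 0) (\<lambda>j. 0 :: 'a cpoly)" by (simp add: hom_expansion_def)
      ultimately have "exp_sum_part V c = (\<lambda>j. 0)" by (rule hom_expansion_unique)
      then show False using k by simp
    qed
    moreover have "?f c \<in> exp_space V" by (auto simp: exp_space_def)
    ultimately show "p \<in> ?L" using least_term_exp[OF V k(2,3)] k(1) by (metis (mono_tags, lifting) mem_Collect_eq)
  qed
qed

text \<open>Exponentials with different frequencies are linearly independent: an operator \<open>D\<^sub>y - y \<cdot> u\<close> removes the frequency
  \<open>u\<close> from a vanishing exponential sum and keeps another one.\<close>

lemma exp_sum_part_zero_imp_coeff_zero:
  assumes V: "finite V" and "\<And>j. exp_sum_part V c j = 0" "w \<in> V"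
  shows "c w = 0"
  using assms(2,3)
proof (induction "card {w\<in>V. c w \<noteq> 0}" arbitrary: c w rule: less_induct)
  case (less c w)
  show ?case
  proof (rule ccontr)
    assume w: "c w \<noteq> 0"
    show False
    proof (cases "\<exists>u\<in>V. u \<noteq> w \<and> c u \<noteq> 0")
      case True
      then obtain u where u: "u \<in> V" "u \<noteq> w" "c u \<noteq> 0" by blast
      \<comment> \<open>The factor below vanishes at \<open>u\<close>, and at \<open>w\<close> it is \<open>y \<cdot> y\<close> for this choice of \<open>y\<close>.\<close>
      define y where "y = w - u"
      let ?d = "\<lambda>w. complex_of_real (y \<bullet> w - y \<bullet> u) * c w"
      have "?d w = 0"
      proof (rule less.hyps)
        show "card {w\<in>V. ?d w \<noteq> 0} < card {w\<in>V. c w \<noteq> 0}"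
          using V u by (intro psubset_card_mono) auto
        show "exp_sum_part V ?d j = 0" for j
          unfolding exp_sum_part_shift by (simp add: less.prems(1))
        show "w \<in> V" by fact
      qed
      moreover have "y \<bullet> w - y \<bullet> u = y \<bullet> y" by (simp add: y_def inner_diff_right)
      ultimately show False using w u by (simp add: y_def)
    next
      case False
      have "exp_sum_part V c 0 = pscale (c w) (exp_part w 0) + (\<Sum>w\<in>V - {w}. pscale (c w) (exp_part w 0))"
        unfolding exp_sum_part_def using V less.prems by (intro sum.remove)
      also have "(\<Sum>w\<in>V - {w}. pscale (c w) (exp_part w 0)) = 0"
        using False by (intro sum.neutral) auto
      finally have "pscale (c w) 1 = (0 :: 'a cpoly)"
        using less.prems(1)[of 0] by (simp add: exp_part_def)
      then show False using w by simp
    qed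
  qed
qed

text \<open>Suppose that the least space is spanned by fewer than \<open>card V\<close> polynomials \<open>g\<close>. Then some nonzero coefficient vector \<open>c\<close>
  satisfies \<open>\<Sum>\<^sub>w c\<^sub>w cnj(g(w)) = 0\<close> for all of them, hence for all \<open>g\<close> in the least space. Take for \<open>g\<close> the least
  term of the exponential sum with coefficients \<open>c\<close>: its coefficient at \<open>t\<^sup>m\<close> is \<open>(\<Sum>\<^sub>w c\<^sub>w w\<^sup>m) / m!\<close>, so the
  sum equals \<open>\<Sum>\<^sub>m m! \<bar>g\<^sub>m\<bar>\<^sup>2\<close>, which is positive.\<close>

theorem card_le_of_least_space_subset_span:
  assumes V: "finite V" and G: "finite G" "least_space V \<subseteq> cpoly.span G"
  shows "card V \<le> card G"
proof (rule ccontr)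
  assume "\<not> card V \<le> card G"
  then have "card G < card V" by simp
  from homogeneous_system[OF G(1) V this, of "\<lambda>g w. cnj (peval g w)"]
  obtain c where c: "\<exists>w\<in>V. c w \<noteq> 0" and sys: "\<And>g. g \<in> G \<Longrightarrow> (\<Sum>w\<in>V. cnj (peval g w) * c w) = 0" by blast
  have orth: "(\<Sum>w\<in>V. cnj (peval g w) * c w) = 0" if "g \<in> cpoly.span G" for g
    using that
  proof (induction rule: cpoly.span_induct_alt)
    case (step a g h)
    have "(\<Sum>w\<in>V. cnj (peval (pscale a g + h) w) * c w)
        = cnj a * (\<Sum>w\<in>V. cnj (peval g w) * c w) + (\<Sum>w\<in>V. cnj (peval h w) * c w)"
      by (simp add: peval_add peval_pscale sum.distrib sum_distrib_left algebra_simps)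
    then show ?case using step sys by simp
  qed simp
  have "\<exists>k. exp_sum_part V c k \<noteq> 0"
    using exp_sum_part_zero_imp_coeff_zero[OF V, of c] c by blast
  then obtain k where k: "exp_sum_part V c k \<noteq> 0" "\<And>i. i < k \<Longrightarrow> exp_sum_part V c i = 0"
    using exists_least_iff[of "\<lambda>k. exp_sum_part V c k \<noteq> 0"] by auto
  define g where "g = exp_sum_part V c k"
  have "g \<in> least_space V"
    unfolding least_space_def least_terms_exp_space[OF V] g_def using k by (intro cpoly.span_base) blast
  then have 0: "(\<Sum>w\<in>V. cnj (peval g w) * c w) = 0" using orth G by blast
  let ?fact = "\<lambda>m. (\<Prod>i\<in>UNIV. fact (coef m i)) :: real"
  have "(\<Sum>w\<in>V. cnj (peval g w) * c w)
      = (\<Sum>w\<in>V. \<Sum>m\<in>Poly_Mapping.keys g. cnj (coef g m) * (mon_eval m w * c w))"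
    unfolding peval_superset[OF finite_keys order_refl]
    by (intro sum.cong) (auto simp: sum_distrib_right mult.assoc mon_eval_def)
  also have "\<dots> = (\<Sum>m\<in>Poly_Mapping.keys g. cnj (coef g m) * (\<Sum>w\<in>V. mon_eval m w * c w))"
    by (subst sum.swap) (simp add: sum_distrib_left)
  also have "\<dots> = (\<Sum>m\<in>Poly_Mapping.keys g. complex_of_real (?fact m * (cmod (coef g m))\<^sup>2))"
  proof (rule sum.cong[OF refl])
    fix m assume "m \<in> Poly_Mapping.keys g"
    then have m: "mdeg m = k"
      using hom_exp_sum_part[of V c k] by (auto simp: g_def hom_polys_iff in_keys_iff)
    have "coef g m = (\<Sum>w\<in>V. c w * (mon_eval m w / complex_of_real (?fact m)))"
      unfolding g_def exp_sum_part_def lookup_sum coef_pscale m[symmetric] coef_exp_part by simp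
    also have "\<dots> = (\<Sum>w\<in>V. mon_eval m w * c w) / complex_of_real (?fact m)"
      unfolding sum_divide_distrib by (intro sum.cong) auto
    finally have "(\<Sum>w\<in>V. mon_eval m w * c w) = complex_of_real (?fact m) * coef g m"
      by simp
    then show "cnj (coef g m) * (\<Sum>w\<in>V. mon_eval m w * c w) = complex_of_real (?fact m * (cmod (coef g m))\<^sup>2)"
      using complex_norm_square[of "coef g m"] by (simp add: mult_ac)
  qed
  finally have "complex_of_real (\<Sum>m\<in>Poly_Mapping.keys g. ?fact m * (cmod (coef g m))\<^sup>2) = 0"
    using 0 by simp
  then have "(\<Sum>m\<in>Poly_Mapping.keys g. ?fact m * (cmod (coef g m))\<^sup>2) = 0"
    by (simp only: of_real_eq_0_iff)
  then have "\<forall>m\<in>Poly_Mapping.keys g. ?fact m * (cmod (coef g m))\<^sup>2 = 0"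
    by (subst (asm) sum_nonneg_eq_0_iff) (auto intro!: mult_nonneg_nonneg prod_nonneg)
  then have "coef g m = 0" for m by (cases "m \<in> Poly_Mapping.keys g") (auto simp: in_keys_iff)
  then have "g = 0" by (intro poly_mapping_eqI) simp
  then show False using k by (simp add: g_def)
qed

text \<open>The operator \<open>\<Prod>\<^sub>y (D\<^sub>y - lam y)\<close> multiplies the coefficient at \<open>w\<close> by \<open>\<Prod>\<^sub>y (y \<cdot> w - lam y) = 0\<close> and so annihilates the
  exponential sum; its leading part \<open>p\<^sub>Y(D)\<close> then annihilates the least term.\<close>

lemma diff_op_prod_form_least:
  assumes "finite Y" "\<And>w. w \<in> V \<Longrightarrow> c w \<noteq> 0 \<Longrightarrow> \<exists>y\<in>Y. v y \<bullet> w = lam y"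
    and "\<And>i. i < k \<Longrightarrow> exp_sum_part V c i = 0"
  shows "diff_op (prod_form v Y) (exp_sum_part V c k) = 0"
  using assms
proof (induction Y arbitrary: c k rule: finite_induct)
  case empty
  then have "c w = 0" if "w \<in> V" for w using that by blast
  then show ?case by (simp add: exp_sum_part_def)
next
  case (insert y Y)
  have eq: "diff_op (prod_form v (insert y Y)) p = diff_op (prod_form v Y) (dir_deriv (v y) p)" for p
    using insert.hyps by (simp add: prod_form_insert mult.commute[of "lin_form (v y)"] diff_op_mult diff_op_lin_form)
  show ?case
  proof (cases k)
    case 0
    then show ?thesis unfolding eq by (simp add: dir_deriv_exp_sum_part_0)
  next
    case (Suc k')
    let ?c = "\<lambda>w. complex_of_real (v y \<bullet> w - lam y) * c w"
    have "dir_deriv (v y) (exp_sum_part V c k) = exp_sum_part V ?c k'"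
      unfolding exp_sum_part_shift Suc using insert.prems(2)[of k'] Suc by simp
    moreover have "diff_op (prod_form v Y) (exp_sum_part V ?c k') = 0"
    proof (rule insert.IH)
      show "\<exists>z\<in>Y. v z \<bullet> w = lam z" if "w \<in> V" "?c w \<noteq> 0" for w
        using insert.prems(1)[of w] that by auto
      show "exp_sum_part V ?c i = 0" if "i < k'" for i
        unfolding exp_sum_part_shift using insert.prems(2)[of i] insert.prems(2)[of "Suc i"] that Suc by simp
    qed
    ultimately show ?thesis unfolding eq by simp
  qed
qed

section \<open>Vertices of a simple arrangement\<close>

lemma is_basis_finite_card:
  fixes v :: "'i \<Rightarrow> real ^ 'n"
  assumes "is_basis v B"
  shows "finite B" "card B = CARD('n)"
proof -
  have B: "inj_on v B" "independent (v ` B)" "span (v ` B) = UNIV"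
    using assms by (auto simp: is_basis_def lin_indep_def)
  have "finite (v ` B)" using B(2) by (rule independent_imp_finite)
  then show "finite B" using B(1) by (rule finite_imageD)
  have "card (v ` B) = dim (v ` B)" using B(2) by (simp add: dim_eq_card_independent)
  also have "\<dots> = dim (span (v ` B))" by simp
  also have "\<dots> = CARD('n)" unfolding B(3) by simp
  finally show "card B = CARD('n)" using B(1) by (simp add: card_image)
qed

lemma vertex_ex1:
  fixes v :: "'i \<Rightarrow> real ^ 'n"
  assumes "is_basis v B"
  shows "\<exists>!t. t \<in> (\<Inter>b\<in>B. hyperplane v lam b)"
proof -
  have B: "inj_on v B" "independent (v ` B)" "span (v ` B) = UNIV"
    using assms by (auto simp: is_basis_def lin_indep_def)
  obtain g :: "real ^ 'n \<Rightarrow> real" where g: "linear g" "\<And>x. x \<in> v ` B \<Longrightarrow> g x = lam (inv_into B v x)"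
    using linear_independent_extend[OF B(2), of "\<lambda>x. lam (inv_into B v x)"] by blast
  define t where "t = (\<Sum>e\<in>Basis. g e *\<^sub>R e)"
  have gt: "g x = x \<bullet> t" for x
  proof -
    have "g x = g (\<Sum>e\<in>Basis. (x \<bullet> e) *\<^sub>R e)" by (simp add: euclidean_representation)
    also have "\<dots> = x \<bullet> t" by (simp add: t_def linear_sum[OF g(1)] linear_scale[OF g(1)] inner_sum_right mult.commute)
    finally show ?thesis .
  qed
  show ?thesis
  proof (rule ex1I)
    show "t \<in> (\<Inter>b\<in>B. hyperplane v lam b)"
      using g(2) B(1) by (auto simp: hyperplane_def simp flip: gt)
    fix s assume s: "s \<in> (\<Inter>b\<in>B. hyperplane v lam b)"
    have orth: "x \<bullet> (s - t) = 0" if "x \<in> v ` B" for x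
      using s that g(2)[OF that] B(1) by (auto simp: hyperplane_def inner_diff_right simp flip: gt)
    have "x \<bullet> (s - t) = 0" if "x \<in> span (v ` B)" for x
      using that by (induction rule: span_induct_alt) (simp_all add: inner_add_left orth)
    then have "(s - t) \<bullet> (s - t) = 0" unfolding B(3) by blast
    then show "s = t" by simp
  qed
qed

text \<open>A further hyperplane through the vertex would give a nonempty intersection of codimension \<open>n + 1\<close>.\<close>

lemma vertex_incidence:
  fixes v :: "'i \<Rightarrow> real ^ 'n"
  assumes simple: "simple_arrangement v lam Z" and B: "is_basis v B" "B \<subseteq> Z" and x: "x \<in> Z"
  shows "v x \<bullet> vertex v lam B = lam x \<longleftrightarrow> x \<in> B"
proof -
  let ?t = "vertex v lam B"
  have t: "?t \<in> (\<Inter>b\<in>B. hyperplane v lam b)"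
    unfolding vertex_def by (rule theI'[OF vertex_ex1[OF B(1)]])
  have False if "v x \<bullet> ?t = lam x" "x \<notin> B"
  proof -
    let ?H = "\<Inter>b\<in>insert x B. hyperplane v lam b"
    have "?t \<in> ?H" using t that by (simp add: hyperplane_def)
    then have ne: "?H \<noteq> {}" by blast
    have "insert x B \<subseteq> Z" using B x by simp
    then have "aff_dim ?H = int CARD('n) - int (card (insert x B))"
      using simple ne unfolding simple_arrangement_def by blast
    also have "\<dots> = -1" using that is_basis_finite_card[OF B(1)] by simp
    finally show False using ne aff_dim_empty by blast
  qed
  then show ?thesis using t by (auto simp: hyperplane_def)
qed

section \<open>Pairings that are perfect by a dimension count\<close>

text \<open>More elements of \<open>D\<close> than functionals \<open>pairing (Q i)\<close> admit a combination on which all these functionals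
  vanish.\<close>

lemma independent_card_le:
  fixes Q :: "'a \<Rightarrow> 'n::finite cpoly"
  assumes J: "finite J" and D: "cpoly.subspace D"
    and nondeg: "\<And>q. q \<in> D \<Longrightarrow> (\<And>i. i \<in> J \<Longrightarrow> pairing (Q i) q = 0) \<Longrightarrow> q = 0"
    and G: "G \<subseteq> D" "cpoly.independent G"
  shows "finite G \<and> card G \<le> card J"
proof -
  have fin: "card G \<le> card J" if "finite G" "G \<subseteq> D" "cpoly.independent G" for G
  proof (rule ccontr)
    assume "\<not> card G \<le> card J"
    then have "card J < card G" by simp
    from homogeneous_system[OF J that(1) this, of "\<lambda>i. pairing (Q i)"]
    obtain c where c: "\<exists>g\<in>G. c g \<noteq> 0" "\<And>i. i \<in> J \<Longrightarrow> (\<Sum>g\<in>G. pairing (Q i) g * c g) = 0" by blast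
    have "(\<Sum>g\<in>G. pscale (c g) g) = 0"
    proof (rule nondeg)
      show "(\<Sum>g\<in>G. pscale (c g) g) \<in> D"
        using that D by (intro cpoly.subspace_sum cpoly.subspace_scale) auto
      show "pairing (Q i) (\<Sum>g\<in>G. pscale (c g) g) = 0" if "i \<in> J" for i
        using c(2)[OF that] by (simp add: pairing_sum_right pairing_pscale_right mult.commute)
    qed
    then show False using c(1) that by (auto simp: cpoly.dependent_finite)
  qed
  moreover have "finite G"
  proof (rule ccontr)
    assume "infinite G"
    then obtain G' where G': "G' \<subseteq> G" "finite G'" "card G' = Suc (card J)"
      using infinite_arbitrarily_large by blast
    then have "card G' \<le> card J" using G cpoly.independent_mono[OF G(2) G'(1)] by (intro fin) auto
    then show False using G' by simp
  qed
  ultimately show ?thesis using G by blast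
qed

text \<open>The functionals \<open>pairing (Q i)\<close> bound the dimension of \<open>D\<close> from above by \<open>card J\<close>, and the subspace \<open>L\<close> bounds it from
  below. So both bounds are attained, \<open>L\<close> is all of \<open>D\<close>, and the pairing matrix between the \<open>Q i\<close> and a basis of
  \<open>D\<close> is square and injective on one side, hence also on the other side, and it is surjective.\<close>

lemma perfect_pairing:
  fixes Q :: "'a \<Rightarrow> 'n::finite cpoly"
  assumes J: "finite J" and D: "cpoly.subspace D" and L: "cpoly.subspace L" "L \<subseteq> D"
    and nondegenerate: "\<forall>q\<in>D. (\<forall>i\<in>J. pairing (Q i) q = 0) \<longrightarrow> q = 0"
    and lower: "\<forall>G. finite G \<and> L \<subseteq> cpoly.span G \<longrightarrow> card J \<le> card G"
  shows "L = D" "cpoly.dim D = card J"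
    "\<And>a. (\<And>q. q \<in> D \<Longrightarrow> (\<Sum>i\<in>J. a i * pairing (Q i) q) = 0) \<Longrightarrow> (\<forall>i\<in>J. a i = 0)"
    "\<And>f. f \<in> dual_space D \<Longrightarrow> \<exists>a. \<forall>q\<in>D. f q = (\<Sum>i\<in>J. a i * pairing (Q i) q)"
proof -
  have nondeg: "\<And>q. q \<in> D \<Longrightarrow> (\<And>i. i \<in> J \<Longrightarrow> pairing (Q i) q = 0) \<Longrightarrow> q = 0"
    using nondegenerate by blast
  note card_le = independent_card_le[where Q = Q, OF J D nondeg]
  obtain G where G: "G \<subseteq> L" "cpoly.independent G" "L \<subseteq> cpoly.span G"
    using cpoly.maximal_independent_subset[of L] by blast
  have finG: "finite G" and "card G \<le> card J" using card_le[of G] G L by auto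
  then have cardG: "card G = card J" using lower G(3) by (simp add: le_antisym)
  have D_span: "D \<subseteq> cpoly.span G"
  proof
    fix d assume d: "d \<in> D"
    show "d \<in> cpoly.span G"
    proof (rule ccontr)
      assume n: "d \<notin> cpoly.span G"
      then have "cpoly.independent (insert d G)" using G(2) by (simp add: cpoly.independent_insertI)
      then have "card (insert d G) \<le> card J" using card_le[of "insert d G"] d G L by auto
      moreover have "d \<notin> G" using n cpoly.span_base by blast
      ultimately show False using finG cardG by simp
    qed
  qed
  moreover have "cpoly.span G \<subseteq> L" using G L by (intro cpoly.span_minimal)
  ultimately show LD: "L = D" using L by blast
  then have GD: "cpoly.span G = D" using D_span \<open>cpoly.span G \<subseteq> L\<close> by blast
  show "cpoly.dim D = card J"
    unfolding cardG[symmetric] GD[symmetric] using G(2) by (simp add: cpoly.dim_eq_card_independent)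
  show inj: "\<forall>i\<in>J. a i = 0" if a: "\<And>q. q \<in> D \<Longrightarrow> (\<Sum>i\<in>J. a i * pairing (Q i) q) = 0" for a
  proof (rule ccontr)
    assume "\<not> (\<forall>i\<in>J. a i = 0)"
    then obtain i0 where i0: "i0 \<in> J" "a i0 \<noteq> 0" by blast
    have "card (J - {i0}) < card G" unfolding cardG using J i0 by (intro card_Diff1_less)
    from homogeneous_system[OF _ finG this, of "\<lambda>i. pairing (Q i)"] J
    obtain c where c: "\<exists>g\<in>G. c g \<noteq> 0" "\<And>i. i \<in> J - {i0} \<Longrightarrow> (\<Sum>g\<in>G. pairing (Q i) g * c g) = 0" by blast
    let ?q = "\<Sum>g\<in>G. pscale (c g) g"
    have q: "?q \<in> D" unfolding GD[symmetric]
      by (intro cpoly.span_sum cpoly.span_scale cpoly.span_base)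
    have other: "pairing (Q i) ?q = 0" if "i \<in> J - {i0}" for i
      using c(2)[OF that] by (simp add: pairing_sum_right pairing_pscale_right mult.commute)
    have "(\<Sum>i\<in>J. a i * pairing (Q i) ?q) = a i0 * pairing (Q i0) ?q"
      using J i0 other by (subst sum.remove[of J i0]) auto
    then have "pairing (Q i0) ?q = 0" using a[OF q] i0 by simp
    then have "?q = 0" using other q by (intro nondeg) auto
    then show False using c(1) finG G(2) by (auto simp: cpoly.dependent_finite)
  qed
  show "\<exists>a. \<forall>q\<in>D. f q = (\<Sum>i\<in>J. a i * pairing (Q i) q)" if f: "f \<in> dual_space D" for f
  proof -
    let ?B = "insert None (Some ` J)"
    let ?M = "\<lambda>g k. case k of None \<Rightarrow> f g | Some i \<Rightarrow> pairing (Q i) g"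
    have "card G < card ?B" using J by (simp add: cardG card_image)
    \<comment> \<open>The functional \<open>f\<close> is added as one more unknown; in a solution its coefficient cannot be zero,
      because the functionals \<open>pairing (Q i)\<close> are independent on \<open>D\<close>.\<close>
    from homogeneous_system[OF finG _ this, of ?M] J
    obtain c where c: "\<exists>k\<in>?B. c k \<noteq> 0" "\<And>g. g \<in> G \<Longrightarrow> (\<Sum>k\<in>?B. ?M g k * c k) = 0" by blast
    have rel: "f g * c None + (\<Sum>i\<in>J. c (Some i) * pairing (Q i) g) = 0" if "g \<in> G" for g
      using c(2)[OF that] J by (simp add: sum.reindex mult.commute)
    have f0: "f 0 = 0"
    proof -
      have "f (pscale 0 0) = 0 * f 0" using f cpoly.subspace_0[OF D] unfolding dual_space_def by blast
      then show ?thesis by simp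
    qed
    have "q \<in> D \<and> f q * c None + (\<Sum>i\<in>J. c (Some i) * pairing (Q i) q) = 0" if "q \<in> cpoly.span G" for q
      using that
    proof (induction rule: cpoly.span_induct_alt)
      case base
      then show ?case using cpoly.subspace_0[OF D] by (simp add: f0 pairing_eq_coef)
    next
      case (step a g h)
      have gD: "g \<in> D" using step(1) G(1) L(2) by blast
      then have agD: "pscale a g \<in> D" using D by (simp add: cpoly.subspace_scale)
      have "f (pscale a g + h) = a * f g + f h"
        using f gD agD step(2) unfolding dual_space_def by auto
      then have "f (pscale a g + h) * c None + (\<Sum>i\<in>J. c (Some i) * pairing (Q i) (pscale a g + h))
          = a * (f g * c None + (\<Sum>i\<in>J. c (Some i) * pairing (Q i) g))
            + (f h * c None + (\<Sum>i\<in>J. c (Some i) * pairing (Q i) h))"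
        by (simp add: pairing_add_right pairing_pscale_right sum.distrib sum_distrib_left algebra_simps)
      also have "\<dots> = 0" using rel[OF step(1)] step(2) by simp
      finally show ?case using agD step(2) D by (simp add: cpoly.subspace_add)
    qed
    then have relD: "f q * c None + (\<Sum>i\<in>J. c (Some i) * pairing (Q i) q) = 0" if "q \<in> D" for q
      using that GD by auto
    have "c None \<noteq> 0"
    proof
      assume 0: "c None = 0"
      then have "\<forall>i\<in>J. c (Some i) = 0" using relD by (intro inj) simp
      then show False using c(1) 0 by auto
    qed
    have "f q = (\<Sum>i\<in>J. (- c (Some i) / c None) * pairing (Q i) q)" if "q \<in> D" for q
    proof -
      have "f q * c None = - (\<Sum>i\<in>J. c (Some i) * pairing (Q i) q)"
        using relD[OF that] by (simp add: eq_neg_iff_add_eq_0)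
      then have "f q = - (\<Sum>i\<in>J. c (Some i) * pairing (Q i) q) / c None"
        using \<open>c None \<noteq> 0\<close> by (simp add: field_simps)
      then show ?thesis by (simp add: sum_divide_distrib sum_negf)
    qed
    then show ?thesis by (intro exI[of _ "\<lambda>i. - c (Some i) / c None"]) blast
  qed
qed

lemma subspace_ker_ideal: "cpoly.subspace (ker_ideal J)"
  by (auto simp: cpoly.subspace_def ker_ideal_def diff_op_add_right diff_op_pscale_right)

section \<open>The space P as the kernel of an ideal\<close>

text \<open>The upward closed predicate on subspaces that corresponds to the semi-external family.\<close>

definition spans_above :: "('i \<Rightarrow> real ^ 'n) \<Rightarrow> 'i set set \<Rightarrow> (real ^ 'n) set \<Rightarrow> bool" where
  "spans_above v \<I> S \<longleftrightarrow> (\<exists>I\<in>\<I>. span (v ` I) \<subseteq> S)"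

lemma spans_above_mono: "spans_above v \<I> S \<Longrightarrow> S \<subseteq> S' \<Longrightarrow> spans_above v \<I> S'"
  by (auto simp: spans_above_def)

lemma spans_above_span_iff:
  assumes "semi_external v X \<I>" "I \<in> indep_subsets v X"
  shows "spans_above v \<I> (span (v ` I)) \<longleftrightarrow> I \<in> \<I>"
  using assms unfolding spans_above_def semi_external_def by blast

lemma indep_subset_same_span:
  fixes v :: "'i::linorder \<Rightarrow> real ^ 'n"
  assumes "finite X" "Z \<subseteq> X"
  obtains I where "I \<in> indep_subsets v X" "I \<subseteq> Z" "span (v ` I) = span (v ` Z)"
proof
  have fin: "finite Z" using assms finite_subset by auto
  show "greedy_basis v Z \<subseteq> Z" by (rule greedy_basis_subset)
  then show "greedy_basis v Z \<in> indep_subsets v X"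
    using assms lin_indep_greedy_basis[OF fin] by (auto simp: indep_subsets_def)
  show "span (v ` greedy_basis v Z) = span (v ` Z)" by (rule span_greedy_basis[OF fin])
qed

lemma semi_space_P_eq_good_space:
  fixes v :: "'i::linorder \<Rightarrow> real ^ 'n"
  assumes X: "finite X" and semi: "semi_external v X \<I>"
  shows "semi_space_P v X \<I> = good_space v (spans_above v \<I>) X {0}"
proof -
  have "(\<exists>I\<in>\<I>. Y \<inter> I = {}) \<longleftrightarrow> spans_above v \<I> (span ({0} \<union> v ` (X - Y)))" if "Y \<subseteq> X" for Y
  proof
    assume "\<exists>I\<in>\<I>. Y \<inter> I = {}"
    then obtain I where I: "I \<in> \<I>" "Y \<inter> I = {}" by blast
    have "I \<subseteq> X" using semi I by (auto simp: semi_external_def indep_subsets_def)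
    then have "span (v ` I) \<subseteq> span ({0} \<union> v ` (X - Y))" using I by (intro span_mono) auto
    then show "spans_above v \<I> (span ({0} \<union> v ` (X - Y)))" using I by (auto simp: spans_above_def)
  next
    assume above: "spans_above v \<I> (span ({0} \<union> v ` (X - Y)))"
    obtain I where I: "I \<in> indep_subsets v X" "I \<subseteq> X - Y" "span (v ` I) = span (v ` (X - Y))"
      using indep_subset_same_span[OF X, of "X - Y" v] by blast
    then have "I \<in> \<I>" using above spans_above_span_iff[OF semi I(1)] by simp
    then show "\<exists>I\<in>\<I>. Y \<inter> I = {}" using I(2) by blast
  qed
  then have "Y \<subseteq> X \<and> (\<exists>I\<in>\<I>. Y \<inter> I = {}) \<longleftrightarrow>
      Y \<subseteq> X \<and> spans_above v \<I> (span ({0} \<union> v ` (X - Y)))" for Y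
    by (rule conj_cong[OF refl])
  then show ?thesis unfolding semi_space_P_def good_space_def by (simp only:)
qed

lemma lin_ideal_singleton_0: "lin_ideal {0} = {0}"
proof -
  have "p = 0" if "p \<in> ideal.span {0}" for p :: "'a cpoly"
    using that by (induction rule: ideal.span_induct_alt) auto
  then show ?thesis by (auto simp: lin_ideal_def intro: ideal.span_zero)
qed

lemma ker_semi_ideal_I_iff:
  "q \<in> ker_ideal (semi_ideal_I v X \<I>) \<longleftrightarrow>
    (\<forall>F\<in>facets v X. \<forall>\<eta>. \<eta> \<noteq> 0 \<and> (\<forall>y\<in>F. \<eta> \<bullet> y = 0) \<longrightarrow> diff_op (lin_form \<eta> ^ (num_off v X F + 1)) q = 0) \<and>
    (\<forall>S\<in>missing_spans v X \<I>. \<forall>p\<in>hom_polys_perp (num_off v X S) S. diff_op p q = 0)"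
proof -
  let ?M = "\<Union>S \<in> missing_spans v X \<I>. hom_polys_perp (num_off v X S) S"
  have "q \<in> ker_ideal (semi_ideal_I v X \<I>) \<longleftrightarrow> q \<in> ker_ideal (ideal_I_plus v X) \<and> q \<in> ker_ideal (ideal.span ?M)"
  proof
    assume q: "q \<in> ker_ideal (semi_ideal_I v X \<I>)"
    have "ideal_I_plus v X \<subseteq> semi_ideal_I v X \<I>" "ideal.span ?M \<subseteq> semi_ideal_I v X \<I>"
      unfolding semi_ideal_I_def ideal_I_plus_def by (force intro: ideal.span_zero)+
    then show "q \<in> ker_ideal (ideal_I_plus v X) \<and> q \<in> ker_ideal (ideal.span ?M)"
      using q by (auto simp: ker_ideal_def)
  next
    assume "q \<in> ker_ideal (ideal_I_plus v X) \<and> q \<in> ker_ideal (ideal.span ?M)"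
    then show "q \<in> ker_ideal (semi_ideal_I v X \<I>)"
      by (auto simp: ker_ideal_def semi_ideal_I_def diff_op_add_left)
  qed
  then show ?thesis unfolding ideal_I_plus_def ker_ideal_span by blast
qed

text \<open>For \<open>W = {0}\<close> the degree conditions are the equations imposed by the generators of the ideal: the missing spans
  are the spanned subspaces that are not good, and on a facet hyperplane the normals generate all polynomials
  on the orthogonal complement.\<close>

theorem semi_space_P_eq_ker:
  fixes v :: "'i::linorder \<Rightarrow> real ^ 'n"
  assumes X: "finite X" "\<And>x. x \<in> X \<Longrightarrow> v x \<noteq> 0" "span (v ` X) = UNIV" and semi: "semi_external v X \<I>"
  shows "semi_space_P v X \<I> = ker_ideal (semi_ideal_I v X \<I>)"
proof -
  let ?Good = "spans_above v \<I>"
  have deg_below_iff: "deg_below {0} S k q \<longleftrightarrow> (\<forall>j\<ge>k. \<forall>p\<in>hom_polys_perp j S. diff_op p q = 0)" for S k and q :: "'n cpoly"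
    by (simp add: deg_below_def lin_ideal_singleton_0)
  have "q \<in> semi_space_P v X \<I> \<longleftrightarrow> deg_conditions v ?Good X {0} q" for q
  proof
    assume "q \<in> semi_space_P v X \<I>"
    then have "q \<in> good_space v ?Good X {0}" by (simp add: semi_space_P_eq_good_space[OF X(1) semi])
    then show "deg_conditions v ?Good X {0} q"
      by (rule deg_conditions_good_space[OF X(1), rotated]) (rule spans_above_mono)
  next
    assume K: "deg_conditions v ?Good X {0} q"
    have "\<exists>p \<in> good_space v ?Good X {0}. \<exists>j \<in> lin_ideal {0}. q = p + j"
    proof (rule deg_conditions_imp_good_space[OF X(1) _ _ _ _ K])
      show "?Good S'" if "?Good S" "S \<subseteq> S'" for S S' using that by (rule spans_above_mono)
    qed (use X in auto)
    then show "q \<in> semi_space_P v X \<I>"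
      by (auto simp: lin_ideal_singleton_0 semi_space_P_eq_good_space[OF X(1) semi])
  qed
  moreover have "deg_conditions v ?Good X {0} q \<longleftrightarrow> q \<in> ker_ideal (semi_ideal_I v X \<I>)" for q
  proof
    assume K: "deg_conditions v ?Good X {0} q"
    show "q \<in> ker_ideal (semi_ideal_I v X \<I>)"
      unfolding ker_semi_ideal_I_iff
    proof (intro conjI ballI allI impI)
      fix F \<eta> assume F: "F \<in> facets v X" and \<eta>: "\<eta> \<noteq> 0 \<and> (\<forall>y\<in>F. \<eta> \<bullet> y = 0)"
      obtain Y where Y: "F = span (v ` Y)" "Y \<subseteq> X" "dim F = CARD('n) - 1"
        using F by (auto simp: facets_def)
      have deg_below: "deg_below {0} F (num_off v X F + of_bool (?Good F)) q"
        using Y by (intro deg_conditionsD[OF K, of Y]) auto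
      have "dir_deriv y (lin_form \<eta> ^ (num_off v X F + 1)) = 0" if "y \<in> F" for y
      proof -
        have "y \<bullet> \<eta> = 0" using \<eta> that by (metis inner_commute)
        then show ?thesis
          unfolding Suc_eq_plus1[symmetric] dir_deriv_power dir_deriv_lin_form by simp
      qed
      moreover have "lin_form \<eta> ^ (num_off v X F + 1) \<in> hom_polys (num_off v X F + 1)"
        using hom_power[OF hom_lin_form[of \<eta>], where a = "num_off v X F + 1"] by simp
      ultimately have "lin_form \<eta> ^ (num_off v X F + 1) \<in> hom_polys_perp (num_off v X F + 1) F"
        by (simp add: hom_polys_perp_iff)
      moreover have "num_off v X F + of_bool (?Good F) \<le> num_off v X F + 1" by simp
      ultimately show "diff_op (lin_form \<eta> ^ (num_off v X F + 1)) q = 0"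
        using deg_below unfolding deg_below_iff by blast
    next
      fix S p assume S: "S \<in> missing_spans v X \<I>" and p: "p \<in> hom_polys_perp (num_off v X S) S"
      then obtain I where I: "S = span (v ` I)" "I \<in> indep_subsets v X" "I \<notin> \<I>"
        by (auto simp: missing_spans_def)
      then have "\<not> ?Good S" using spans_above_span_iff[OF semi] by simp
      then have "deg_below {0} S (num_off v X S + of_bool (?Good S)) q"
        using I by (intro deg_conditionsD[OF K, of I]) (auto simp: indep_subsets_def)
      then have "deg_below {0} S (num_off v X S) q" using \<open>\<not> ?Good S\<close> by simp
      then show "diff_op p q = 0" unfolding deg_below_iff using p by blast
    qed
  next
    assume "q \<in> ker_ideal (semi_ideal_I v X \<I>)"
    then have facet: "\<And>F \<eta>. F \<in> facets v X \<Longrightarrow> \<eta> \<noteq> 0 \<Longrightarrow> (\<And>y. y \<in> F \<Longrightarrow> \<eta> \<bullet> y = 0) \<Longrightarrow>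
          diff_op (lin_form \<eta> ^ (num_off v X F + 1)) q = 0"
      and missing: "\<And>S p. S \<in> missing_spans v X \<I> \<Longrightarrow> p \<in> hom_polys_perp (num_off v X S) S \<Longrightarrow> diff_op p q = 0"
      unfolding ker_semi_ideal_I_iff by blast+
    show "deg_conditions v ?Good X {0} q"
    proof (rule deg_conditionsI)
      fix Z S assume Z: "Z \<subseteq> X" "S = span ({0} \<union> v ` Z)" and dimS: "dim S = CARD('n) - 1 \<or> \<not> ?Good S"
      have S: "S = span (v ` Z)" using Z by simp
      have "diff_op p q = 0" if p: "p \<in> hom_polys_perp (num_off v X S + of_bool (?Good S)) S" for p
      proof (cases "?Good S")
        case False
        obtain I where I: "I \<in> indep_subsets v X" "span (v ` I) = S"
          using indep_subset_same_span[OF X(1) Z(1), of v] S by metis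
        then have "I \<notin> \<I>" using False spans_above_span_iff[OF semi] by metis
        then have "S \<in> missing_spans v X \<I>" using I by (auto simp: missing_spans_def)
        then show ?thesis using missing p False by simp
      next
        case True
        then have dim: "dim S = CARD('n) - 1" using dimS by simp
        then have "S \<in> facets v X" unfolding facets_def using Z(1) S by blast
        have "dim S < CARD('n)" using dim by simp
        then have "S \<noteq> UNIV" by (metis dim_UNIV DIM_cart DIM_real mult.right_neutral less_irrefl)
        then obtain x where "x \<notin> S" by blast
        moreover have "subspace S" unfolding S by simp
        ultimately obtain \<eta> where \<eta>: "\<And>s. s \<in> S \<Longrightarrow> s \<bullet> \<eta> = 0" "x \<bullet> \<eta> = 1"
          using orthogonal_component by blast
        then have \<eta>0: "\<eta> \<noteq> 0" by auto
        have \<eta>S: "\<eta> \<bullet> y = 0" if "y \<in> S" for y using \<eta>(1)[OF that] by (simp add: inner_commute)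
        have "span S = S" using \<open>subspace S\<close> by (simp add: span_eq_iff)
        moreover have "\<eta> \<notin> S" using \<eta>(1)[of \<eta>] \<eta>0 by auto
        ultimately have "\<eta> \<notin> span S" by metis
        then have "dim (insert \<eta> S) = DIM(real ^ 'n)" using dim by (simp add: dim_insert)
        then have full: "span (insert \<eta> S) = UNIV" using dim_eq_full by blast
        have "p \<in> hom_polys_perp (num_off v X S + 1) S" using p True by simp
        then obtain c where "p = pscale c (lin_form \<eta> ^ (num_off v X S + 1))"
          using perp_hyperplane[OF full \<eta>0 \<eta>S] by blast
        then show ?thesis
          using facet[OF \<open>S \<in> facets v X\<close> \<eta>0 \<eta>S] by (simp only: diff_op_pscale_left cpoly.scale_zero_right)
      qed
      then show "deg_below {0} S (num_off v X S + of_bool (?Good S)) q"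
        unfolding deg_below_iff using diff_op_perp_upward by blast
    qed
  qed
  ultimately show ?thesis by blast
qed

section \<open>Dimensions and duality\<close>

lemma least_space_subset_semi_space_D:
  assumes X: "finite X" "finite B0" and V: "finite V"
    and inc: "\<And>w. w \<in> V \<Longrightarrow> \<exists>I\<in>\<I>. \<forall>b\<in>greedy_ext v B0 I. v b \<bullet> w = lam b"
  shows "least_space V \<subseteq> semi_space_D v X B0 \<I>"
  unfolding least_space_def least_terms_exp_space[OF V]
proof (rule cpoly.span_minimal)
  show "cpoly.subspace (semi_space_D v X B0 \<I>)"
    unfolding semi_space_D_def by (rule subspace_ker_ideal)
  show "{exp_sum_part V c k | c k. (\<forall>i<k. exp_sum_part V c i = 0) \<and> exp_sum_part V c k \<noteq> 0}
      \<subseteq> semi_space_D v X B0 \<I>"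
    unfolding semi_space_D_def semi_ideal_J_def
  proof (clarsimp simp: ker_ideal_span)
    fix c k Y
    assume 0: "\<forall>i<k. exp_sum_part V c i = 0" and Y: "Y \<subseteq> X \<union> B0" "\<forall>I\<in>\<I>. Y \<inter> greedy_ext v B0 I \<noteq> {}"
    show "diff_op (prod_form v Y) (exp_sum_part V c k) = 0"
    proof (rule diff_op_prod_form_least[where lam = lam])
      show "finite Y" using X Y finite_subset by blast
      show "\<exists>y\<in>Y. v y \<bullet> w = lam y" if "w \<in> V" for w using inc[OF that] Y(2) by blast
      show "exp_sum_part V c i = 0" if "i < k" for i using 0 that by simp
    qed
  qed
qed

text \<open>The components of degree \<open>j\<close> of a combination of homogeneous basis elements come from the elements
  of degree \<open>j\<close> alone.\<close>

lemma dim_homogeneous_part: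
  assumes J: "finite J" and inj: "inj_on Q J" and indep: "cpoly.independent (Q ` J)"
    and hom: "\<And>i. i \<in> J \<Longrightarrow> Q i \<in> hom_polys (d i)"
  shows "cpoly.dim (cpoly.span (Q ` J) \<inter> hom_polys j) = card {i\<in>J. d i = j}"
proof -
  let ?K = "{i\<in>J. d i = j}"
  have "cpoly.span (Q ` J) \<inter> hom_polys j = cpoly.span (Q ` ?K)"
  proof
    show "cpoly.span (Q ` ?K) \<subseteq> cpoly.span (Q ` J) \<inter> hom_polys j"
    proof (rule cpoly.span_minimal)
      show "Q ` ?K \<subseteq> cpoly.span (Q ` J) \<inter> hom_polys j" using hom by (auto intro: cpoly.span_base)
      show "cpoly.subspace (cpoly.span (Q ` J) \<inter> hom_polys j)"
        by (auto simp: cpoly.subspace_def intro: hom_add hom_pscale cpoly.span_add cpoly.span_scale cpoly.span_zero)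
    qed
    show "cpoly.span (Q ` J) \<inter> hom_polys j \<subseteq> cpoly.span (Q ` ?K)"
    proof
      fix p assume p: "p \<in> cpoly.span (Q ` J) \<inter> hom_polys j"
      then obtain u where "p = (\<Sum>q\<in>Q ` J. pscale (u q) q)"
        using J cpoly.span_finite[of "Q ` J"] by auto
      then have u: "p = (\<Sum>i\<in>J. pscale (u (Q i)) (Q i))" by (simp add: sum.reindex[OF inj])
      let ?s = "\<Sum>i\<in>?K. pscale (u (Q i)) (Q i)" and ?r = "\<Sum>i\<in>J - ?K. pscale (u (Q i)) (Q i)"
      have split: "p = ?r + ?s" unfolding u using J by (intro sum.subset_diff) auto
      have "?s \<in> hom_polys j" using hom by (intro hom_sum hom_pscale) auto
      then have r: "?r \<in> hom_polys j" using split p hom_minus[of p j ?s] by simp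
      have "?r = 0"
      proof (rule poly_mapping_eqI)
        fix m
        show "coef ?r m = coef 0 m"
        proof (cases "mdeg m = j")
          case True
          then have "coef (Q i) m = 0" if "i \<in> J - ?K" for i
            using that hom[of i] by (auto simp: hom_polys_iff)
          then show ?thesis by (simp add: lookup_sum)
        next
          case False
          then show ?thesis using r by (auto simp: hom_polys_iff)
        qed
      qed
      moreover have "?s \<in> cpoly.span (Q ` ?K)"
        by (intro cpoly.span_sum cpoly.span_scale cpoly.span_base) auto
      ultimately show "p \<in> cpoly.span (Q ` ?K)" using split by simp
    qed
  qed
  moreover have "cpoly.independent (Q ` ?K)" using indep by (rule cpoly.independent_mono) auto
  moreover have "card (Q ` ?K) = card ?K" using inj by (intro card_image) (auto simp: inj_on_def)
  ultimately show ?thesis by (simp add: cpoly.dim_eq_card_independent)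
qed

lemma Q_poly_hom:
  assumes "finite X"
  shows "Q_poly v X I \<in> hom_polys (val v X I)"
proof -
  have "active_set v X I \<subseteq> X" by (auto simp: active_set_def)
  then show ?thesis
    unfolding Q_poly_def val_def using assms finite_subset by (blast intro: hom_prod_form)
qed

lemma iso_onto_dual_pairing:
  assumes P: "cpoly.subspace P" and D: "cpoly.subspace D"
    and inj: "\<And>p. p \<in> P \<Longrightarrow> (\<And>q. q \<in> D \<Longrightarrow> pairing p q = 0) \<Longrightarrow> p = 0"
    and surj: "\<And>f. f \<in> dual_space D \<Longrightarrow> \<exists>p\<in>P. \<forall>q\<in>D. f q = pairing p q"
  shows "iso_onto_dual (\<lambda>p. restrict (pairing p) D) P D"
proof -
  let ?\<Phi> = "\<lambda>p. restrict (pairing p) D"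
  have "inj_on ?\<Phi> P"
  proof (rule inj_onI)
    fix p p' assume p: "p \<in> P" "p' \<in> P" and eq: "?\<Phi> p = ?\<Phi> p'"
    have "p - p' = 0"
    proof (rule inj)
      show "p - p' \<in> P" using P p by (rule cpoly.subspace_diff)
      fix q assume "q \<in> D"
      then have "pairing p q = pairing p' q" using fun_cong[OF eq, of q] by simp
      then show "pairing (p - p') q = 0" using pairing_add_left[of "p - p'" p' q] by simp
    qed
    then show "p = p'" by simp
  qed
  moreover have "?\<Phi> ` P = dual_space D"
  proof
    show "?\<Phi> ` P \<subseteq> dual_space D"
      using D by (auto simp: dual_space_def cpoly.subspace_add cpoly.subspace_scale
        pairing_add_right pairing_pscale_right)
    show "dual_space D \<subseteq> ?\<Phi> ` P"
    proof
      fix f assume f: "f \<in> dual_space D"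
      then obtain p where p: "p \<in> P" "\<forall>q\<in>D. f q = pairing p q" using surj by blast
      have "f = ?\<Phi> p"
        using f p(2) by (intro extensionalityI[of f D]) (auto simp: dual_space_def)
      then show "f \<in> ?\<Phi> ` P" using p(1) by blast
    qed
  qed
  ultimately show ?thesis
    unfolding iso_onto_dual_def bij_betw_def
    by (auto simp: fun_eq_iff restrict_def pairing_add_left pairing_pscale_left)
qed

theorem theorem2p6:
  fixes v :: "'i::linorder \<Rightarrow> real ^ 'n"
    and X B0 :: "'i set"
    and lam :: "'i \<Rightarrow> real"
    and \<I> :: "'i set set"
  assumes "finite X"
    and "\<forall>x\<in>X. v x \<noteq> 0"
    and "span (v ` X) = UNIV"
    and "is_basis v B0"
    and "X \<inter> B0 = {}"
    and "\<forall>x\<in>X. \<forall>b\<in>B0. x < b"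
    and "simple_arrangement v lam (X \<union> B0)"
    and "semi_external v X \<I>"
    and "bases v X \<subseteq> \<I>"
    and "\<I> \<subseteq> indep_subsets v X"
  shows
    "(inj_on (Q_poly v X) \<I> \<and> cpoly.independent (Q_poly v X ` \<I>) \<and>
      cpoly.span (Q_poly v X ` \<I>) = semi_space_P v X \<I> \<and>
      cpoly.dim (semi_space_P v X \<I>) = card \<I> \<and>
      (\<forall>j. cpoly.dim (semi_space_P v X \<I> \<inter> hom_polys j) = card {I \<in> \<I>. val v X I = j})) \<and>
     (semi_space_D v X B0 \<I> = least_space ((\<lambda>I. vertex v lam (greedy_ext v B0 I)) ` \<I>) \<and>
      cpoly.dim (semi_space_D v X B0 \<I>) = card \<I>) \<and>
     (semi_ideal_J v X B0 \<I> \<inter> semi_space_P v X \<I> = {0} \<and>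
      {p + q | p q. p \<in> semi_ideal_J v X B0 \<I> \<and> q \<in> semi_space_P v X \<I>} = UNIV) \<and>
     semi_space_P v X \<I> = ker_ideal (semi_ideal_I v X \<I>) \<and>
     iso_onto_dual (\<lambda>p. restrict (pairing p) (semi_space_D v X B0 \<I>))
       (semi_space_P v X \<I>) (semi_space_D v X B0 \<I>)"
proof -
  let ?Q = "Q_poly v X" and ?P = "semi_space_P v X \<I>" and ?D = "semi_space_D v X B0 \<I>"
    and ?J = "semi_ideal_J v X B0 \<I>"
  let ?vert = "\<lambda>I. vertex v lam (greedy_ext v B0 I)"
  have finB0: "finite B0" "span (v ` B0) = UNIV"
    using is_basis_finite_card(1)[OF assms(4)] assms(4) by (auto simp: is_basis_def)
  have less: "x < b" if "x \<in> X" "b \<in> B0" for x b using assms(6) that by blast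
  have "\<I> \<subseteq> Pow X" using assms(10) by (auto simp: indep_subsets_def)
  then have fin: "finite \<I>" using assms(1) by (meson finite_Pow_iff finite_subset)
  have ext: "is_basis v (greedy_ext v B0 I)" "greedy_ext v B0 I \<subseteq> X \<union> B0" "greedy_ext v B0 I \<inter> X = I"
    if "I \<in> \<I>" for I
  proof -
    have I: "I \<in> indep_subsets v X" "I \<subseteq> X" using that assms(10) by (auto simp: indep_subsets_def)
    note * = greedy_ext_basis[OF assms(1) finB0 less I(1)]
    show "is_basis v (greedy_ext v B0 I)" by (rule *(1))
    show "greedy_ext v B0 I \<subseteq> X \<union> B0" using *(3) I(2) by blast
    show "greedy_ext v B0 I \<inter> X = I" using *(2,3) I(2) assms(5) by blast
  qed
  have inc: "v x \<bullet> ?vert I = lam x \<longleftrightarrow> x \<in> greedy_ext v B0 I" if "I \<in> \<I>" "x \<in> X \<union> B0" for I x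
    using vertex_incidence[OF assms(7) ext(1,2)[OF that(1)] that(2)] .
  have "inj_on ?vert \<I>"
  proof (rule inj_onI)
    fix I I' assume I: "I \<in> \<I>" "I' \<in> \<I>" and eq: "?vert I = ?vert I'"
    have "x \<in> greedy_ext v B0 I \<longleftrightarrow> x \<in> greedy_ext v B0 I'" if "x \<in> X" for x
      using inc[OF I(1), of x] inc[OF I(2), of x] that eq by simp
    then show "I = I'" using ext(3)[OF I(1)] ext(3)[OF I(2)] by blast
  qed
  then have cardV: "card (?vert ` \<I>) = card \<I>" by (rule card_image)
  have finV: "finite (?vert ` \<I>)" using fin by simp
  have sum: "{p + q | p q. p \<in> ?J \<and> q \<in> ?P} = UNIV"
    by (rule semi_ideal_J_plus_semi_space_P[OF assms(1) finB0 assms(5) less assms(10)])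
  have spanQ: "cpoly.span (?Q ` \<I>) = ?P"
    by (rule span_Q_eq_semi_space_P[OF assms(1,8)])
  have J_D: "pairing p q = 0" if "p \<in> ?J" "q \<in> ?D" for p q
    using that by (auto simp: semi_space_D_def ker_ideal_def pairing_eq_coef)
  have nondeg: "\<forall>q\<in>?D. (\<forall>I\<in>\<I>. pairing (?Q I) q = 0) \<longrightarrow> q = 0"
  proof (intro ballI impI)
    fix q assume q: "q \<in> ?D" and 0: "\<forall>I\<in>\<I>. pairing (?Q I) q = 0"
    have P0: "pairing p q = 0" if "p \<in> ?P" for p
      using that unfolding spanQ[symmetric]
      by (induction rule: cpoly.span_induct_alt) (use 0 in \<open>auto simp: pairing_add_left pairing_pscale_left\<close>)
    show "q = 0"
    proof (rule pairing_nondegenerate)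
      fix p
      have "p \<in> {p + q | p q. p \<in> ?J \<and> q \<in> ?P}" using sum by simp
      then show "pairing p q = 0" using J_D[OF _ q] P0 by (auto simp: pairing_add_left)
    qed
  qed
  have sub: "cpoly.subspace ?D" "cpoly.subspace (least_space (?vert ` \<I>))" "cpoly.subspace ?P"
    unfolding semi_space_D_def least_space_def spanQ[symmetric]
    by (rule subspace_ker_ideal cpoly.subspace_span)+
  have least_D: "least_space (?vert ` \<I>) \<subseteq> ?D"
  proof (rule least_space_subset_semi_space_D[OF assms(1) finB0(1) finV])
    fix w assume "w \<in> ?vert ` \<I>"
    then show "\<exists>I\<in>\<I>. \<forall>b\<in>greedy_ext v B0 I. v b \<bullet> w = lam b"
      using inc ext(2) by blast
  qed
  have lower: "\<forall>G. finite G \<and> least_space (?vert ` \<I>) \<subseteq> cpoly.span G \<longrightarrow> card \<I> \<le> card G"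
    using card_le_of_least_space_subset_span[OF finV] unfolding cardV by blast
  note perfect = perfect_pairing[OF fin sub(1,2) least_D nondeg lower]
  have zero: "\<forall>I\<in>\<I>. a I = 0" if "\<And>q. q \<in> ?D \<Longrightarrow> pairing (\<Sum>I\<in>\<I>. pscale (a I) (?Q I)) q = 0" for a
    using that by (intro perfect(3)) (simp add: pairing_sum_left pairing_pscale_left)
  have inj: "inj_on ?Q \<I>"
  proof (rule inj_onI, rule ccontr)
    fix I I' assume I: "I \<in> \<I>" "I' \<in> \<I>" "?Q I = ?Q I'" "I \<noteq> I'"
    let ?\<delta> = "\<lambda>I K. if K = I then 1 else 0 :: complex"
    have \<delta>: "(\<Sum>K\<in>\<I>. pscale (?\<delta> I K) (?Q K)) = ?Q I" if "I \<in> \<I>" for I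
    proof -
      have "(\<Sum>K\<in>\<I>. pscale (?\<delta> I K) (?Q K)) = (\<Sum>K\<in>\<I>. if K = I then ?Q I else 0)"
        by (rule sum.cong) auto
      then show ?thesis using that fin by simp
    qed
    have "(\<Sum>K\<in>\<I>. pscale (?\<delta> I K - ?\<delta> I' K) (?Q K)) = 0"
      unfolding cpoly.scale_left_diff_distrib sum_subtractf using I \<delta> by simp
    then have "\<forall>K\<in>\<I>. ?\<delta> I K - ?\<delta> I' K = 0" by (intro zero) (simp only: pairing_zero_left)
    then have "?\<delta> I I - ?\<delta> I' I = 0" using I(1) by blast
    then show False using I(4) by simp
  qed
  have indep: "cpoly.independent (?Q ` \<I>)"
  proof
    assume "cpoly.dependent (?Q ` \<I>)"
    then obtain u I where u: "I \<in> \<I>" "u (?Q I) \<noteq> 0" "(\<Sum>q\<in>?Q ` \<I>. pscale (u q) q) = 0"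
      using fin by (auto simp: cpoly.dependent_finite)
    then have "(\<Sum>I\<in>\<I>. pscale (u (?Q I)) (?Q I)) = 0" by (simp add: sum.reindex[OF inj])
    then have "\<forall>I\<in>\<I>. u (?Q I) = 0" by (intro zero) simp
    then show False using u by blast
  qed
  have P_sum: "\<exists>a. p = (\<Sum>I\<in>\<I>. pscale (a I) (?Q I))" if p: "p \<in> ?P" for p
  proof -
    obtain u where "p = (\<Sum>q\<in>?Q ` \<I>. pscale (u q) q)"
      using p fin cpoly.span_finite[of "?Q ` \<I>"] unfolding spanQ[symmetric] by auto
    then have "p = (\<Sum>I\<in>\<I>. pscale (u (?Q I)) (?Q I))" by (simp add: sum.reindex[OF inj])
    then show ?thesis by (intro exI[of _ "\<lambda>I. u (?Q I)"])
  qed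
  have P_inj: "p = 0" if p: "p \<in> ?P" "\<And>q. q \<in> ?D \<Longrightarrow> pairing p q = 0" for p
  proof -
    obtain a where a: "p = (\<Sum>I\<in>\<I>. pscale (a I) (?Q I))" using P_sum[OF p(1)] by blast
    then have "\<forall>I\<in>\<I>. a I = 0" using p(2) by (intro zero) simp
    then show ?thesis unfolding a by simp
  qed
  have dimP: "cpoly.dim ?P = card \<I>"
    unfolding spanQ[symmetric] using indep inj by (simp add: cpoly.dim_eq_card_independent card_image)
  have hilbert: "cpoly.dim (?P \<inter> hom_polys j) = card {I \<in> \<I>. val v X I = j}" for j
    unfolding spanQ[symmetric] using fin inj indep Q_poly_hom[OF assms(1)] by (rule dim_homogeneous_part)
  have direct: "?J \<inter> ?P = {0}"
    using P_inj J_D cpoly.subspace_0[OF sub(3)] cpoly.subspace_0[OF subspace_semi_ideal_J] by blast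
  have ker: "?P = ker_ideal (semi_ideal_I v X \<I>)"
    using assms(2) by (intro semi_space_P_eq_ker assms(1,3,8)) blast
  have iso: "iso_onto_dual (\<lambda>p. restrict (pairing p) ?D) ?P ?D"
  proof (rule iso_onto_dual_pairing[OF sub(3,1) P_inj])
    fix f assume "f \<in> dual_space ?D"
    then obtain a where a: "\<forall>q\<in>?D. f q = (\<Sum>I\<in>\<I>. a I * pairing (?Q I) q)" using perfect(4) by blast
    have "(\<Sum>I\<in>\<I>. pscale (a I) (?Q I)) \<in> ?P"
      unfolding spanQ[symmetric] by (intro cpoly.span_sum cpoly.span_scale cpoly.span_base) auto
    moreover have "\<forall>q\<in>?D. f q = pairing (\<Sum>I\<in>\<I>. pscale (a I) (?Q I)) q"
      using a by (simp add: pairing_sum_left pairing_pscale_left)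
    ultimately show "\<exists>p\<in>?P. \<forall>q\<in>?D. f q = pairing p q" by blast
  qed
  show ?thesis
    using inj indep spanQ dimP hilbert perfect(1,2) direct sum ker iso by blast
qed

end
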